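(* Let $1\to I\to M\xrightarrow{\pi}Q\to1$ be an exact sequence of multiplicative Lie algebras, let $A$ be an abelian multiplicative Lie algebra, and let $\chi=\{\sigma,\tau,\nu\}$ be action terms for $(M,A)$ which are realized by some extension of $A$ by $M$. If $H^{0}(M,A,\chi)=0$, then the sequence $$1\to H^{1}(Q,A^{I},\hat\chi)\xrightarrow{\ \mathrm{inf}\ }H^{1}(M,A,\chi)\xrightarrow{\ \mathrm{res}\ }H^{1}(I,A,\chi_I)^{\square}\xrightarrow{\ \partial\ }H^{2}(Q,A^{I},\hat\chi)\xrightarrow{\ \mathrm{inf}\ }H^{2}(M,A,\chi)$$ (inflation, restriction, transgression, inflation) is exact.
   Context: A multiplicative Lie algebra is a group with a binary operation $\{\,,\}$ such that, with $x^{z}:=zxz^{-1}$, for all $x,y,z$: $\{x,x\}=1$; $\{x,yz\}=\{x,y\}\{x,z\}^{y}$; $\{xy,z\}=\{y,z\}^{x}\{x,z\}$; $\{\{x,y\},z^{y}\}\{\{y,z\},x^{z}\}\{\{z,x\},y^{x}\}=1$; $\{x,y\}^{z}=\{x^{z},y^{z}\}$. It is abelian if its group is commutative (then written additively, neutral element $0$) and its bracket is trivial. $I$ is identified with an ideal of $M$. Action terms for $(M,A)$, $A$ abelian: functions $\sigma:M\to\mathrm{Aut}\,A$, $\tau:M\times A\to A$, $\nu:A\times M\to A$, written $\sigma_m(a),\tau_m(a),\nu_m(a)$, with $\tau_m(0)=\nu_m(0)=0$. They are realized by an extension $1\to A\to E\to M\to1$ if for some section $l$ with $l(1)=1$: $\sigma_m(a)=l(m)al(m)^{-1}$,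 $\tau_m(a)=\{l(m),a\}$, $\nu_m(a)=\{a,l(m)\}$. Cohomology of $(P,B,\chi)$, where $B$ is abelian, $P$ a multiplicative Lie algebra and $\chi$ action terms for $(P,B)$: - $H^{0}(P,B,\chi)=\{a\in B:\sigma_x(a)=a\ \forall x\in P\}$. - A derivation is a map $d:P\to B$ with $d(xy)=d(x)+\sigma_x(d(y))$ and $d(\{x,y\})=\tau_x(d(y))+d(x)+d(y)+\sigma_{\{x,y\}}(\nu_y(d(x))-d(x)-d(y))$. Principal derivations are $d_a(x)=a-\sigma_x(a)$, $a\in B$. $H^{1}(P,B,\chi)$ is the group of derivations modulo principal derivations. - A compatible 2-cocycle is a pair $S,S_f:P^2\to B$ with $S(x,1)=S(1,x)=0$, $S_f(x,x)=S_f(x,1)=S_f(1,x)=0$ such that $B\times P$ with $\langle a,x\rangle\langle b,y\rangle=\langle a+\sigma_x(b)+S(x,y),xy\rangle$, $\{\langle a,x\rangle,\langle b,y\rangle\}=\langle a+b+\tau_x(b)+S_f(x,y)+\sigma_{\{x,y\}}(\nu_y(a)-a-b),\{x,y\}\rangle$ is a multiplicative Lie algebra. 2-coboundaries are the pairs $G(x,y)=h(x)+\sigma_x(h(y))-h(xy)$, $G_f(x,y)=\tau_x(h(y))+h(x)+h(y)+\sigma_{\{x,y\}}(\nu_y(h(x))-h(x)-h(y))-h(\{x,y\})$ with $h:P\to B$. $H^{2}(P,B,\chi)$ is the group of compatible 2-cocycles (pointwise addition) modulo 2-coboundaries. $A^{I}=\{a\in A:\sigma_n(a)=a,\ \tau_n(a)=\nu_n(a)=0\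 \forall n\in I\}$. $\hat\chi=\{\hat\sigma,\hat\tau,\hat\nu\}$ are the induced action terms for $(Q,A^{I})$: $\hat\sigma_q(a)=\sigma_m(a)$, $\hat\tau_q(a)=\tau_m(a)$, $\hat\nu_q(a)=\nu_m(a)$ for any $m\in M$ with $\pi(m)=q$. $\chi_I$ is the restriction of $\chi$ to $(I,A)$. A derivation $d:I\to A$ of $(I,A,\chi_I)$ satisfies the $\square$-condition if there is $\eta:M\to A$ with $\eta(1)=0$ such that for all $m\in M,n\in I$: $\sigma_m(d(m^{-1}nm))-d(n)=\sigma_n(\eta(m))-\eta(m)$ and $d(\{m,n\})-\tau_m(d(n))+\sigma_{\{m,n\}}(d(n))-d(n)=\eta(m)+\sigma_{\{m,n\}}(\nu_n(\eta(m))-\eta(m))$. $H^{1}(I,A,\chi_I)^{\square}$ is the set (a subgroup) of classes $[d]\in H^{1}(I,A,\chi_I)$ with $d$ satisfying the $\square$-condition. Maps: restriction is $[d]\mapsto[d|_I]$; inflation is precomposition with $\pi$, i.e. $[d]\mapsto[d\circ\pi]$ and $[\{S,S_f\}]\mapsto[\{S(\pi(\cdot),\pi(\cdot)),S_f(\pi(\cdot),\pi(\cdot))\}]$ (values in $A^I\subseteq A$). Transgression: fix a section $l:Q\to M$ of $\pi$ with $l(1)=1$ and put $T^{s}(x,y)=l(x)l(y)l(xy)^{-1}$, $T^{s}_f(x,y)=\{l(x),l(y)\}l(\{x,y\})^{-1}$ (elements of $I$). For $d$ satisfying the $\square$-condition choose a witness $\tilde\eta:M\to A$ with $\tilde\eta|_I=d$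 and set $\eta(x)=\tilde\eta(l(x))$ for $x\in Q$. Then $\partial([d])$ is the class of the 2-cocycle $$\partial(d)(x,y)=\eta(x)+\sigma_{l(x)}(\eta(y))-\sigma_{T^{s}(x,y)}(\eta(xy))-d(T^{s}(x,y)),$$ $$\partial(d)_f(x,y)=\eta(x)+\eta(y)+\tau_{l(x)}(\eta(y))+\sigma_{\{l(x),l(y)\}}\big(\nu_{l(y)}(\eta(x))-\eta(x)-\eta(y)\big)-\sigma_{T^{s}_f(x,y)}(\eta(\{x,y\}))-d(T^{s}_f(x,y)).$$ *)

theory Defs
  imports "HOL-Algebra.Product_Groups" "HOL-Algebra.Elementary_Groups"
begin

section \<open>Multiplicative Lie algebras\<close>

record 'a mlie = "'a monoid" +
  bracket :: "'a \<Rightarrow> 'a \<Rightarrow> 'a"  (\<open>\<lbrace>_,/ _\<rbrace>\<index>\<close>)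

text \<open>\<open>conj_by G x z\<close> is \<open>x\<close> with exponent \<open>z\<close>, a left conjugation: \<open>z x z\<inverse>\<close>.\<close>

definition conj_by :: "('a, 'b) monoid_scheme \<Rightarrow> 'a \<Rightarrow> 'a \<Rightarrow> 'a" where
  "conj_by G x z = z \<otimes>\<^bsub>G\<^esub> x \<otimes>\<^bsub>G\<^esub> inv\<^bsub>G\<^esub> z"

locale mult_lie_algebra = group M for M :: "('a, 'b) mlie_scheme" (structure) +
  assumes bracket_closed:
    "\<lbrakk>x \<in> carrier M; y \<in> carrier M\<rbrakk> \<Longrightarrow> \<lbrace>x, y\<rbrace> \<in> carrier M"
  and bracket_self:
    "x \<in> carrier M \<Longrightarrow> \<lbrace>x, x\<rbrace> = \<one>"
  and bracket_mult_right:
    "\<lbrakk>x \<in> carrier M; y \<in> carrier M; z \<in> carrier M\<rbrakk>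
      \<Longrightarrow> \<lbrace>x, y \<otimes> z\<rbrace> = \<lbrace>x, y\<rbrace> \<otimes> conj_by M \<lbrace>x, z\<rbrace> y"
  and bracket_mult_left:
    "\<lbrakk>x \<in> carrier M; y \<in> carrier M; z \<in> carrier M\<rbrakk>
      \<Longrightarrow> \<lbrace>x \<otimes> y, z\<rbrace> = conj_by M \<lbrace>y, z\<rbrace> x \<otimes> \<lbrace>x, z\<rbrace>"
  and bracket_jacobi:
    "\<lbrakk>x \<in> carrier M; y \<in> carrier M; z \<in> carrier M\<rbrakk>
      \<Longrightarrow> \<lbrace>\<lbrace>x, y\<rbrace>, conj_by M z y\<rbrace> \<otimes> \<lbrace>\<lbrace>y, z\<rbrace>, conj_by M x z\<rbrace> \<otimes> \<lbrace>\<lbrace>z, x\<rbrace>, conj_by M y x\<rbrace> = \<one>"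
  and bracket_conj:
    "\<lbrakk>x \<in> carrier M; y \<in> carrier M; z \<in> carrier M\<rbrakk>
      \<Longrightarrow> conj_by M \<lbrace>x, y\<rbrace> z = \<lbrace>conj_by M x z, conj_by M y z\<rbrace>"

text \<open>Abelian multiplicative Lie algebras are written multiplicatively throughout, so that
  \<open>\<otimes>\<close>, \<open>inv\<close> and \<open>\<one>\<close> of the coefficients stand for the \<open>+\<close>, \<open>-\<close> and \<open>0\<close> of the usual formulas.\<close>

locale abelian_mult_lie_algebra = mult_lie_algebra + comm_group M +
  assumes bracket_trivial: "\<lbrakk>x \<in> carrier M; y \<in> carrier M\<rbrakk> \<Longrightarrow> \<lbrace>x, y\<rbrace> = \<one>"

definition mlie_hom :: "('a, 'c) mlie_scheme \<Rightarrow> ('b, 'd) mlie_scheme \<Rightarrow> ('a \<Rightarrow> 'b) set" where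
  "mlie_hom G H = {f \<in> hom G H. \<forall>x\<in>carrier G. \<forall>y\<in>carrier G. f \<lbrace>x, y\<rbrace>\<^bsub>G\<^esub> = \<lbrace>f x, f y\<rbrace>\<^bsub>H\<^esub>}"

definition mlie_short_exact ::
  "'k mlie \<Rightarrow> 'e mlie \<Rightarrow> 'p mlie \<Rightarrow> ('k \<Rightarrow> 'e) \<Rightarrow> ('e \<Rightarrow> 'p) \<Rightarrow> bool" where
  "mlie_short_exact K E P i p \<longleftrightarrow>
     mult_lie_algebra K \<and> mult_lie_algebra E \<and> mult_lie_algebra P \<and>
     i \<in> mlie_hom K E \<and> p \<in> mlie_hom E P \<and>
     inj_on i (carrier K) \<and> i ` carrier K = kernel E P p \<and> p ` carrier E = carrier P"

definition normalized_section :: "'e mlie \<Rightarrow> 'p mlie \<Rightarrow> ('e \<Rightarrow> 'p) \<Rightarrow> ('p \<Rightarrow> 'e) \<Rightarrow> bool" where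
  "normalized_section E P p l \<longleftrightarrow>
     l \<in> carrier P \<rightarrow> carrier E \<and> (\<forall>x\<in>carrier P. p (l x) = x) \<and> l \<one>\<^bsub>P\<^esub> = \<one>\<^bsub>E\<^esub>"


section \<open>Action terms\<close>

text \<open>Only the values on the carriers matter; in particular the restriction of \<open>\<chi>\<close> to a
  subalgebra is represented by \<open>\<chi>\<close> itself.\<close>

record ('p, 'b) action =
  sigma :: "'p \<Rightarrow> 'b \<Rightarrow> 'b"
  tau :: "'p \<Rightarrow> 'b \<Rightarrow> 'b"
  nu :: "'b \<Rightarrow> 'p \<Rightarrow> 'b"

text \<open>The argument order of \<open>nu\<close> follows \<open>\<nu> : A \<times> M \<rightarrow> A\<close>, so \<open>nu \<chi> a m\<close> is \<open>\<nu>\<^sub>m(a)\<close>.\<close>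

definition action_terms :: "'p mlie \<Rightarrow> 'b mlie \<Rightarrow> ('p, 'b) action \<Rightarrow> bool" where
  "action_terms P B \<chi> \<longleftrightarrow>
     (\<forall>m\<in>carrier P. sigma \<chi> m \<in> mlie_hom B B \<and> bij_betw (sigma \<chi> m) (carrier B) (carrier B)) \<and>
     (\<forall>m\<in>carrier P. \<forall>a\<in>carrier B. tau \<chi> m a \<in> carrier B \<and> nu \<chi> a m \<in> carrier B) \<and>
     (\<forall>m\<in>carrier P. tau \<chi> m \<one>\<^bsub>B\<^esub> = \<one>\<^bsub>B\<^esub> \<and> nu \<chi> \<one>\<^bsub>B\<^esub> m = \<one>\<^bsub>B\<^esub>)"

definition realized_by ::
  "'p mlie \<Rightarrow> 'b mlie \<Rightarrow> ('p, 'b) action \<Rightarrow> 'e mlie \<Rightarrow> ('b \<Rightarrow> 'e) \<Rightarrow> ('e \<Rightarrow> 'p) \<Rightarrow> bool" where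
  "realized_by P B \<chi> E i p \<longleftrightarrow>
     mlie_short_exact B E P i p \<and>
     (\<exists>l. normalized_section E P p l \<and>
        (\<forall>m\<in>carrier P. \<forall>a\<in>carrier B.
           i (sigma \<chi> m a) = l m \<otimes>\<^bsub>E\<^esub> i a \<otimes>\<^bsub>E\<^esub> inv\<^bsub>E\<^esub> (l m) \<and>
           i (tau \<chi> m a) = \<lbrace>l m, i a\<rbrace>\<^bsub>E\<^esub> \<and>
           i (nu \<chi> a m) = \<lbrace>i a, l m\<rbrace>\<^bsub>E\<^esub>))"

text \<open>The expression \<open>a + b + \<tau>\<^sub>x(b) + \<sigma>\<^bsub>{x,y}\<^esub>(\<nu>\<^sub>y(a) - a - b)\<close> shared by the derivation,
  cocycle, coboundary and transgression formulas.\<close>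

definition bracket_part ::
  "'p mlie \<Rightarrow> 'b mlie \<Rightarrow> ('p, 'b) action \<Rightarrow> 'p \<Rightarrow> 'p \<Rightarrow> 'b \<Rightarrow> 'b \<Rightarrow> 'b" where
  "bracket_part P B \<chi> x y a b =
     a \<otimes>\<^bsub>B\<^esub> b \<otimes>\<^bsub>B\<^esub> tau \<chi> x b
     \<otimes>\<^bsub>B\<^esub> sigma \<chi> \<lbrace>x, y\<rbrace>\<^bsub>P\<^esub> (nu \<chi> a y \<otimes>\<^bsub>B\<^esub> inv\<^bsub>B\<^esub> a \<otimes>\<^bsub>B\<^esub> inv\<^bsub>B\<^esub> b)"


section \<open>Cohomology in degrees 0, 1, 2\<close>

definition H0 :: "'p mlie \<Rightarrow> 'b mlie \<Rightarrow> ('p, 'b) action \<Rightarrow> 'b set" where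
  "H0 P B \<chi> = {a \<in> carrier B. \<forall>x\<in>carrier P. sigma \<chi> x a = a}"

text \<open>Maps defined on a carrier are extensional, so that function equality is equality on the
  carrier and cochains form a \<^const>\<open>product_group\<close>.\<close>

definition derivations :: "'p mlie \<Rightarrow> 'b mlie \<Rightarrow> ('p, 'b) action \<Rightarrow> ('p \<Rightarrow> 'b) set" where
  "derivations P B \<chi> =
     {d \<in> carrier P \<rightarrow>\<^sub>E carrier B.
        \<forall>x\<in>carrier P. \<forall>y\<in>carrier P.
          d (x \<otimes>\<^bsub>P\<^esub> y) = d x \<otimes>\<^bsub>B\<^esub> sigma \<chi> x (d y) \<and>
          d \<lbrace>x, y\<rbrace>\<^bsub>P\<^esub> = bracket_part P B \<chi> x y (d x) (d y)}"

definition principal_derivations :: "'p mlie \<Rightarrow> 'b mlie \<Rightarrow> ('p, 'b) action \<Rightarrow> ('p \<Rightarrow> 'b) set" where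
  "principal_derivations P B \<chi> =
     {(\<lambda>x\<in>carrier P. a \<otimes>\<^bsub>B\<^esub> inv\<^bsub>B\<^esub> (sigma \<chi> x a)) | a. a \<in> carrier B}"

definition derivation_group :: "'p mlie \<Rightarrow> 'b mlie \<Rightarrow> ('p, 'b) action \<Rightarrow> ('p \<Rightarrow> 'b) monoid" where
  "derivation_group P B \<chi> = (product_group (carrier P) (\<lambda>_. B))\<lparr>carrier := derivations P B \<chi>\<rparr>"

definition H1 :: "'p mlie \<Rightarrow> 'b mlie \<Rightarrow> ('p, 'b) action \<Rightarrow> ('p \<Rightarrow> 'b) set monoid" where
  "H1 P B \<chi> = derivation_group P B \<chi> Mod principal_derivations P B \<chi>"

definition H1_class :: "'p mlie \<Rightarrow> 'b mlie \<Rightarrow> ('p, 'b) action \<Rightarrow> ('p \<Rightarrow> 'b) \<Rightarrow> ('p \<Rightarrow> 'b) set" where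
  "H1_class P B \<chi> d = principal_derivations P B \<chi> #>\<^bsub>derivation_group P B \<chi>\<^esub> d"

definition cocycle_algebra ::
  "'p mlie \<Rightarrow> 'b mlie \<Rightarrow> ('p, 'b) action \<Rightarrow> ('p \<times> 'p \<Rightarrow> 'b) \<Rightarrow> ('p \<times> 'p \<Rightarrow> 'b) \<Rightarrow> ('b \<times> 'p) mlie"
  where
  "cocycle_algebra P B \<chi> S Sf =
     \<lparr>carrier = carrier B \<times> carrier P,
      monoid.mult = (\<lambda>(a, x) (b, y). (a \<otimes>\<^bsub>B\<^esub> sigma \<chi> x b \<otimes>\<^bsub>B\<^esub> S (x, y), x \<otimes>\<^bsub>P\<^esub> y)),
      one = (\<one>\<^bsub>B\<^esub>, \<one>\<^bsub>P\<^esub>),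
      bracket = (\<lambda>(a, x) (b, y).
        (bracket_part P B \<chi> x y a b \<otimes>\<^bsub>B\<^esub> Sf (x, y), \<lbrace>x, y\<rbrace>\<^bsub>P\<^esub>))\<rparr>"

definition cocycles ::
  "'p mlie \<Rightarrow> 'b mlie \<Rightarrow> ('p, 'b) action \<Rightarrow> (('p \<times> 'p \<Rightarrow> 'b) \<times> ('p \<times> 'p \<Rightarrow> 'b)) set" where
  "cocycles P B \<chi> =
     {(S, Sf). S \<in> carrier P \<times> carrier P \<rightarrow>\<^sub>E carrier B \<and>
               Sf \<in> carrier P \<times> carrier P \<rightarrow>\<^sub>E carrier B \<and>
        (\<forall>x\<in>carrier P. S (x, \<one>\<^bsub>P\<^esub>) = \<one>\<^bsub>B\<^esub> \<and> S (\<one>\<^bsub>P\<^esub>, x) = \<one>\<^bsub>B\<^esub> \<and>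
           Sf (x, x) = \<one>\<^bsub>B\<^esub> \<and> Sf (x, \<one>\<^bsub>P\<^esub>) = \<one>\<^bsub>B\<^esub> \<and> Sf (\<one>\<^bsub>P\<^esub>, x) = \<one>\<^bsub>B\<^esub>) \<and>
        mult_lie_algebra (cocycle_algebra P B \<chi> S Sf)}"

text \<open>The normalization of \<open>h\<close> is forced: the first coboundary formula gives \<open>G(1,1) = h(1)\<close> when
  \<open>\<sigma>\<^sub>1\<close> is the identity, and cocycles are normalized.\<close>

definition coboundaries ::
  "'p mlie \<Rightarrow> 'b mlie \<Rightarrow> ('p, 'b) action \<Rightarrow> (('p \<times> 'p \<Rightarrow> 'b) \<times> ('p \<times> 'p \<Rightarrow> 'b)) set" where
  "coboundaries P B \<chi> =
     {(\<lambda>(x, y)\<in>carrier P \<times> carrier P.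
         h x \<otimes>\<^bsub>B\<^esub> sigma \<chi> x (h y) \<otimes>\<^bsub>B\<^esub> inv\<^bsub>B\<^esub> h (x \<otimes>\<^bsub>P\<^esub> y),
       \<lambda>(x, y)\<in>carrier P \<times> carrier P.
         bracket_part P B \<chi> x y (h x) (h y) \<otimes>\<^bsub>B\<^esub> inv\<^bsub>B\<^esub> h \<lbrace>x, y\<rbrace>\<^bsub>P\<^esub>)
      | h. h \<in> carrier P \<rightarrow> carrier B \<and> h \<one>\<^bsub>P\<^esub> = \<one>\<^bsub>B\<^esub>}"

definition cocycle_group ::
  "'p mlie \<Rightarrow> 'b mlie \<Rightarrow> ('p, 'b) action \<Rightarrow> (('p \<times> 'p \<Rightarrow> 'b) \<times> ('p \<times> 'p \<Rightarrow> 'b)) monoid" where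
  "cocycle_group P B \<chi> =
     (product_group (carrier P \<times> carrier P) (\<lambda>_. B) \<times>\<times> product_group (carrier P \<times> carrier P) (\<lambda>_. B))
       \<lparr>carrier := cocycles P B \<chi>\<rparr>"

definition H2 ::
  "'p mlie \<Rightarrow> 'b mlie \<Rightarrow> ('p, 'b) action \<Rightarrow> (('p \<times> 'p \<Rightarrow> 'b) \<times> ('p \<times> 'p \<Rightarrow> 'b)) set monoid" where
  "H2 P B \<chi> = cocycle_group P B \<chi> Mod coboundaries P B \<chi>"

definition H2_class ::
  "'p mlie \<Rightarrow> 'b mlie \<Rightarrow> ('p, 'b) action \<Rightarrow> ('p \<times> 'p \<Rightarrow> 'b) \<times> ('p \<times> 'p \<Rightarrow> 'b)
    \<Rightarrow> (('p \<times> 'p \<Rightarrow> 'b) \<times> ('p \<times> 'p \<Rightarrow> 'b)) set" where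
  "H2_class P B \<chi> c = coboundaries P B \<chi> #>\<^bsub>cocycle_group P B \<chi>\<^esub> c"


section \<open>Invariants and induced action terms\<close>

definition invariants :: "'m set \<Rightarrow> 'a mlie \<Rightarrow> ('m, 'a) action \<Rightarrow> 'a set" where
  "invariants I A \<chi> =
     {a \<in> carrier A. \<forall>n\<in>I. sigma \<chi> n a = a \<and> tau \<chi> n a = \<one>\<^bsub>A\<^esub> \<and> nu \<chi> a n = \<one>\<^bsub>A\<^esub>}"

text \<open>Here and below \<^const>\<open>the_elem\<close> selects the common value of an expression over all admissible
  choices; it is meaningful precisely when the expression does not depend on the choice.\<close>

definition induced_action :: "'m mlie \<Rightarrow> ('m \<Rightarrow> 'q) \<Rightarrow> ('m, 'a) action \<Rightarrow> ('q, 'a) action" where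
  "induced_action M \<pi> \<chi> =
     \<lparr>sigma = (\<lambda>q a. the_elem {sigma \<chi> m a | m. m \<in> carrier M \<and> \<pi> m = q}),
      tau = (\<lambda>q a. the_elem {tau \<chi> m a | m. m \<in> carrier M \<and> \<pi> m = q}),
      nu = (\<lambda>a q. the_elem {nu \<chi> a m | m. m \<in> carrier M \<and> \<pi> m = q})\<rparr>"


section \<open>The square condition\<close>

definition square_witness ::
  "'m mlie \<Rightarrow> 'm set \<Rightarrow> 'a mlie \<Rightarrow> ('m, 'a) action \<Rightarrow> ('m \<Rightarrow> 'a) \<Rightarrow> ('m \<Rightarrow> 'a) \<Rightarrow> bool" where
  "square_witness M I A \<chi> d \<eta> \<longleftrightarrow>
     \<eta> \<in> carrier M \<rightarrow> carrier A \<and> \<eta> \<one>\<^bsub>M\<^esub> = \<one>\<^bsub>A\<^esub> \<and>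
     (\<forall>m\<in>carrier M. \<forall>n\<in>I.
        sigma \<chi> m (d (inv\<^bsub>M\<^esub> m \<otimes>\<^bsub>M\<^esub> n \<otimes>\<^bsub>M\<^esub> m)) \<otimes>\<^bsub>A\<^esub> inv\<^bsub>A\<^esub> d n
          = sigma \<chi> n (\<eta> m) \<otimes>\<^bsub>A\<^esub> inv\<^bsub>A\<^esub> \<eta> m \<and>
        d \<lbrace>m, n\<rbrace>\<^bsub>M\<^esub> \<otimes>\<^bsub>A\<^esub> inv\<^bsub>A\<^esub> tau \<chi> m (d n) \<otimes>\<^bsub>A\<^esub> sigma \<chi> \<lbrace>m, n\<rbrace>\<^bsub>M\<^esub> (d n) \<otimes>\<^bsub>A\<^esub> inv\<^bsub>A\<^esub> d n
          = \<eta> m \<otimes>\<^bsub>A\<^esub> sigma \<chi> \<lbrace>m, n\<rbrace>\<^bsub>M\<^esub> (nu \<chi> (\<eta> m) n \<otimes>\<^bsub>A\<^esub> inv\<^bsub>A\<^esub> \<eta> m))"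

definition square_derivations ::
  "'m mlie \<Rightarrow> 'm set \<Rightarrow> 'a mlie \<Rightarrow> ('m, 'a) action \<Rightarrow> ('m \<Rightarrow> 'a) set" where
  "square_derivations M I A \<chi> =
     {d \<in> derivations (M\<lparr>carrier := I\<rparr>) A \<chi>. \<exists>\<eta>. square_witness M I A \<chi> d \<eta>}"

definition H1_square ::
  "'m mlie \<Rightarrow> 'm set \<Rightarrow> 'a mlie \<Rightarrow> ('m, 'a) action \<Rightarrow> ('m \<Rightarrow> 'a) set monoid" where
  "H1_square M I A \<chi> =
     (H1 (M\<lparr>carrier := I\<rparr>) A \<chi>)
       \<lparr>carrier := H1_class (M\<lparr>carrier := I\<rparr>) A \<chi> ` square_derivations M I A \<chi>\<rparr>"


section \<open>Inflation, restriction, transgression\<close>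

definition inflate_derivation :: "'m mlie \<Rightarrow> ('m \<Rightarrow> 'q) \<Rightarrow> ('q \<Rightarrow> 'a) \<Rightarrow> 'm \<Rightarrow> 'a" where
  "inflate_derivation M \<pi> d = (\<lambda>m\<in>carrier M. d (\<pi> m))"

definition inflate_cocycle ::
  "'m mlie \<Rightarrow> ('m \<Rightarrow> 'q) \<Rightarrow> ('q \<times> 'q \<Rightarrow> 'a) \<times> ('q \<times> 'q \<Rightarrow> 'a)
    \<Rightarrow> ('m \<times> 'm \<Rightarrow> 'a) \<times> ('m \<times> 'm \<Rightarrow> 'a)" where
  "inflate_cocycle M \<pi> = (\<lambda>(S, Sf).
     (\<lambda>(x, y)\<in>carrier M \<times> carrier M. S (\<pi> x, \<pi> y),
      \<lambda>(x, y)\<in>carrier M \<times> carrier M. Sf (\<pi> x, \<pi> y)))"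

definition transgression_cocycle ::
  "'m mlie \<Rightarrow> 'q mlie \<Rightarrow> 'a mlie \<Rightarrow> ('m, 'a) action \<Rightarrow> ('q \<Rightarrow> 'm) \<Rightarrow> ('m \<Rightarrow> 'a) \<Rightarrow> ('m \<Rightarrow> 'a)
    \<Rightarrow> ('q \<times> 'q \<Rightarrow> 'a) \<times> ('q \<times> 'q \<Rightarrow> 'a)" where
  "transgression_cocycle M Q A \<chi> l d \<eta>' =
     (let \<eta> = (\<lambda>x. \<eta>' (l x));
          T = (\<lambda>x y. l x \<otimes>\<^bsub>M\<^esub> l y \<otimes>\<^bsub>M\<^esub> inv\<^bsub>M\<^esub> l (x \<otimes>\<^bsub>Q\<^esub> y));
          Tf = (\<lambda>x y. \<lbrace>l x, l y\<rbrace>\<^bsub>M\<^esub> \<otimes>\<^bsub>M\<^esub> inv\<^bsub>M\<^esub> l \<lbrace>x, y\<rbrace>\<^bsub>Q\<^esub>)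
      in (\<lambda>(x, y)\<in>carrier Q \<times> carrier Q.
            \<eta> x \<otimes>\<^bsub>A\<^esub> sigma \<chi> (l x) (\<eta> y)
              \<otimes>\<^bsub>A\<^esub> inv\<^bsub>A\<^esub> sigma \<chi> (T x y) (\<eta> (x \<otimes>\<^bsub>Q\<^esub> y)) \<otimes>\<^bsub>A\<^esub> inv\<^bsub>A\<^esub> d (T x y),
          \<lambda>(x, y)\<in>carrier Q \<times> carrier Q.
            bracket_part M A \<chi> (l x) (l y) (\<eta> x) (\<eta> y)
              \<otimes>\<^bsub>A\<^esub> inv\<^bsub>A\<^esub> sigma \<chi> (Tf x y) (\<eta> \<lbrace>x, y\<rbrace>\<^bsub>Q\<^esub>) \<otimes>\<^bsub>A\<^esub> inv\<^bsub>A\<^esub> d (Tf x y)))"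

definition inflation1 ::
  "'m mlie \<Rightarrow> ('m \<Rightarrow> 'q) \<Rightarrow> 'a mlie \<Rightarrow> ('m, 'a) action \<Rightarrow> ('q \<Rightarrow> 'a) set \<Rightarrow> ('m \<Rightarrow> 'a) set" where
  "inflation1 M \<pi> A \<chi> c = the_elem {H1_class M A \<chi> (inflate_derivation M \<pi> d) | d. d \<in> c}"

definition restriction1 ::
  "'m mlie \<Rightarrow> 'm set \<Rightarrow> 'a mlie \<Rightarrow> ('m, 'a) action \<Rightarrow> ('m \<Rightarrow> 'a) set \<Rightarrow> ('m \<Rightarrow> 'a) set" where
  "restriction1 M I A \<chi> c = the_elem {H1_class (M\<lparr>carrier := I\<rparr>) A \<chi> (restrict d I) | d. d \<in> c}"

definition transgression ::
  "'m mlie \<Rightarrow> 'm set \<Rightarrow> 'q mlie \<Rightarrow> ('m \<Rightarrow> 'q) \<Rightarrow> 'a mlie \<Rightarrow> ('m, 'a) action \<Rightarrow> ('q \<Rightarrow> 'm)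
    \<Rightarrow> ('m \<Rightarrow> 'a) set \<Rightarrow> (('q \<times> 'q \<Rightarrow> 'a) \<times> ('q \<times> 'q \<Rightarrow> 'a)) set" where
  "transgression M I Q \<pi> A \<chi> l c =
     the_elem {H2_class Q (A\<lparr>carrier := invariants I A \<chi>\<rparr>) (induced_action M \<pi> \<chi>)
                 (transgression_cocycle M Q A \<chi> l d \<eta>)
               | d \<eta>. d \<in> c \<and> d \<in> square_derivations M I A \<chi> \<and>
                       square_witness M I A \<chi> d \<eta> \<and> (\<forall>n\<in>I. \<eta> n = d n)}"

definition inflation2 ::
  "'m mlie \<Rightarrow> ('m \<Rightarrow> 'q) \<Rightarrow> 'a mlie \<Rightarrow> ('m, 'a) action
    \<Rightarrow> (('q \<times> 'q \<Rightarrow> 'a) \<times> ('q \<times> 'q \<Rightarrow> 'a)) set \<Rightarrow> (('m \<times> 'm \<Rightarrow> 'a) \<times> ('m \<times> 'm \<Rightarrow> 'a)) set" where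
  "inflation2 M \<pi> A \<chi> c = the_elem {H2_class M A \<chi> (inflate_cocycle M \<pi> s) | s. s \<in> c}"

definition exact_at ::
  "('a, 'x) monoid_scheme \<Rightarrow> ('a \<Rightarrow> 'b) \<Rightarrow> ('b, 'y) monoid_scheme \<Rightarrow> ('b \<Rightarrow> 'c) \<Rightarrow> ('c, 'z) monoid_scheme
    \<Rightarrow> bool" where
  "exact_at G f H g K \<longleftrightarrow>
     group G \<and> group H \<and> group K \<and> f \<in> hom G H \<and> g \<in> hom H K \<and> f ` carrier G = kernel H K g"

end

theory Submission
  imports Defs
begin

text \<open>
  Everything takes place in the split extension \<open>A \<rtimes> M\<close>, the cocycle algebra of the trivial cocycle.
  It is a multiplicative Lie algebra as soon as the action terms are realized by some extension \<open>E\<close>,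
  being a quotient of the fibre square of \<open>E\<close> over \<open>M\<close> (\<open>realized_imp_split\<close>). The rules for
  \<open>\<sigma>\<close>, \<open>\<tau>\<close> and \<open>\<nu>\<close> are instances of the laws in \<open>A \<rtimes> M\<close>. That products, inverses, coboundaries and
  inflations of cocycles are again cocycles is seen in the same way: their extensions are images of
  extensions that are already at hand or of fibre products of these, so no law has to be verified by
  expanding cocycle equations.

  The hypothesis \<open>H\<^sup>0(M,A) = 0\<close> enters through the identity \<open>{[x,y],z} = [{x,y},z]\<close>
  (\<open>bracket_commutator\<close>): if \<open>n\<close> fixes \<open>a\<close>, then \<open>{n,a}\<close> is fixed by all of \<open>M\<close>, hence trivial. So an
  element of \<open>A\<close> lies in \<open>A\<^sup>I\<close> as soon as it is fixed by conjugation with \<open>I\<close> (\<open>invariants_iff\<close>). This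
  gives the injectivity of the first inflation and, together with the fact that a derivation
  vanishing on \<open>I\<close> descends to \<open>Q\<close>, exactness at \<open>H\<^sup>1(M,A)\<close>.

  The rest is a connecting homomorphism. A relative cochain is a map \<open>h : M \<rightarrow> A\<close> whose coboundary
  vanishes whenever one argument lies in \<open>I\<close>. Two facts about relative cochains carry the proof. First, the
  derivations of \<open>I\<close> that satisfy the square condition are exactly the restrictions of relative
  cochains (\<open>square_derivations_eq\<close>): the square condition says that \<open>(\<eta> m, m)\<close> normalizes the
  subalgebra \<open>D = {(d n, n) | n \<in> I}\<close> of \<open>A \<rtimes> M\<close> and has its brackets with \<open>D\<close> in \<open>D\<close>, and \<open>h\<close> is read off from
  the products of elements of \<open>D\<close> with the \<open>(\<eta> x, x)\<close>, for \<open>x\<close> in the image of the section. Second,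
  the coboundary of a relative cochain is the inflation of a cocycle of \<open>Q\<close> with values in \<open>A\<^sup>I\<close>
  (\<open>inflate_relative_cocycle\<close>, \<open>relative_cocycle_closed\<close>): the coboundary measures the failure of
  \<open>m \<mapsto> (h m, m)\<close> to be a homomorphism, its values idealize \<open>D\<close> because the idealizer of a subalgebra is
  a subalgebra, and an element of \<open>A\<close> that idealizes \<open>D\<close> is invariant.

  The transgression thus sends the class of \<open>h|I\<close> to the class of the cocycle inflating to the
  coboundary of \<open>h\<close>. It is well defined because a relative cochain that vanishes on \<open>I\<close> is inflated
  from \<open>Q\<close>. Its kernel consists of the restrictions of those \<open>h\<close> that become derivations of \<open>M\<close>
  after division by a cochain inflated from \<open>Q\<close>; and a cocycle of \<open>Q\<close> whose inflation is the
  coboundary of some \<open>h\<close> vanishes on trivial arguments, so that \<open>h\<close> is relative and the cocycle is a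
  transgression.
\<close>


section \<open>Commutative groups and their quotients\<close>

lemma comm_group_subgroup:
  assumes "comm_group G" "subgroup H G"
  shows "comm_group (G\<lparr>carrier := H\<rparr>)"
proof -
  interpret comm_group G by (rule assms(1))
  show ?thesis
    using assms(2) subgroup.subset[OF assms(2)]
    by (intro group.group_comm_groupI subgroup.subgroup_is_group[OF assms(2)] group_axioms)
       (auto intro: m_comm)
qed

lemma comm_group_product_group:
  assumes "\<And>i. i \<in> I \<Longrightarrow> comm_group (G i)"
  shows "comm_group (product_group I G)"
  using assms
  by (intro group.group_comm_groupI product_group)
     (auto simp: comm_group.axioms PiE_iff intro!: restrict_ext comm_groupE(4))

lemma comm_group_DirProd:
  assumes "comm_group G" "comm_group H"
  shows "comm_group (G \<times>\<times> H)"
  using assms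
  by (intro group.group_comm_groupI DirProd_group) (auto simp: comm_group.axioms comm_groupE(4))

lemma (in comm_group) mult_inv_cancel_pairs:
  assumes "a \<in> carrier G" "u \<in> carrier G" "b \<in> carrier G" "v \<in> carrier G" "w \<in> carrier G"
  shows "a \<otimes> inv u \<otimes> (b \<otimes> inv v) \<otimes> (u \<otimes> v \<otimes> w) = a \<otimes> b \<otimes> w"
proof -
  have "a \<otimes> inv u \<otimes> (b \<otimes> inv v) \<otimes> (u \<otimes> v \<otimes> w) = a \<otimes> b \<otimes> w \<otimes> (inv u \<otimes> u) \<otimes> (inv v \<otimes> v)"
    using assms by (simp only: m_ac m_closed inv_closed)
  then show ?thesis using assms by simp
qed

lemma (in comm_group) mult_cancel_inv:
  assumes "b \<in> carrier G" "x \<in> carrier G" "y \<in> carrier G" "z \<in> carrier G"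
  shows "b \<otimes> x \<otimes> y \<otimes> inv (b \<otimes> z) = x \<otimes> y \<otimes> inv z"
proof -
  have "b \<otimes> x \<otimes> y \<otimes> (inv b \<otimes> inv z) = (b \<otimes> inv b) \<otimes> (x \<otimes> y \<otimes> inv z)"
    using assms by (simp only: m_ac m_closed inv_closed)
  then show ?thesis using assms by (simp add: inv_mult)
qed

lemma (in comm_group) mult_eq_iff_swap:
  assumes "a \<in> carrier G" "b \<in> carrier G" "x \<in> carrier G" "y \<in> carrier G"
  shows "x \<otimes> inv b = y \<otimes> inv a \<longleftrightarrow> a \<otimes> x = b \<otimes> y"
proof -
  have "x \<otimes> inv b = y \<otimes> inv a \<longleftrightarrow> x = y \<otimes> inv a \<otimes> b"
    using assms by (metis inv_closed inv_solve_right m_closed)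
  also have "\<dots> \<longleftrightarrow> x = b \<otimes> y \<otimes> inv a"
    using assms by (simp add: m_ac)
  also have "\<dots> \<longleftrightarrow> x \<otimes> a = b \<otimes> y"
    using assms by (metis inv_solve_right m_closed)
  also have "\<dots> \<longleftrightarrow> a \<otimes> x = b \<otimes> y"
    using assms by (simp add: m_comm[of x a])
  finally show ?thesis .
qed

lemma (in comm_group) mult_eq_iff_move:
  assumes "z \<in> carrier G" "t \<in> carrier G" "s \<in> carrier G" "b \<in> carrier G" "a \<in> carrier G" "w \<in> carrier G"
  shows "z \<otimes> inv t \<otimes> s \<otimes> inv b = a \<otimes> w \<longleftrightarrow> z = a \<otimes> b \<otimes> t \<otimes> (w \<otimes> inv s)"
proof -
  have 1: "z \<otimes> inv t \<otimes> s \<otimes> inv b = z \<otimes> inv (b \<otimes> t \<otimes> inv s)"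
    using assms by (simp add: inv_mult m_ac)
  have 2: "a \<otimes> b \<otimes> t \<otimes> (w \<otimes> inv s) = a \<otimes> w \<otimes> (b \<otimes> t \<otimes> inv s)"
    using assms by (simp only: m_ac m_closed inv_closed)
  have "z \<otimes> inv u = x \<longleftrightarrow> z = x \<otimes> u" if "u \<in> carrier G" "x \<in> carrier G" for u x
    using assms(1) that by (auto simp: m_assoc)
  then show ?thesis unfolding 1 2 using assms by simp
qed

lemma (in group) eq_of_mult_inv_eq_one:
  "\<lbrakk>u \<otimes> inv z = \<one>; u \<in> carrier G; z \<in> carrier G\<rbrakk> \<Longrightarrow> z = u"
  using inv_equality[of u "inv z"] by simp

lemma the_elem_unique_value:
  assumes "Q a" "\<And>d. Q d \<Longrightarrow> f d = X"
  shows "the_elem {f d | d. Q d} = X"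
proof -
  have "{f d | d. Q d} = {X}" using assms by force
  then show ?thesis by simp
qed

lemma r_coset_eq_iff:
  assumes "comm_group G" "subgroup N G" "x \<in> carrier G" "y \<in> carrier G"
  shows "N #>\<^bsub>G\<^esub> x = N #>\<^bsub>G\<^esub> y \<longleftrightarrow> (\<exists>n\<in>N. y = n \<otimes>\<^bsub>G\<^esub> x)"
proof -
  interpret G: comm_group G by (rule assms(1))
  have "N #>\<^bsub>G\<^esub> x = N #>\<^bsub>G\<^esub> y \<longleftrightarrow> y \<in> N #>\<^bsub>G\<^esub> x"
    using G.rcos_self[OF assms(4,2)] G.repr_independence[OF _ assms(3,2)] by metis
  then show ?thesis unfolding r_coset_def by blast
qed

text \<open>The maps of the sequence are given by their values \<open>\<phi>\<close> on representatives, so their images and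
  kernels can be computed before passing to the quotient.\<close>

lemma hom_from_quotient:
  assumes G: "comm_group G" and N: "subgroup N G" and \<phi>: "\<phi> \<in> hom G K"
    and F': "\<forall>x\<in>carrier G. F (N #>\<^bsub>G\<^esub> x) = \<phi> x"
  shows "F \<in> hom (G Mod N) K"
    and "F ` carrier (G Mod N) = \<phi> ` carrier G"
    and "kernel (G Mod N) K F = (\<lambda>x. N #>\<^bsub>G\<^esub> x) ` kernel G K \<phi>"
proof -
  interpret G: comm_group G by (rule G)
  interpret N: normal N G using N by (simp add: G.normal_iff_subgroup)
  have F: "F (N #>\<^bsub>G\<^esub> x) = \<phi> x" if "x \<in> carrier G" for x using F' that by blast
  show "F \<in> hom (G Mod N) K"
    using \<phi> by (auto simp: hom_def carrier_FactGroup F N.rcos_sum Pi_iff)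
  show "F ` carrier (G Mod N) = \<phi> ` carrier G"
    by (auto simp: carrier_FactGroup F image_image)
  show "kernel (G Mod N) K F = (\<lambda>x. N #>\<^bsub>G\<^esub> x) ` kernel G K \<phi>"
    by (auto simp: kernel_def carrier_FactGroup F)
qed

lemma r_coset_hom:
  assumes "comm_group G" "subgroup N G"
  shows "(\<lambda>x. N #>\<^bsub>G\<^esub> x) \<in> hom G (G Mod N)"
  using assms by (simp add: comm_group.normal_iff_subgroup normal.r_coset_hom_Mod)

lemma the_elem_r_coset:
  assumes G: "comm_group G" and N: "subgroup N G" and d: "d \<in> carrier G"
    and f: "\<And>n. n \<in> N \<Longrightarrow> f (n \<otimes>\<^bsub>G\<^esub> d) = X"
  shows "the_elem {f e | e. e \<in> N #>\<^bsub>G\<^esub> d} = X"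
proof (rule the_elem_unique_value)
  show "d \<in> N #>\<^bsub>G\<^esub> d" using comm_group.axioms(2)[OF G] d N by (rule group.rcos_self)
qed (auto simp: r_coset_def f)

lemma r_coset_eq_subgroup_iff:
  assumes "comm_group G" "subgroup N G" "x \<in> carrier G"
  shows "N #>\<^bsub>G\<^esub> x = N \<longleftrightarrow> x \<in> N"
  using assms comm_group.axioms(2) group.coset_join1 group.coset_join2 by metis

lemma the_elem_hom_r_coset:
  assumes G: "comm_group G" "subgroup N G" and H: "comm_group H" "subgroup K H"
    and f: "f \<in> hom G H" "\<And>n. n \<in> N \<Longrightarrow> f n \<in> K" and d: "d \<in> carrier G"
  shows "the_elem {K #>\<^bsub>H\<^esub> f e | e. e \<in> N #>\<^bsub>G\<^esub> d} = K #>\<^bsub>H\<^esub> f d"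
proof (rule the_elem_r_coset[OF G d])
  fix n assume n: "n \<in> N"
  have nG: "n \<in> carrier G" using n subgroup.subset[OF G(2)] by blast
  have "f (n \<otimes>\<^bsub>G\<^esub> d) = f n \<otimes>\<^bsub>H\<^esub> f d" using f(1) nG d by (rule hom_mult)
  moreover have "f d \<in> carrier H" "f (n \<otimes>\<^bsub>G\<^esub> d) \<in> carrier H"
    using f(1) d comm_groupE(1)[OF G(1) nG d] unfolding hom_def by blast+
  ultimately show "K #>\<^bsub>H\<^esub> f (n \<otimes>\<^bsub>G\<^esub> d) = K #>\<^bsub>H\<^esub> f d"
    using r_coset_eq_iff[OF H, of "f d" "f (n \<otimes>\<^bsub>G\<^esub> d)"] f(2)[OF n] by blast
qed


section \<open>Identities in multiplicative Lie algebras\<close>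

context mult_lie_algebra
begin

lemma inv_mult_cancel [simp]:
  "\<lbrakk>x \<in> carrier M; y \<in> carrier M\<rbrakk> \<Longrightarrow> inv x \<otimes> (x \<otimes> y) = y"
  "\<lbrakk>x \<in> carrier M; y \<in> carrier M\<rbrakk> \<Longrightarrow> x \<otimes> (inv x \<otimes> y) = y"
  by (simp_all flip: m_assoc)

lemma conj_by_closed [simp]:
  "\<lbrakk>x \<in> carrier M; z \<in> carrier M\<rbrakk> \<Longrightarrow> conj_by M x z \<in> carrier M"
  by (simp add: conj_by_def)

lemma conj_by_one [simp]: "x \<in> carrier M \<Longrightarrow> conj_by M x \<one> = x"
  by (simp add: conj_by_def)

lemma one_conj_by [simp]: "z \<in> carrier M \<Longrightarrow> conj_by M \<one> z = \<one>"
  by (simp add: conj_by_def)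

lemma conj_by_mult:
  "\<lbrakk>x \<in> carrier M; y \<in> carrier M; z \<in> carrier M\<rbrakk>
    \<Longrightarrow> conj_by M (x \<otimes> y) z = conj_by M x z \<otimes> conj_by M y z"
  by (simp add: conj_by_def m_assoc inv_solve_left')

lemma conj_by_inv:
  "\<lbrakk>x \<in> carrier M; z \<in> carrier M\<rbrakk> \<Longrightarrow> conj_by M (inv x) z = inv (conj_by M x z)"
  by (simp add: conj_by_def m_assoc inv_mult_group)

lemma conj_by_conj_by:
  "\<lbrakk>x \<in> carrier M; y \<in> carrier M; z \<in> carrier M\<rbrakk>
    \<Longrightarrow> conj_by M (conj_by M x y) z = conj_by M x (z \<otimes> y)"
  by (simp add: conj_by_def m_assoc inv_mult_group)

lemma conj_by_cancel:
  "\<lbrakk>x \<in> carrier M; y \<in> carrier M; z \<in> carrier M; conj_by M x z = conj_by M y z\<rbrakk> \<Longrightarrow> x = y"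
  by (simp add: conj_by_def)

lemma bracket_one_right [simp]: "x \<in> carrier M \<Longrightarrow> \<lbrace>x, \<one>\<rbrace> = \<one>"
  using bracket_mult_right[of x \<one> \<one>] bracket_closed[of x \<one>] by simp

lemma bracket_one_left [simp]: "x \<in> carrier M \<Longrightarrow> \<lbrace>\<one>, x\<rbrace> = \<one>"
  using bracket_mult_left[of \<one> \<one> x] bracket_closed[of \<one> x] by simp

text \<open>Expanding \<open>{xy, xy} = 1\<close> in both arguments leaves the conjugate of \<open>{y,x}{x,y}\<close> by \<open>x\<close>.\<close>

lemma bracket_swap:
  assumes [simp]: "x \<in> carrier M" "y \<in> carrier M"
  shows "\<lbrace>y, x\<rbrace> = inv \<lbrace>x, y\<rbrace>"
proof -
  note [simp] = bracket_closed
  have "\<one> = \<lbrace>x \<otimes> y, x \<otimes> y\<rbrace>" by (simp add: bracket_self)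
  also have "\<dots> = conj_by M \<lbrace>y, x \<otimes> y\<rbrace> x \<otimes> \<lbrace>x, x \<otimes> y\<rbrace>"
    by (simp add: bracket_mult_left)
  also have "\<dots> = conj_by M (\<lbrace>y, x\<rbrace> \<otimes> \<lbrace>x, y\<rbrace>) x"
    by (simp add: bracket_mult_right bracket_self conj_by_mult)
  finally have "\<one> = conj_by M (\<lbrace>y, x\<rbrace> \<otimes> \<lbrace>x, y\<rbrace>) x" .
  from arg_cong[OF this, of "\<lambda>t. conj_by M t (inv x)"]
  have "\<lbrace>y, x\<rbrace> \<otimes> \<lbrace>x, y\<rbrace> = \<one>"
    by (simp add: conj_by_conj_by)
  then show ?thesis by (simp add: inv_equality)
qed

lemma bracket_inv_right:
  assumes [simp]: "x \<in> carrier M" "y \<in> carrier M"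
  shows "\<lbrace>x, inv y\<rbrace> = conj_by M (inv \<lbrace>x, y\<rbrace>) (inv y)"
proof -
  note [simp] = bracket_closed
  have "\<lbrace>x, inv y\<rbrace> \<otimes> conj_by M \<lbrace>x, y\<rbrace> (inv y) = \<one>"
    using bracket_mult_right[of x "inv y" y] by simp
  then show ?thesis by (simp add: inv_equality conj_by_inv)
qed

lemma bracket_inv_left:
  assumes [simp]: "x \<in> carrier M" "y \<in> carrier M"
  shows "\<lbrace>inv x, y\<rbrace> = conj_by M (inv \<lbrace>x, y\<rbrace>) (inv x)"
proof -
  note [simp] = bracket_closed
  have "conj_by M \<lbrace>x, y\<rbrace> (inv x) \<otimes> \<lbrace>inv x, y\<rbrace> = \<one>"
    using bracket_mult_left[of "inv x" x y] by simp
  then show ?thesis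
    by (metis assms bracket_closed conj_by_closed conj_by_inv inv_closed inv_equality inv_inv)
qed

text \<open>The two orders of expanding \<open>{ay, cw}\<close> differ by moving \<open>{a,c}\<close> past a conjugate of \<open>{y,w}\<close>;
  comparing them shows that \<open>{a,c}\<close> and \<open>[a,c]\<close> act alike on brackets.\<close>

lemma conj_by_bracket_eq_commutator:
  assumes [simp]: "a \<in> carrier M" "b \<in> carrier M" "c \<in> carrier M" "d \<in> carrier M"
  shows "conj_by M \<lbrace>b, d\<rbrace> \<lbrace>a, c\<rbrace> = conj_by M \<lbrace>b, d\<rbrace> (a \<otimes> c \<otimes> inv a \<otimes> inv c)"
proof -
  note [simp] = bracket_closed
  have main: "\<lbrace>a, c\<rbrace> \<otimes> conj_by M \<lbrace>y, w\<rbrace> (c \<otimes> a) = conj_by M \<lbrace>y, w\<rbrace> (a \<otimes> c) \<otimes> \<lbrace>a, c\<rbrace>"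
    if [simp]: "y \<in> carrier M" "w \<in> carrier M" for y w
  proof -
    have 1: "\<lbrace>a \<otimes> y, c \<otimes> w\<rbrace> = conj_by M \<lbrace>y, c\<rbrace> a \<otimes> (\<lbrace>a, c\<rbrace> \<otimes> (conj_by M \<lbrace>y, w\<rbrace> (c \<otimes> a)
              \<otimes> conj_by M \<lbrace>a, w\<rbrace> c))"
      using bracket_mult_right[of "a \<otimes> y" c w]
      by (simp add: bracket_mult_left conj_by_mult conj_by_conj_by m_assoc)
    have 2: "\<lbrace>a \<otimes> y, c \<otimes> w\<rbrace> = conj_by M \<lbrace>y, c\<rbrace> a \<otimes> (conj_by M \<lbrace>y, w\<rbrace> (a \<otimes> c) \<otimes> (\<lbrace>a, c\<rbrace>
              \<otimes> conj_by M \<lbrace>a, w\<rbrace> c))"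
      using bracket_mult_left[of a y "c \<otimes> w"]
      by (simp add: bracket_mult_right conj_by_mult conj_by_conj_by m_assoc)
    from 1 2 have "\<lbrace>a, c\<rbrace> \<otimes> conj_by M \<lbrace>y, w\<rbrace> (c \<otimes> a) \<otimes> conj_by M \<lbrace>a, w\<rbrace> c
        = conj_by M \<lbrace>y, w\<rbrace> (a \<otimes> c) \<otimes> \<lbrace>a, c\<rbrace> \<otimes> conj_by M \<lbrace>a, w\<rbrace> c"
      by (simp add: m_assoc)
    then show ?thesis by simp
  qed
  let ?g = "inv a \<otimes> inv c"
  have "\<lbrace>a, c\<rbrace> \<otimes> \<lbrace>b, d\<rbrace> = conj_by M \<lbrace>b, d\<rbrace> (a \<otimes> c \<otimes> ?g) \<otimes> \<lbrace>a, c\<rbrace>"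
    using main[of "conj_by M b ?g" "conj_by M d ?g"]
    by (simp add: conj_by_conj_by m_assoc flip: bracket_conj)
  then show ?thesis
    by (simp add: conj_by_def[of M _ "\<lbrace>a, c\<rbrace>"] m_assoc inv_solve_right')
qed

text \<open>Expand \<open>{zxz\<inverse>, zyz\<inverse>}\<close>, which is the conjugate of \<open>{x,y}\<close> by \<open>z\<close>, and expand
  \<open>{z, [x,y]}\<close>; the previous lemma identifies the two expansions up to the factor \<open>{x,y}\<close>.\<close>

lemma bracket_commutator:
  assumes [simp]: "x \<in> carrier M" "y \<in> carrier M" "z \<in> carrier M"
  shows "\<lbrace>x \<otimes> y \<otimes> inv x \<otimes> inv y, z\<rbrace> = \<lbrace>x, y\<rbrace> \<otimes> z \<otimes> inv \<lbrace>x, y\<rbrace> \<otimes> inv z"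
proof -
  note [simp] = bracket_closed
  let ?c = "\<lbrace>x, y\<rbrace>"
  let ?k = "x \<otimes> y \<otimes> inv x \<otimes> inv y"
  let ?w = "conj_by M y z"
  have zw: "\<lbrace>z, ?w\<rbrace> = conj_by M \<lbrace>z, y\<rbrace> z"
    using bracket_conj[of z y z] by (simp add: conj_by_def m_assoc)
  have xw: "\<lbrace>x, ?w\<rbrace> = \<lbrace>x, z\<rbrace> \<otimes> conj_by M ?c z \<otimes> inv (conj_by M \<lbrace>x, z\<rbrace> ?w)"
  proof -
    have "\<lbrace>x, ?w\<rbrace> = \<lbrace>x, z \<otimes> (y \<otimes> inv z)\<rbrace>" by (simp add: conj_by_def m_assoc)
    also have "\<dots> = \<lbrace>x, z\<rbrace> \<otimes> conj_by M (\<lbrace>x, y\<rbrace> \<otimes> conj_by M \<lbrace>x, inv z\<rbrace> y) z"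
      by (simp add: bracket_mult_right)
    also have "\<dots> = \<lbrace>x, z\<rbrace> \<otimes> conj_by M ?c z \<otimes> inv (conj_by M \<lbrace>x, z\<rbrace> ?w)"
      by (simp add: bracket_inv_right conj_by_inv conj_by_mult conj_by_conj_by m_assoc)
         (simp add: conj_by_def m_assoc inv_mult_group)
    finally show ?thesis .
  qed
  have "conj_by M ?c z = \<lbrace>z \<otimes> (x \<otimes> inv z), ?w\<rbrace>"
    by (simp add: bracket_conj) (simp add: conj_by_def m_assoc)
  also have "\<dots> = conj_by M (conj_by M \<lbrace>inv z, ?w\<rbrace> x \<otimes> \<lbrace>x, ?w\<rbrace>) z \<otimes> \<lbrace>z, ?w\<rbrace>"
    by (simp add: bracket_mult_left)
  also have "\<dots> = conj_by M (conj_by M (inv \<lbrace>z, y\<rbrace>) x \<otimes> \<lbrace>x, ?w\<rbrace> \<otimes> \<lbrace>z, y\<rbrace>) z"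
    by (simp add: bracket_inv_left zw conj_by_inv conj_by_mult conj_by_conj_by m_assoc)
  finally have "?c = conj_by M (inv \<lbrace>z, y\<rbrace>) x \<otimes> \<lbrace>x, ?w\<rbrace> \<otimes> \<lbrace>z, y\<rbrace>"
    by (rule conj_by_cancel[rotated 3]) simp_all
  then have "?c = inv (conj_by M \<lbrace>z, y\<rbrace> x) \<otimes> (\<lbrace>x, z\<rbrace> \<otimes> conj_by M ?c z \<otimes> inv (conj_by M \<lbrace>x, z\<rbrace> ?w)) \<otimes> \<lbrace>z, y\<rbrace>"
    by (simp add: xw conj_by_inv)
  moreover have "c = inv p \<otimes> (a \<otimes> s \<otimes> inv r) \<otimes> w \<Longrightarrow> inv a \<otimes> p \<otimes> c \<otimes> inv w \<otimes> r = s"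
    if "p \<in> carrier M" "a \<in> carrier M" "s \<in> carrier M" "r \<in> carrier M" "w \<in> carrier M" for c p a s r w
    using that by (simp add: m_assoc)
  ultimately have "inv \<lbrace>x, z\<rbrace> \<otimes> conj_by M \<lbrace>z, y\<rbrace> x \<otimes> ?c \<otimes> inv \<lbrace>z, y\<rbrace> \<otimes> conj_by M \<lbrace>x, z\<rbrace> ?w = conj_by M ?c z"
    by (metis assms bracket_closed conj_by_closed)
  then have A: "\<lbrace>z, x\<rbrace> \<otimes> conj_by M \<lbrace>z, y\<rbrace> x \<otimes> ?c \<otimes> \<lbrace>y, z\<rbrace> \<otimes> conj_by M \<lbrace>x, z\<rbrace> ?w = conj_by M ?c z"
    by (simp add: bracket_swap[of x z] bracket_swap[of z y])
  \<comment> \<open>\<open>{y,z}\<close> acts on brackets as \<open>[y,z]\<close>, which takes \<open>z y z\<inverse>\<close> to \<open>y\<close>\<close>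
  have B: "\<lbrace>y, z\<rbrace> \<otimes> conj_by M \<lbrace>x, z\<rbrace> ?w = conj_by M \<lbrace>x, z\<rbrace> y \<otimes> \<lbrace>y, z\<rbrace>"
  proof -
    have "conj_by M (conj_by M \<lbrace>x, z\<rbrace> ?w) \<lbrace>y, z\<rbrace> = conj_by M \<lbrace>x, z\<rbrace> y"
      using conj_by_bracket_eq_commutator[of y "conj_by M x ?w" z "conj_by M z ?w"]
      by (simp add: bracket_conj) (simp add: conj_by_def m_assoc inv_mult_group)
    then show ?thesis
      by (simp add: conj_by_def[of M _ "\<lbrace>y, z\<rbrace>"] inv_solve_right')
  qed
  \<comment> \<open>\<open>[x,y] = xy (yx)\<inverse>\<close>, and on brackets \<open>[x,y]\<close> acts as \<open>{x,y}\<close>\<close>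
  have "\<lbrace>z, ?k\<rbrace> \<otimes> ?c = \<lbrace>z, x \<otimes> y\<rbrace> \<otimes> conj_by M (inv \<lbrace>z, y \<otimes> x\<rbrace>) ?k \<otimes> ?c"
    using bracket_mult_right[of z "x \<otimes> y" "inv (y \<otimes> x)"]
    unfolding bracket_inv_right[of z "y \<otimes> x", simplified]
    by (simp add: conj_by_conj_by) (simp add: inv_mult_group m_assoc)
  also have "conj_by M (inv \<lbrace>z, y \<otimes> x\<rbrace>) ?k = conj_by M (inv \<lbrace>z, y \<otimes> x\<rbrace>) ?c"
    using conj_by_bracket_eq_commutator[of x z y "y \<otimes> x"] by (simp add: conj_by_inv)
  also have "\<lbrace>z, x \<otimes> y\<rbrace> \<otimes> \<dots> \<otimes> ?c = \<lbrace>z, x\<rbrace> \<otimes> conj_by M \<lbrace>z, y\<rbrace> x \<otimes> ?c \<otimes> (conj_by M \<lbrace>x, z\<rbrace> y \<otimes> \<lbrace>y, z\<rbrace>)"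
    by (simp add: bracket_mult_right conj_by_def[of M _ ?c] m_assoc inv_mult_group
        bracket_swap[of z y] bracket_swap[of z x] conj_by_inv)
  also have "\<dots> = conj_by M ?c z"
    using A B by (simp add: m_assoc)
  finally have "\<lbrace>z, ?k\<rbrace> \<otimes> ?c = conj_by M ?c z" .
  then have "\<lbrace>z, ?k\<rbrace> = conj_by M ?c z \<otimes> inv ?c"
    by (simp add: inv_solve_right)
  moreover have "\<lbrace>?k, z\<rbrace> = inv \<lbrace>z, ?k\<rbrace>"
    by (rule bracket_swap) simp_all
  ultimately have "\<lbrace>?k, z\<rbrace> = inv (conj_by M ?c z \<otimes> inv ?c)"
    by simp
  then show ?thesis
    by (simp add: inv_mult_group conj_by_def m_assoc)
qed

end


section \<open>Idealizers\<close>

text \<open>Both \<open>x\<close> and \<open>x\<inverse>\<close> are asked to conjugate \<open>D\<close> into itself, so that the idealizer is a subgroup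
  although \<open>D\<close> may be infinite.\<close>

definition idealizer :: "('a, 'b) mlie_scheme \<Rightarrow> 'a set \<Rightarrow> 'a set" where
  "idealizer G D = {x \<in> carrier G. \<forall>y\<in>D. conj_by G y x \<in> D \<and> conj_by G y (inv\<^bsub>G\<^esub> x) \<in> D \<and> \<lbrace>x, y\<rbrace>\<^bsub>G\<^esub> \<in> D}"

context mult_lie_algebra
begin

lemma idealizer_subgroup:
  assumes D: "subgroup D M"
  shows "subgroup (idealizer M D) M"
proof -
  interpret D: subgroup D M by (rule D)
  have carr: "y \<in> carrier M" if "y \<in> D" for y using D.subset that by blast
  show ?thesis
  proof (rule subgroupI)
    show "idealizer M D \<subseteq> carrier M" by (auto simp: idealizer_def)
    have "\<one> \<in> idealizer M D" using carr by (simp add: idealizer_def)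
    then show "idealizer M D \<noteq> {}" by blast
  next
    fix x assume x: "x \<in> idealizer M D"
    have "\<lbrace>inv x, y\<rbrace> \<in> D" if y: "y \<in> D" for y
    proof -
      have "\<lbrace>x, y\<rbrace> \<in> D" "x \<in> carrier M" using x y by (auto simp: idealizer_def)
      then have "conj_by M (inv \<lbrace>x, y\<rbrace>) (inv x) \<in> D" using x by (simp add: idealizer_def)
      then show ?thesis using \<open>x \<in> carrier M\<close> carr[OF y] by (simp add: bracket_inv_left)
    qed
    then show "inv x \<in> idealizer M D" using x by (simp add: idealizer_def)
  next
    fix x y assume x: "x \<in> idealizer M D" and y: "y \<in> idealizer M D"
    have xy: "x \<in> carrier M" "y \<in> carrier M" using x y by (auto simp: idealizer_def)
    have "conj_by M z (x \<otimes> y) \<in> D \<and> conj_by M z (inv (x \<otimes> y)) \<in> D \<and> \<lbrace>x \<otimes> y, z\<rbrace> \<in> D"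
      if z: "z \<in> D" for z
    proof (intro conjI)
      have "conj_by M (conj_by M z y) x \<in> D" using x y z by (simp add: idealizer_def)
      then show "conj_by M z (x \<otimes> y) \<in> D" using xy carr[OF z] by (simp add: conj_by_conj_by)
      have "conj_by M (conj_by M z (inv x)) (inv y) \<in> D" using x y z by (simp add: idealizer_def)
      then show "conj_by M z (inv (x \<otimes> y)) \<in> D"
        using xy carr[OF z] by (simp add: conj_by_conj_by inv_mult_group)
      have "conj_by M \<lbrace>y, z\<rbrace> x \<in> D" "\<lbrace>x, z\<rbrace> \<in> D" using x y z by (simp_all add: idealizer_def)
      then show "\<lbrace>x \<otimes> y, z\<rbrace> \<in> D" using xy carr[OF z] by (simp add: bracket_mult_left)
    qed
    then show "x \<otimes> y \<in> idealizer M D" using xy by (simp add: idealizer_def)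
  qed
qed

text \<open>Conjugation by \<open>{x,y}\<close> stays in \<open>D\<close> because \<open>[{x,y},z] = {[x,y],z}\<close> and the commutator
  \<open>[x,y]\<close> lies in the idealizer; the bracket with \<open>{x,y}\<close> stays in \<open>D\<close> by the Jacobi identity.\<close>

lemma idealizer_bracket_closed:
  assumes D: "subgroup D M" and sub: "\<And>a b. \<lbrakk>a \<in> D; b \<in> D\<rbrakk> \<Longrightarrow> \<lbrace>a, b\<rbrace> \<in> D"
    and x: "x \<in> idealizer M D" and y: "y \<in> idealizer M D"
  shows "\<lbrace>x, y\<rbrace> \<in> idealizer M D"
proof -
  interpret D: subgroup D M by (rule D)
  interpret N: subgroup "idealizer M D" M by (rule idealizer_subgroup[OF D])
  note [simp] = bracket_closed
  have Dc [simp]: "z \<in> carrier M" if "z \<in> D" for z using D.subset that by blast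
  have Nc [simp]: "z \<in> carrier M" if "z \<in> idealizer M D" for z using that unfolding idealizer_def by blast
  have inN: "conj_by M z u \<in> D" "conj_by M z (inv u) \<in> D" "\<lbrace>u, z\<rbrace> \<in> D" "\<lbrace>z, u\<rbrace> \<in> D"
    if "u \<in> idealizer M D" "z \<in> D" for u z
  proof -
    show 1: "\<lbrace>u, z\<rbrace> \<in> D" and "conj_by M z u \<in> D" "conj_by M z (inv u) \<in> D"
      using that unfolding idealizer_def by blast+
    have "\<lbrace>z, u\<rbrace> = inv \<lbrace>u, z\<rbrace>" using that by (intro bracket_swap) simp_all
    then show "\<lbrace>z, u\<rbrace> \<in> D" using 1 by simp
  qed
  have DN: "z \<in> idealizer M D" if "z \<in> D" for z
    using that unfolding idealizer_def conj_by_def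
    by (auto intro!: sub D.m_closed D.m_inv_closed)
  have conj: "conj_by M z \<lbrace>u, v\<rbrace> \<in> D"
    if uv: "u \<in> idealizer M D" "v \<in> idealizer M D" and z: "z \<in> D" for u v z
  proof -
    have "\<lbrace>u \<otimes> v \<otimes> inv u \<otimes> inv v, z\<rbrace> \<otimes> z \<in> D"
      using uv z by (intro D.m_closed inN(3) N.m_closed N.m_inv_closed)
    also have "\<lbrace>u \<otimes> v \<otimes> inv u \<otimes> inv v, z\<rbrace> \<otimes> z = conj_by M z \<lbrace>u, v\<rbrace>"
      using uv z by (subst bracket_commutator) (simp_all add: conj_by_def m_assoc)
    finally show ?thesis .
  qed
  show ?thesis
    unfolding idealizer_def
  proof (intro CollectI conjI ballI)
    fix z assume z: "z \<in> D"
    show "conj_by M z \<lbrace>x, y\<rbrace> \<in> D" using conj x y z by blast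
    show "conj_by M z (inv \<lbrace>x, y\<rbrace>) \<in> D" using conj[OF y x z] x y bracket_swap[of x y] by simp
    \<comment> \<open>the Jacobi identity for \<open>x\<close>, \<open>y\<close> and \<open>w\<close> has \<open>{{x,y},z}\<close> as its first factor\<close>
    define w where "w = conj_by M z (inv y)"
    have w: "w \<in> D" "conj_by M w y = z"
      using inN(2)[OF y z] y z by (simp_all add: w_def conj_by_conj_by)
    let ?a = "\<lbrace>\<lbrace>y, w\<rbrace>, conj_by M x w\<rbrace> \<otimes> \<lbrace>\<lbrace>w, x\<rbrace>, conj_by M y x\<rbrace>"
    have conjN: "conj_by M u v \<in> idealizer M D" if "u \<in> idealizer M D" "v \<in> idealizer M D" for u v
      using that unfolding conj_by_def by (intro N.m_closed N.m_inv_closed)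
    have a: "?a \<in> D"
      by (intro D.m_closed inN(4)[OF conjN[OF x DN[OF w(1)]] inN(3)[OF y w(1)]]
          inN(4)[OF conjN[OF y x] inN(4)[OF x w(1)]])
    have "\<lbrace>\<lbrace>x, y\<rbrace>, z\<rbrace> \<otimes> ?a = \<one>"
      using bracket_jacobi[of x y w] x y z w by (simp add: m_assoc)
    then have "\<lbrace>\<lbrace>x, y\<rbrace>, z\<rbrace> = inv ?a"
      using x y z w(1) by (intro inv_equality[symmetric]) (simp_all add: m_assoc)
    then show "\<lbrace>\<lbrace>x, y\<rbrace>, z\<rbrace> \<in> D" using a by simp
  qed (use x y in simp)
qed

end


section \<open>Constructions of multiplicative Lie algebras\<close>

lemma mlie_homD:
  assumes "f \<in> mlie_hom G H"
  shows "x \<in> carrier G \<Longrightarrow> f x \<in> carrier H"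
    and "\<lbrakk>x \<in> carrier G; y \<in> carrier G\<rbrakk> \<Longrightarrow> f (x \<otimes>\<^bsub>G\<^esub> y) = f x \<otimes>\<^bsub>H\<^esub> f y"
    and "\<lbrakk>x \<in> carrier G; y \<in> carrier G\<rbrakk> \<Longrightarrow> f \<lbrace>x, y\<rbrace>\<^bsub>G\<^esub> = \<lbrace>f x, f y\<rbrace>\<^bsub>H\<^esub>"
  using assms by (auto simp: mlie_hom_def hom_def)

text \<open>This recognizes an algebra as a multiplicative Lie algebra when it is a quotient of a known one:
  every law holds for the images of elements because it holds for the elements.\<close>

lemma mult_lie_algebra_surj_image:
  fixes H :: "('b, 'd) mlie_scheme"
  assumes G: "mult_lie_algebra G"
    and surj: "f ` carrier G = carrier H"
    and one: "f \<one>\<^bsub>G\<^esub> = \<one>\<^bsub>H\<^esub>"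
    and mult: "\<And>x y. \<lbrakk>x \<in> carrier G; y \<in> carrier G\<rbrakk> \<Longrightarrow> f (x \<otimes>\<^bsub>G\<^esub> y) = f x \<otimes>\<^bsub>H\<^esub> f y"
    and brac: "\<And>x y. \<lbrakk>x \<in> carrier G; y \<in> carrier G\<rbrakk> \<Longrightarrow> f \<lbrace>x, y\<rbrace>\<^bsub>G\<^esub> = \<lbrace>f x, f y\<rbrace>\<^bsub>H\<^esub>"
  shows "mult_lie_algebra H"
proof -
  interpret G: mult_lie_algebra G by (rule G)
  note [simp] = G.bracket_closed
  have closed: "f x \<in> carrier H" if "x \<in> carrier G" for x using surj that by blast
  have grp: "group H"
  proof (rule groupI)
    show "x \<otimes>\<^bsub>H\<^esub> y \<in> carrier H" if "x \<in> carrier H" "y \<in> carrier H" for x y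
      using that by (auto simp flip: surj mult)
    show "\<one>\<^bsub>H\<^esub> \<in> carrier H" by (auto simp flip: one intro: closed)
    show "x \<otimes>\<^bsub>H\<^esub> y \<otimes>\<^bsub>H\<^esub> z = x \<otimes>\<^bsub>H\<^esub> (y \<otimes>\<^bsub>H\<^esub> z)"
      if "x \<in> carrier H" "y \<in> carrier H" "z \<in> carrier H" for x y z
      using that by (auto simp flip: surj mult simp: G.m_assoc)
    show "\<one>\<^bsub>H\<^esub> \<otimes>\<^bsub>H\<^esub> x = x" if "x \<in> carrier H" for x
      using that by (auto simp flip: surj mult one)
    show "\<exists>y\<in>carrier H. y \<otimes>\<^bsub>H\<^esub> x = \<one>\<^bsub>H\<^esub>" if "x \<in> carrier H" for x
      using that by (auto simp flip: surj mult one intro!: bexI[of _ "inv\<^bsub>G\<^esub> _"])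
  qed
  interpret H: group H by (rule grp)
  have inv: "inv\<^bsub>H\<^esub> (f x) = f (inv\<^bsub>G\<^esub> x)" if "x \<in> carrier G" for x
    using that by (intro H.inv_equality) (auto simp flip: mult one intro: closed)
  have conj: "conj_by H (f x) (f z) = f (conj_by G x z)" if "x \<in> carrier G" "z \<in> carrier G" for x z
    using that by (simp add: conj_by_def inv mult)
  show ?thesis
  proof (intro mult_lie_algebra.intro grp mult_lie_algebra_axioms.intro)
    fix x y assume "x \<in> carrier H" "y \<in> carrier H"
    then show "\<lbrace>x, y\<rbrace>\<^bsub>H\<^esub> \<in> carrier H" by (auto simp flip: surj brac)
  next
    fix x assume "x \<in> carrier H"
    then show "\<lbrace>x, x\<rbrace>\<^bsub>H\<^esub> = \<one>\<^bsub>H\<^esub>" by (auto simp flip: surj brac one simp: G.bracket_self)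
  next
    fix x y z assume "x \<in> carrier H" "y \<in> carrier H" "z \<in> carrier H"
    then obtain a b c where abc: "x = f a" "y = f b" "z = f c" "a \<in> carrier G" "b \<in> carrier G" "c \<in> carrier G"
      by (auto simp flip: surj)
    show "\<lbrace>x, y \<otimes>\<^bsub>H\<^esub> z\<rbrace>\<^bsub>H\<^esub> = \<lbrace>x, y\<rbrace>\<^bsub>H\<^esub> \<otimes>\<^bsub>H\<^esub> conj_by H \<lbrace>x, z\<rbrace>\<^bsub>H\<^esub> y"
      using abc by (simp add: conj G.bracket_mult_right flip: mult brac)
    show "\<lbrace>x \<otimes>\<^bsub>H\<^esub> y, z\<rbrace>\<^bsub>H\<^esub> = conj_by H \<lbrace>y, z\<rbrace>\<^bsub>H\<^esub> x \<otimes>\<^bsub>H\<^esub> \<lbrace>x, z\<rbrace>\<^bsub>H\<^esub>"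
      using abc by (simp add: conj G.bracket_mult_left flip: mult brac)
    show "\<lbrace>\<lbrace>x, y\<rbrace>\<^bsub>H\<^esub>, conj_by H z y\<rbrace>\<^bsub>H\<^esub> \<otimes>\<^bsub>H\<^esub> \<lbrace>\<lbrace>y, z\<rbrace>\<^bsub>H\<^esub>, conj_by H x z\<rbrace>\<^bsub>H\<^esub>
        \<otimes>\<^bsub>H\<^esub> \<lbrace>\<lbrace>z, x\<rbrace>\<^bsub>H\<^esub>, conj_by H y x\<rbrace>\<^bsub>H\<^esub> = \<one>\<^bsub>H\<^esub>"
      using abc by (simp add: conj G.bracket_jacobi one flip: mult brac)
    show "conj_by H \<lbrace>x, y\<rbrace>\<^bsub>H\<^esub> z = \<lbrace>conj_by H x z, conj_by H y z\<rbrace>\<^bsub>H\<^esub>"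
      using abc by (simp add: conj G.bracket_conj flip: mult brac)
  qed
qed

lemma mult_lie_algebra_subalgebra:
  assumes G: "mult_lie_algebra G" and S: "subgroup S G"
    and brac: "\<And>x y. \<lbrakk>x \<in> S; y \<in> S\<rbrakk> \<Longrightarrow> \<lbrace>x, y\<rbrace>\<^bsub>G\<^esub> \<in> S"
  shows "mult_lie_algebra (G\<lparr>carrier := S\<rparr>)"
proof -
  interpret G: mult_lie_algebra G by (rule G)
  interpret S: subgroup S G by (rule S)
  have conj: "conj_by (G\<lparr>carrier := S\<rparr>) x z = conj_by G x z" if "z \<in> S" for x z
    using that S by (simp add: conj_by_def)
  have conj_in: "conj_by G x z \<in> S" if "x \<in> S" "z \<in> S" for x z
    using that by (simp add: conj_by_def)
  show ?thesis
    by (intro mult_lie_algebra.intro S.subgroup_is_group G.group_axioms mult_lie_algebra_axioms.intro)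
       (simp_all add: conj conj_in brac G.bracket_self G.bracket_mult_right G.bracket_mult_left
          G.bracket_jacobi G.bracket_conj)
qed

definition fibre_product ::
  "('a, 'c) mlie_scheme \<Rightarrow> ('b, 'd) mlie_scheme \<Rightarrow> ('a \<Rightarrow> 'p) \<Rightarrow> ('b \<Rightarrow> 'p) \<Rightarrow> ('a \<times> 'b) mlie" where
  "fibre_product G H f g =
     \<lparr>carrier = {(x, y). x \<in> carrier G \<and> y \<in> carrier H \<and> f x = g y},
      monoid.mult = (\<lambda>(x, y) (x', y'). (x \<otimes>\<^bsub>G\<^esub> x', y \<otimes>\<^bsub>H\<^esub> y')),
      one = (\<one>\<^bsub>G\<^esub>, \<one>\<^bsub>H\<^esub>),
      bracket = (\<lambda>(x, y) (x', y'). (\<lbrace>x, x'\<rbrace>\<^bsub>G\<^esub>, \<lbrace>y, y'\<rbrace>\<^bsub>H\<^esub>))\<rparr>"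

lemma mult_lie_algebra_fibre_product:
  assumes G: "mult_lie_algebra G" and H: "mult_lie_algebra H" and P: "mult_lie_algebra P"
    and f: "f \<in> mlie_hom G P" and g: "g \<in> mlie_hom H P"
  shows "mult_lie_algebra (fibre_product G H f g)" (is "mult_lie_algebra ?F")
proof -
  interpret G: mult_lie_algebra G by (rule G)
  interpret H: mult_lie_algebra H by (rule H)
  interpret P: mult_lie_algebra P by (rule P)
  interpret f: group_hom G P f
    using f by (unfold_locales) (simp add: mlie_hom_def)
  interpret g: group_hom H P g
    using g by (unfold_locales) (simp add: mlie_hom_def)
  note [simp] = G.bracket_closed H.bracket_closed mlie_homD(3)[OF f] mlie_homD(3)[OF g]
  have grp: "group ?F"
  proof (rule groupI)
    show "\<exists>y\<in>carrier ?F. y \<otimes>\<^bsub>?F\<^esub> x = \<one>\<^bsub>?F\<^esub>" if "x \<in> carrier ?F" for x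
      using that by (intro bexI[of _ "(inv\<^bsub>G\<^esub> fst x, inv\<^bsub>H\<^esub> snd x)"]) (auto simp: fibre_product_def)
  qed (auto simp: fibre_product_def G.m_assoc H.m_assoc)
  interpret F: group ?F by (rule grp)
  have inv: "inv\<^bsub>?F\<^esub> (x, y) = (inv\<^bsub>G\<^esub> x, inv\<^bsub>H\<^esub> y)" if "(x, y) \<in> carrier ?F" for x y
    using that by (intro F.inv_equality) (auto simp: fibre_product_def)
  have conj: "conj_by ?F (x, y) (x', y') = (conj_by G x x', conj_by H y y')"
    if "(x', y') \<in> carrier ?F" for x y x' y'
    using that inv[OF that] by (simp add: conj_by_def) (simp add: fibre_product_def)
  show ?thesis
  proof (intro mult_lie_algebra.intro grp mult_lie_algebra_axioms.intro; clarify)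
    fix x y x' y' assume [simp]: "(x, x') \<in> carrier ?F" "(y, y') \<in> carrier ?F"
    have [simp]: "x \<in> carrier G" "y \<in> carrier G" "x' \<in> carrier H" "y' \<in> carrier H"
      "f x = g x'" "f y = g y'"
      using \<open>(x, x') \<in> _\<close> \<open>(y, y') \<in> _\<close> by (auto simp: fibre_product_def)
    show "\<lbrace>(x, x'), (y, y')\<rbrace>\<^bsub>?F\<^esub> \<in> carrier ?F" by (simp add: fibre_product_def)
    show "\<lbrace>(x, x'), (x, x')\<rbrace>\<^bsub>?F\<^esub> = \<one>\<^bsub>?F\<^esub>"
      by (simp add: fibre_product_def G.bracket_self H.bracket_self)
    fix z z' assume [simp]: "(z, z') \<in> carrier ?F"
    have [simp]: "z \<in> carrier G" "z' \<in> carrier H" "f z = g z'"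
      using \<open>(z, z') \<in> _\<close> by (auto simp: fibre_product_def)
    show "\<lbrace>(x, x'), (y, y') \<otimes>\<^bsub>?F\<^esub> (z, z')\<rbrace>\<^bsub>?F\<^esub>
        = \<lbrace>(x, x'), (y, y')\<rbrace>\<^bsub>?F\<^esub> \<otimes>\<^bsub>?F\<^esub> conj_by ?F \<lbrace>(x, x'), (z, z')\<rbrace>\<^bsub>?F\<^esub> (y, y')"
      using conj[of y y'] by (simp add: fibre_product_def G.bracket_mult_right H.bracket_mult_right)
    show "\<lbrace>(x, x') \<otimes>\<^bsub>?F\<^esub> (y, y'), (z, z')\<rbrace>\<^bsub>?F\<^esub>
        = conj_by ?F \<lbrace>(y, y'), (z, z')\<rbrace>\<^bsub>?F\<^esub> (x, x') \<otimes>\<^bsub>?F\<^esub> \<lbrace>(x, x'), (z, z')\<rbrace>\<^bsub>?F\<^esub>"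
      using conj[of x x'] by (simp add: fibre_product_def G.bracket_mult_left H.bracket_mult_left)
    show "\<lbrace>\<lbrace>(x, x'), (y, y')\<rbrace>\<^bsub>?F\<^esub>, conj_by ?F (z, z') (y, y')\<rbrace>\<^bsub>?F\<^esub> \<otimes>\<^bsub>?F\<^esub>
          \<lbrace>\<lbrace>(y, y'), (z, z')\<rbrace>\<^bsub>?F\<^esub>, conj_by ?F (x, x') (z, z')\<rbrace>\<^bsub>?F\<^esub> \<otimes>\<^bsub>?F\<^esub>
          \<lbrace>\<lbrace>(z, z'), (x, x')\<rbrace>\<^bsub>?F\<^esub>, conj_by ?F (y, y') (x, x')\<rbrace>\<^bsub>?F\<^esub> = \<one>\<^bsub>?F\<^esub>"
      using conj[of x x' y y'] conj[of y y' z z'] conj[of z z' x x']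
      by (simp add: fibre_product_def G.bracket_jacobi H.bracket_jacobi)
    show "conj_by ?F \<lbrace>(x, x'), (y, y')\<rbrace>\<^bsub>?F\<^esub> (z, z')
        = \<lbrace>conj_by ?F (x, x') (z, z'), conj_by ?F (y, y') (z, z')\<rbrace>\<^bsub>?F\<^esub>"
      using conj[of z z'] by (simp add: fibre_product_def G.bracket_conj H.bracket_conj)
  qed
qed


section \<open>Action terms given by a split extension\<close>

abbreviation semidirect :: "'p mlie \<Rightarrow> 'b mlie \<Rightarrow> ('p, 'b) action \<Rightarrow> ('b \<times> 'p) mlie" where
  "semidirect M A \<chi> \<equiv> cocycle_algebra M A \<chi> (\<lambda>_. \<one>\<^bsub>A\<^esub>) (\<lambda>_. \<one>\<^bsub>A\<^esub>)"

lemma carrier_cocycle_algebra [simp]: "carrier (cocycle_algebra M A \<chi> S Sf) = carrier A \<times> carrier M"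
  and one_cocycle_algebra [simp]: "\<one>\<^bsub>cocycle_algebra M A \<chi> S Sf\<^esub> = (\<one>\<^bsub>A\<^esub>, \<one>\<^bsub>M\<^esub>)"
  and mult_cocycle_algebra [simp]: "(a, x) \<otimes>\<^bsub>cocycle_algebra M A \<chi> S Sf\<^esub> (b, y)
      = (a \<otimes>\<^bsub>A\<^esub> sigma \<chi> x b \<otimes>\<^bsub>A\<^esub> S (x, y), x \<otimes>\<^bsub>M\<^esub> y)"
  and bracket_cocycle_algebra [simp]: "\<lbrace>(a, x), (b, y)\<rbrace>\<^bsub>cocycle_algebra M A \<chi> S Sf\<^esub>
      = (bracket_part M A \<chi> x y a b \<otimes>\<^bsub>A\<^esub> Sf (x, y), \<lbrace>x, y\<rbrace>\<^bsub>M\<^esub>)"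
  by (simp_all add: cocycle_algebra_def)

lemma snd_mlie_hom_cocycle_algebra: "snd \<in> mlie_hom (cocycle_algebra M A \<chi> S Sf) M"
  by (auto simp: mlie_hom_def hom_def)

lemma carrier_derivation_group [simp]: "carrier (derivation_group M A \<chi>) = derivations M A \<chi>"
  and mult_derivation_group [simp]: "d \<otimes>\<^bsub>derivation_group M A \<chi>\<^esub> e = (\<lambda>x\<in>carrier M. d x \<otimes>\<^bsub>A\<^esub> e x)"
  and one_derivation_group [simp]: "\<one>\<^bsub>derivation_group M A \<chi>\<^esub> = (\<lambda>x\<in>carrier M. \<one>\<^bsub>A\<^esub>)"
  by (simp_all add: derivation_group_def)

text \<open>Beyond being action terms, \<open>\<chi>\<close> is required to define a split extension. For the module \<open>A\<^sup>I\<close> over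
  \<open>Q\<close> no realizing extension is given, but its split extension is a quotient of a subalgebra of
  the one over \<open>M\<close>.\<close>

locale action_module =
  fixes M :: "'p mlie" and A :: "'b mlie" (structure) and \<chi> :: "('p, 'b) action"
  assumes base: "mult_lie_algebra M"
    and coeff: "abelian_mult_lie_algebra A"
    and act: "action_terms M A \<chi>"
    and split: "mult_lie_algebra (semidirect M A \<chi>)"
begin

sublocale M: mult_lie_algebra M by (rule base)
sublocale A: abelian_mult_lie_algebra A by (rule coeff)
sublocale E: mult_lie_algebra "semidirect M A \<chi>" by (rule split)

abbreviation \<sigma> where "\<sigma> \<equiv> sigma \<chi>"
abbreviation \<tau> where "\<tau> \<equiv> tau \<chi>"
abbreviation \<nu> where "\<nu> \<equiv> nu \<chi>"
abbreviation bp where "bp \<equiv> bracket_part M A \<chi>"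

declare M.bracket_closed [simp]

lemma sigma_closed [simp]: "\<lbrakk>x \<in> carrier M; a \<in> carrier A\<rbrakk> \<Longrightarrow> \<sigma> x a \<in> carrier A"
  and sigma_mult: "\<lbrakk>x \<in> carrier M; a \<in> carrier A; b \<in> carrier A\<rbrakk> \<Longrightarrow> \<sigma> x (a \<otimes> b) = \<sigma> x a \<otimes> \<sigma> x b"
  using act by (auto simp: action_terms_def mlie_hom_def hom_def)

lemma sigma_hom: "x \<in> carrier M \<Longrightarrow> group_hom A A (\<sigma> x)"
  by unfold_locales (auto simp: hom_def sigma_mult)

lemma sigma_one [simp]: "x \<in> carrier M \<Longrightarrow> \<sigma> x \<one> = \<one>"
  using group_hom.hom_one[OF sigma_hom] by simp

lemma sigma_inv: "\<lbrakk>x \<in> carrier M; a \<in> carrier A\<rbrakk> \<Longrightarrow> \<sigma> x (inv a) = inv (\<sigma> x a)"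
  using group_hom.hom_inv[OF sigma_hom] by simp

lemma tau_closed [simp]: "\<lbrakk>x \<in> carrier M; a \<in> carrier A\<rbrakk> \<Longrightarrow> \<tau> x a \<in> carrier A"
  and nu_closed [simp]: "\<lbrakk>x \<in> carrier M; a \<in> carrier A\<rbrakk> \<Longrightarrow> \<nu> a x \<in> carrier A"
  and tau_one [simp]: "x \<in> carrier M \<Longrightarrow> \<tau> x \<one> = \<one>"
  and nu_one [simp]: "x \<in> carrier M \<Longrightarrow> \<nu> \<one> x = \<one>"
  using act by (auto simp: action_terms_def)

lemma bp_closed [simp]:
  "\<lbrakk>x \<in> carrier M; y \<in> carrier M; a \<in> carrier A; b \<in> carrier A\<rbrakk> \<Longrightarrow> bp x y a b \<in> carrier A"
  by (simp add: bracket_part_def)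

lemma sigma_at_one [simp]: "a \<in> carrier A \<Longrightarrow> \<sigma> \<one>\<^bsub>M\<^esub> a = a"
  using E.l_one[of "(a, \<one>\<^bsub>M\<^esub>)"] by simp

lemma sigma_comp:
  "\<lbrakk>x \<in> carrier M; y \<in> carrier M; a \<in> carrier A\<rbrakk> \<Longrightarrow> \<sigma> (x \<otimes>\<^bsub>M\<^esub> y) a = \<sigma> x (\<sigma> y a)"
  using E.m_assoc[of "(\<one>, x)" "(\<one>, y)" "(a, \<one>\<^bsub>M\<^esub>)"] by simp

lemma sigma_cancel [simp]:
  "\<lbrakk>x \<in> carrier M; a \<in> carrier A\<rbrakk> \<Longrightarrow> \<sigma> x (\<sigma> (inv\<^bsub>M\<^esub> x) a) = a"
  "\<lbrakk>x \<in> carrier M; a \<in> carrier A\<rbrakk> \<Longrightarrow> \<sigma> (inv\<^bsub>M\<^esub> x) (\<sigma> x a) = a"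
  by (simp_all flip: sigma_comp)

lemma semidirect_inv:
  "\<lbrakk>x \<in> carrier M; a \<in> carrier A\<rbrakk>
    \<Longrightarrow> inv\<^bsub>semidirect M A \<chi>\<^esub> (a, x) = (inv (\<sigma> (inv\<^bsub>M\<^esub> x) a), inv\<^bsub>M\<^esub> x)"
  by (rule E.inv_equality) simp_all

lemma semidirect_conj:
  "\<lbrakk>x \<in> carrier M; a \<in> carrier A; y \<in> carrier M; b \<in> carrier A\<rbrakk>
    \<Longrightarrow> conj_by (semidirect M A \<chi>) (b, y) (a, x)
        = (a \<otimes> \<sigma> x b \<otimes> inv (\<sigma> (conj_by M y x) a), conj_by M y x)"
  by (simp add: conj_by_def[of "semidirect M A \<chi>"] semidirect_inv)
     (simp add: conj_by_def sigma_inv flip: sigma_comp)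

lemma bracket_module_right:
  "\<lbrakk>x \<in> carrier M; a \<in> carrier A\<rbrakk> \<Longrightarrow> \<lbrace>(\<one>, x), (a, \<one>\<^bsub>M\<^esub>)\<rbrace>\<^bsub>semidirect M A \<chi>\<^esub> = (\<tau> x a, \<one>\<^bsub>M\<^esub>)"
  by (simp add: bracket_part_def A.m_comm[of a] A.m_assoc)

lemma bracket_module_left:
  "\<lbrakk>x \<in> carrier M; a \<in> carrier A\<rbrakk> \<Longrightarrow> \<lbrace>(a, \<one>\<^bsub>M\<^esub>), (\<one>, x)\<rbrace>\<^bsub>semidirect M A \<chi>\<^esub> = (\<nu> a x, \<one>\<^bsub>M\<^esub>)"
  by (simp add: bracket_part_def A.m_comm[of a] A.m_assoc)

lemma nu_eq_inv_tau: "\<lbrakk>x \<in> carrier M; a \<in> carrier A\<rbrakk> \<Longrightarrow> \<nu> a x = inv (\<tau> x a)"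
  using E.bracket_swap[of "(\<one>, x)" "(a, \<one>\<^bsub>M\<^esub>)"]
  by (simp add: bracket_module_right bracket_module_left semidirect_inv del: bracket_cocycle_algebra)

lemma tau_mult:
  "\<lbrakk>x \<in> carrier M; a \<in> carrier A; b \<in> carrier A\<rbrakk> \<Longrightarrow> \<tau> x (a \<otimes> b) = \<tau> x a \<otimes> \<tau> x b"
  using E.bracket_mult_right[of "(\<one>, x)" "(a, \<one>\<^bsub>M\<^esub>)" "(b, \<one>\<^bsub>M\<^esub>)"]
  by (simp add: bracket_module_right semidirect_conj A.m_comm[of a] A.m_assoc del: bracket_cocycle_algebra)

lemma tau_comp:
  "\<lbrakk>x \<in> carrier M; y \<in> carrier M; a \<in> carrier A\<rbrakk> \<Longrightarrow> \<tau> (x \<otimes>\<^bsub>M\<^esub> y) a = \<sigma> x (\<tau> y a) \<otimes> \<tau> x a"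
  using E.bracket_mult_left[of "(\<one>, x)" "(\<one>, y)" "(a, \<one>\<^bsub>M\<^esub>)"]
  by (simp add: bracket_module_right semidirect_conj del: bracket_cocycle_algebra)

text \<open>This is \<open>{[x,a],y} = [{x,a},y]\<close> read in the split extension.\<close>

lemma tau_commutator:
  assumes "x \<in> carrier M" "y \<in> carrier M" "a \<in> carrier A"
  shows "\<nu> (\<sigma> x a \<otimes> inv a) y = \<tau> x a \<otimes> inv (\<sigma> y (\<tau> x a))"
  using E.bracket_commutator[of "(\<one>, x)" "(a, \<one>\<^bsub>M\<^esub>)" "(\<one>, y)"] assms
  by (simp add: bracket_module_right bracket_module_left semidirect_inv sigma_inv del: bracket_cocycle_algebra)

lemma bp_mult:
  "\<lbrakk>x \<in> carrier M; y \<in> carrier M; a \<in> carrier A; b \<in> carrier A; a' \<in> carrier A; b' \<in> carrier A\<rbrakk>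
    \<Longrightarrow> bp x y (a \<otimes> a') (b \<otimes> b') = bp x y a b \<otimes> bp x y a' b'"
  by (simp add: bracket_part_def nu_eq_inv_tau tau_mult sigma_mult sigma_inv A.inv_mult A.m_ac)

lemma bp_one [simp]: "\<lbrakk>x \<in> carrier M; y \<in> carrier M\<rbrakk> \<Longrightarrow> bp x y \<one> \<one> = \<one>"
  by (simp add: bracket_part_def)

lemma bp_inv:
  "\<lbrakk>x \<in> carrier M; y \<in> carrier M; a \<in> carrier A; b \<in> carrier A\<rbrakk>
    \<Longrightarrow> bp x y (inv a) (inv b) = inv (bp x y a b)"
  by (rule A.inv_equality[symmetric]) (simp_all flip: bp_mult)

lemma bp_self [simp]: "\<lbrakk>x \<in> carrier M; a \<in> carrier A\<rbrakk> \<Longrightarrow> bp x x a a = \<one>"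
  using E.bracket_self[of "(a, x)"] by simp

lemma bp_at_one [simp]:
  "\<lbrakk>x \<in> carrier M; a \<in> carrier A\<rbrakk> \<Longrightarrow> bp x \<one>\<^bsub>M\<^esub> a \<one> = \<one>"
  "\<lbrakk>x \<in> carrier M; a \<in> carrier A\<rbrakk> \<Longrightarrow> bp \<one>\<^bsub>M\<^esub> x \<one> a = \<one>"
  using E.bracket_one_right[of "(a, x)"] E.bracket_one_left[of "(a, x)"] by simp_all


section \<open>Derivations and the first cohomology group\<close>

text \<open>\<open>x \<mapsto> (d x, x)\<close> is the conjugate by \<open>a\<close> of the canonical splitting \<open>x \<mapsto> (1, x)\<close>, when \<open>d\<close> is the
  principal derivation of \<open>a\<close>.\<close>

lemma principal_derivation_closed:
  assumes a: "a \<in> carrier A"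
  shows "(\<lambda>x\<in>carrier M. a \<otimes> inv (\<sigma> x a)) \<in> derivations M A \<chi>"
proof -
  have conj: "conj_by (semidirect M A \<chi>) (\<one>, x) (a, \<one>\<^bsub>M\<^esub>) = (a \<otimes> inv (\<sigma> x a), x)" if "x \<in> carrier M" for x
    using a that by (simp add: semidirect_conj)
  have "a \<otimes> inv (\<sigma> (x \<otimes>\<^bsub>M\<^esub> y) a) = a \<otimes> inv (\<sigma> x a) \<otimes> \<sigma> x (a \<otimes> inv (\<sigma> y a))"
    and "a \<otimes> inv (\<sigma> \<lbrace>x, y\<rbrace>\<^bsub>M\<^esub> a) = bp x y (a \<otimes> inv (\<sigma> x a)) (a \<otimes> inv (\<sigma> y a))"
    if x: "x \<in> carrier M" and y: "y \<in> carrier M" for x y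
    using E.conj_by_mult[of "(\<one>, x)" "(\<one>, y)" "(a, \<one>\<^bsub>M\<^esub>)"]
      E.bracket_conj[of "(\<one>, x)" "(\<one>, y)" "(a, \<one>\<^bsub>M\<^esub>)"] a x y
    by (simp_all add: conj)
  then show ?thesis using a by (simp add: derivations_def)
qed

lemma derivations_subgroup: "subgroup (derivations M A \<chi>) (product_group (carrier M) (\<lambda>_. A))"
proof -
  interpret G: group "product_group (carrier M) (\<lambda>_. A)" by simp
  show ?thesis
  proof (rule G.subgroupI)
    show "derivations M A \<chi> \<noteq> {}" using principal_derivation_closed[of \<one>] by blast
  next
    fix d assume d: "d \<in> derivations M A \<chi>"
    then have dP: "d \<in> carrier M \<rightarrow>\<^sub>E carrier A" by (simp add: derivations_def)
    then have "d x \<in> carrier A" if "x \<in> carrier M" for x using that by (rule PiE_mem)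
    then show "inv\<^bsub>product_group (carrier M) (\<lambda>_. A)\<^esub> d \<in> derivations M A \<chi>"
      using d by (simp add: dP) (simp add: derivations_def bp_inv A.inv_mult sigma_inv)
  next
    fix d e assume d: "d \<in> derivations M A \<chi>" and e: "e \<in> derivations M A \<chi>"
    have "d x \<in> carrier A" "e x \<in> carrier A" if "x \<in> carrier M" for x
      using that d e by (auto simp: derivations_def)
    then show "d \<otimes>\<^bsub>product_group (carrier M) (\<lambda>_. A)\<^esub> e \<in> derivations M A \<chi>"
      using d e by (simp add: derivations_def bp_mult sigma_mult A.m_ac)
  qed (auto simp: derivations_def)
qed

lemma comm_group_derivation_group: "comm_group (derivation_group M A \<chi>)"
  unfolding derivation_group_def
  by (intro comm_group_subgroup derivations_subgroup comm_group_product_group A.comm_group_axioms)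

lemma derivation_group_inv:
  assumes "d \<in> derivations M A \<chi>"
  shows "inv\<^bsub>derivation_group M A \<chi>\<^esub> d = (\<lambda>x\<in>carrier M. inv (d x))"
proof -
  interpret G: group "product_group (carrier M) (\<lambda>_. A)" by simp
  show ?thesis
    using assms G.m_inv_consistent[OF derivations_subgroup assms]
    by (simp add: derivation_group_def derivations_def)
qed

lemma derivationD:
  assumes "d \<in> derivations M A \<chi>"
  shows "x \<in> carrier M \<Longrightarrow> d x \<in> carrier A"
    and "\<lbrakk>x \<in> carrier M; y \<in> carrier M\<rbrakk> \<Longrightarrow> d (x \<otimes>\<^bsub>M\<^esub> y) = d x \<otimes> \<sigma> x (d y)"
    and "\<lbrakk>x \<in> carrier M; y \<in> carrier M\<rbrakk> \<Longrightarrow> d \<lbrace>x, y\<rbrace>\<^bsub>M\<^esub> = bp x y (d x) (d y)"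
    and "d \<in> extensional (carrier M)"
  using assms by (auto simp: derivations_def PiE_def)

lemma derivation_one: "d \<in> derivations M A \<chi> \<Longrightarrow> d \<one>\<^bsub>M\<^esub> = \<one>"
  using derivationD(2)[of d "\<one>\<^bsub>M\<^esub>" "\<one>\<^bsub>M\<^esub>"] derivationD(1)[of d "\<one>\<^bsub>M\<^esub>"] by simp

lemma principal_subgroup: "subgroup (principal_derivations M A \<chi>) (derivation_group M A \<chi>)"
proof -
  interpret G: comm_group "derivation_group M A \<chi>" by (rule comm_group_derivation_group)
  show ?thesis
  proof (rule G.subgroupI)
    show "principal_derivations M A \<chi> \<subseteq> carrier (derivation_group M A \<chi>)"
      using principal_derivation_closed by (auto simp: principal_derivations_def)
    show "principal_derivations M A \<chi> \<noteq> {}" by (auto simp: principal_derivations_def)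
  next
    fix d assume "d \<in> principal_derivations M A \<chi>"
    then obtain a where a: "a \<in> carrier A" "d = (\<lambda>x\<in>carrier M. a \<otimes> inv (\<sigma> x a))"
      by (auto simp: principal_derivations_def)
    then have "inv\<^bsub>derivation_group M A \<chi>\<^esub> d = (\<lambda>x\<in>carrier M. inv a \<otimes> inv (\<sigma> x (inv a)))"
      using principal_derivation_closed[OF a(1)]
      by (auto simp: derivation_group_inv A.inv_mult sigma_inv)
    then show "inv\<^bsub>derivation_group M A \<chi>\<^esub> d \<in> principal_derivations M A \<chi>"
      using a(1) by (auto simp: principal_derivations_def)
  next
    fix d e assume "d \<in> principal_derivations M A \<chi>" "e \<in> principal_derivations M A \<chi>"
    then obtain a b where a: "a \<in> carrier A" "d = (\<lambda>x\<in>carrier M. a \<otimes> inv (\<sigma> x a))"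
      and b: "b \<in> carrier A" "e = (\<lambda>x\<in>carrier M. b \<otimes> inv (\<sigma> x b))"
      by (auto simp: principal_derivations_def)
    then have "d \<otimes>\<^bsub>derivation_group M A \<chi>\<^esub> e = (\<lambda>x\<in>carrier M. (a \<otimes> b) \<otimes> inv (\<sigma> x (a \<otimes> b)))"
      by (auto simp: A.inv_mult sigma_mult A.m_ac intro!: restrict_ext)
    then show "d \<otimes>\<^bsub>derivation_group M A \<chi>\<^esub> e \<in> principal_derivations M A \<chi>"
      using a(1) b(1) by (auto simp: principal_derivations_def)
  qed
qed

end


section \<open>Cocycles and the second cohomology group\<close>

lemma bracket_part_subcarrier:
  assumes "group A" "subgroup A1 A" "a \<in> A1" "b \<in> A1"
  shows "bracket_part M (A\<lparr>carrier := A1\<rparr>) \<chi> x y a b = bracket_part M A \<chi> x y a b"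
  using assms by (simp add: bracket_part_def group.m_inv_consistent)

definition coboundary ::
  "'p mlie \<Rightarrow> 'b mlie \<Rightarrow> ('p, 'b) action \<Rightarrow> ('p \<Rightarrow> 'b) \<Rightarrow> ('p \<times> 'p \<Rightarrow> 'b) \<times> ('p \<times> 'p \<Rightarrow> 'b)" where
  "coboundary M A \<chi> h =
     (\<lambda>(x, y)\<in>carrier M \<times> carrier M.
         h x \<otimes>\<^bsub>A\<^esub> sigma \<chi> x (h y) \<otimes>\<^bsub>A\<^esub> inv\<^bsub>A\<^esub> h (x \<otimes>\<^bsub>M\<^esub> y),
      \<lambda>(x, y)\<in>carrier M \<times> carrier M.
         bracket_part M A \<chi> x y (h x) (h y) \<otimes>\<^bsub>A\<^esub> inv\<^bsub>A\<^esub> h \<lbrace>x, y\<rbrace>\<^bsub>M\<^esub>)"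

lemma coboundaries_eq:
  "coboundaries M A \<chi> = coboundary M A \<chi> ` {h \<in> carrier M \<rightarrow> carrier A. h \<one>\<^bsub>M\<^esub> = \<one>\<^bsub>A\<^esub>}"
  unfolding coboundaries_def coboundary_def by blast

abbreviation cochain_group :: "'p mlie \<Rightarrow> 'b mlie \<Rightarrow> (('p \<times> 'p \<Rightarrow> 'b) \<times> ('p \<times> 'p \<Rightarrow> 'b)) monoid" where
  "cochain_group M A \<equiv>
     product_group (carrier M \<times> carrier M) (\<lambda>_. A) \<times>\<times> product_group (carrier M \<times> carrier M) (\<lambda>_. A)"

lemma carrier_cocycle_group [simp]: "carrier (cocycle_group M A \<chi>) = cocycles M A \<chi>"
  and mult_cocycle_group [simp]: "(S, Sf) \<otimes>\<^bsub>cocycle_group M A \<chi>\<^esub> (T, Tf)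
    = (\<lambda>p\<in>carrier M \<times> carrier M. S p \<otimes>\<^bsub>A\<^esub> T p, \<lambda>p\<in>carrier M \<times> carrier M. Sf p \<otimes>\<^bsub>A\<^esub> Tf p)"
  and one_cocycle_group [simp]: "\<one>\<^bsub>cocycle_group M A \<chi>\<^esub>
    = (\<lambda>p\<in>carrier M \<times> carrier M. \<one>\<^bsub>A\<^esub>, \<lambda>p\<in>carrier M \<times> carrier M. \<one>\<^bsub>A\<^esub>)"
  by (simp_all add: cocycle_group_def DirProd_def)

definition normalized_pair :: "'p mlie \<Rightarrow> 'b mlie \<Rightarrow> ('p \<times> 'p \<Rightarrow> 'b) \<Rightarrow> ('p \<times> 'p \<Rightarrow> 'b) \<Rightarrow> bool" where
  "normalized_pair M A S Sf \<longleftrightarrow>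
     S \<in> carrier M \<times> carrier M \<rightarrow>\<^sub>E carrier A \<and> Sf \<in> carrier M \<times> carrier M \<rightarrow>\<^sub>E carrier A \<and>
     (\<forall>x\<in>carrier M. S (x, \<one>\<^bsub>M\<^esub>) = \<one>\<^bsub>A\<^esub> \<and> S (\<one>\<^bsub>M\<^esub>, x) = \<one>\<^bsub>A\<^esub> \<and>
        Sf (x, x) = \<one>\<^bsub>A\<^esub> \<and> Sf (x, \<one>\<^bsub>M\<^esub>) = \<one>\<^bsub>A\<^esub> \<and> Sf (\<one>\<^bsub>M\<^esub>, x) = \<one>\<^bsub>A\<^esub>)"

lemma cocycles_iff:
  "(S, Sf) \<in> cocycles M A \<chi> \<longleftrightarrow>
     normalized_pair M A S Sf \<and> mult_lie_algebra (cocycle_algebra M A \<chi> S Sf)"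
  by (simp add: cocycles_def normalized_pair_def conj_assoc)

context action_module
begin

text \<open>The extension belonging to a product of cocycles is the Baer sum: a quotient of the fibre
  product over \<open>M\<close> of the two extensions. The coefficients of the first may be smaller, so
  that a cocycle with values in \<open>A1\<close> becomes one with values in \<open>A\<close> when it is multiplied by the trivial
  one.\<close>

lemma cocycle_algebra_mult:
  assumes A1: "subgroup A1 A"
    and S: "S \<in> carrier M \<times> carrier M \<rightarrow> A1" "Sf \<in> carrier M \<times> carrier M \<rightarrow> A1"
    and T: "T \<in> carrier M \<times> carrier M \<rightarrow> carrier A" "Tf \<in> carrier M \<times> carrier M \<rightarrow> carrier A"
    and alg1: "mult_lie_algebra (cocycle_algebra M (A\<lparr>carrier := A1\<rparr>) \<chi> S Sf)"
    and alg2: "mult_lie_algebra (cocycle_algebra M A \<chi> T Tf)"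
    and eq: "\<And>x y. \<lbrakk>x \<in> carrier M; y \<in> carrier M\<rbrakk> \<Longrightarrow> U (x, y) = S (x, y) \<otimes> T (x, y)"
      "\<And>x y. \<lbrakk>x \<in> carrier M; y \<in> carrier M\<rbrakk> \<Longrightarrow> Uf (x, y) = Sf (x, y) \<otimes> Tf (x, y)"
  shows "mult_lie_algebra (cocycle_algebra M A \<chi> U Uf)"
proof -
  interpret A1: subgroup A1 A by (rule A1)
  let ?F = "fibre_product (cocycle_algebra M (A\<lparr>carrier := A1\<rparr>) \<chi> S Sf) (cocycle_algebra M A \<chi> T Tf) snd snd"
  let ?f = "\<lambda>((a, x), (b, y)). (a \<otimes> b, x)"
  have SB [simp]: "S (x, y) \<in> carrier A" "Sf (x, y) \<in> carrier A" "T (x, y) \<in> carrier A" "Tf (x, y) \<in> carrier A"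
    if "x \<in> carrier M" "y \<in> carrier M" for x y
    using that S T A1.subset by (auto simp: Pi_iff)
  note [simp] = bracket_part_subcarrier[OF A.group_axioms A1]
  show ?thesis
  proof (rule mult_lie_algebra_surj_image[of ?F ?f])
    show "mult_lie_algebra ?F"
      by (intro mult_lie_algebra_fibre_product[OF alg1 alg2 base] snd_mlie_hom_cocycle_algebra)
    have "(b, x) \<in> ?f ` carrier ?F" if "b \<in> carrier A" "x \<in> carrier M" for b x
      using that by (intro rev_image_eqI[of "((\<one>, x), (b, x))"]) (auto simp: fibre_product_def)
    then show "?f ` carrier ?F = carrier (cocycle_algebra M A \<chi> U Uf)"
      using A1.subset by (auto simp: fibre_product_def)
    show "?f \<one>\<^bsub>?F\<^esub> = \<one>\<^bsub>cocycle_algebra M A \<chi> U Uf\<^esub>" by (simp add: fibre_product_def)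
    fix p q assume "p \<in> carrier ?F" "q \<in> carrier ?F"
    then obtain a b x a' b' y where
      pq: "p = ((a, x), (b, x))" "q = ((a', y), (b', y))"
      "a \<in> A1" "b \<in> carrier A" "x \<in> carrier M" "a' \<in> A1" "b' \<in> carrier A" "y \<in> carrier M"
      by (auto simp: fibre_product_def)
    then have [simp]: "a \<in> carrier A" "a' \<in> carrier A" by auto
    show "?f (p \<otimes>\<^bsub>?F\<^esub> q) = ?f p \<otimes>\<^bsub>cocycle_algebra M A \<chi> U Uf\<^esub> ?f q"
      using pq by (simp add: fibre_product_def eq sigma_mult A.m_ac)
    show "?f \<lbrace>p, q\<rbrace>\<^bsub>?F\<^esub> = \<lbrace>?f p, ?f q\<rbrace>\<^bsub>cocycle_algebra M A \<chi> U Uf\<^esub>"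
      using pq by (simp add: fibre_product_def eq bp_mult A.m_ac)
  qed
qed

text \<open>Inverting the coefficients is an isomorphism of the extensions.\<close>

lemma cocycle_algebra_inv:
  assumes S: "S \<in> carrier M \<times> carrier M \<rightarrow> carrier A" "Sf \<in> carrier M \<times> carrier M \<rightarrow> carrier A"
    and alg: "mult_lie_algebra (cocycle_algebra M A \<chi> S Sf)"
    and eq: "\<And>x y. \<lbrakk>x \<in> carrier M; y \<in> carrier M\<rbrakk> \<Longrightarrow> U (x, y) = inv (S (x, y))"
      "\<And>x y. \<lbrakk>x \<in> carrier M; y \<in> carrier M\<rbrakk> \<Longrightarrow> Uf (x, y) = inv (Sf (x, y))"
  shows "mult_lie_algebra (cocycle_algebra M A \<chi> U Uf)"
proof (rule mult_lie_algebra_surj_image[of "cocycle_algebra M A \<chi> S Sf" "\<lambda>(a, x). (inv a, x)"])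
  have SB [simp]: "S (x, y) \<in> carrier A" "Sf (x, y) \<in> carrier A"
    if "x \<in> carrier M" "y \<in> carrier M" for x y
    using that S by (auto simp: Pi_iff)
  have "(b, x) \<in> (\<lambda>(a, x). (inv a, x)) ` (carrier A \<times> carrier M)" if "b \<in> carrier A" "x \<in> carrier M" for b x
    using that by (intro rev_image_eqI[of "(inv b, x)"]) auto
  then show "(\<lambda>(a, x). (inv a, x)) ` carrier (cocycle_algebra M A \<chi> S Sf) = carrier (cocycle_algebra M A \<chi> U Uf)"
    by auto
qed (use S in \<open>auto simp: alg eq sigma_inv bp_inv A.inv_mult Pi_iff\<close>)

text \<open>The coboundary of \<open>h\<close> is the cocycle of the split extension for the section
  \<open>x \<mapsto> (h x, x)\<close>; shifting the coefficients by \<open>h\<close> translates one description into the other.\<close>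

lemma cocycle_algebra_coboundary:
  assumes h: "h \<in> carrier M \<rightarrow> carrier A" "h \<one>\<^bsub>M\<^esub> = \<one>"
  shows "mult_lie_algebra (cocycle_algebra M A \<chi> (fst (coboundary M A \<chi> h)) (snd (coboundary M A \<chi> h)))"
proof -
  let ?U = "fst (coboundary M A \<chi> h)" and ?Uf = "snd (coboundary M A \<chi> h)"
  let ?f = "\<lambda>(a, x). (a \<otimes> inv (h x), x)"
  have [simp]: "h x \<in> carrier A" if "x \<in> carrier M" for x using h(1) that by blast
  show "mult_lie_algebra (cocycle_algebra M A \<chi> ?U ?Uf)"
  proof (rule mult_lie_algebra_surj_image[of "semidirect M A \<chi>" ?f])
    have "(b, x) \<in> ?f ` (carrier A \<times> carrier M)" if "b \<in> carrier A" "x \<in> carrier M" for b x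
      using that by (intro rev_image_eqI[of "(b \<otimes> h x, x)"]) (auto simp: A.m_assoc)
    then show "?f ` carrier (semidirect M A \<chi>) = carrier (cocycle_algebra M A \<chi> ?U ?Uf)"
      by auto
    show "?f \<one>\<^bsub>semidirect M A \<chi>\<^esub> = \<one>\<^bsub>cocycle_algebra M A \<chi> ?U ?Uf\<^esub>"
      by (simp add: h(2))
    fix p q assume "p \<in> carrier (semidirect M A \<chi>)" "q \<in> carrier (semidirect M A \<chi>)"
    then obtain a x b y where
      pq: "p = (a, x)" "q = (b, y)" "a \<in> carrier A" "x \<in> carrier M" "b \<in> carrier A" "y \<in> carrier M"
      by auto
    have "a \<otimes> \<sigma> x b \<otimes> inv (h (x \<otimes>\<^bsub>M\<^esub> y))
       = a \<otimes> inv (h x) \<otimes> \<sigma> x (b \<otimes> inv (h y)) \<otimes> (h x \<otimes> \<sigma> x (h y) \<otimes> inv (h (x \<otimes>\<^bsub>M\<^esub> y)))"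
      using pq A.mult_inv_cancel_pairs[of a "h x" "\<sigma> x b" "\<sigma> x (h y)" "inv (h (x \<otimes>\<^bsub>M\<^esub> y))"]
      by (simp add: sigma_mult sigma_inv)
    then show "?f (p \<otimes>\<^bsub>semidirect M A \<chi>\<^esub> q) = ?f p \<otimes>\<^bsub>cocycle_algebra M A \<chi> ?U ?Uf\<^esub> ?f q"
      using pq by (simp add: coboundary_def)
    have "bp x y a b \<otimes> inv (h \<lbrace>x, y\<rbrace>\<^bsub>M\<^esub>)
       = bp x y (a \<otimes> inv (h x)) (b \<otimes> inv (h y)) \<otimes> (bp x y (h x) (h y) \<otimes> inv (h \<lbrace>x, y\<rbrace>\<^bsub>M\<^esub>))"
      using pq by (simp add: bp_mult bp_inv A.m_assoc)
    then show "?f \<lbrace>p, q\<rbrace>\<^bsub>semidirect M A \<chi>\<^esub> = \<lbrace>?f p, ?f q\<rbrace>\<^bsub>cocycle_algebra M A \<chi> ?U ?Uf\<^esub>"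
      using pq by (simp add: coboundary_def)
  qed (rule split)
qed

lemma coboundary_in_cocycles:
  assumes h: "h \<in> carrier M \<rightarrow> carrier A" "h \<one>\<^bsub>M\<^esub> = \<one>"
  shows "coboundary M A \<chi> h \<in> cocycles M A \<chi>"
proof -
  have hx [simp]: "h x \<in> carrier A" if "x \<in> carrier M" for x using h(1) that by blast
  obtain U Uf where U: "coboundary M A \<chi> h = (U, Uf)" by (cases "coboundary M A \<chi> h")
  have "normalized_pair M A (fst (coboundary M A \<chi> h)) (snd (coboundary M A \<chi> h))"
    by (auto simp: normalized_pair_def coboundary_def h(2) M.bracket_self)
  then show ?thesis
    using cocycle_algebra_coboundary[OF h] by (simp add: U cocycles_iff)
qed

lemma cocycles_subgroup: "subgroup (cocycles M A \<chi>) (cochain_group M A)"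
proof -
  let ?PG = "product_group (carrier M \<times> carrier M) (\<lambda>_. A)"
  have PG: "group ?PG" by simp
  interpret G: group "cochain_group M A" by (intro DirProd_group PG)
  have norm: "normalized_pair M A S Sf" if "(S, Sf) \<in> cocycles M A \<chi>" for S Sf
    using that by (simp add: cocycles_iff)
  show ?thesis
  proof (rule G.subgroupI)
    show "cocycles M A \<chi> \<subseteq> carrier (cochain_group M A)"
      by (auto simp: cocycles_def)
    show "cocycles M A \<chi> \<noteq> {}" using coboundary_in_cocycles[of "\<lambda>_. \<one>"] by auto
  next
    fix c assume c: "c \<in> cocycles M A \<chi>"
    obtain S Sf where S: "c = (S, Sf)" by (cases c)
    note n = norm[OF c[unfolded S], unfolded normalized_pair_def]
    have SP: "S \<in> carrier M \<times> carrier M \<rightarrow>\<^sub>E carrier A" "Sf \<in> carrier M \<times> carrier M \<rightarrow>\<^sub>E carrier A"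
      using n by simp_all
    have val: "S p \<in> carrier A" "Sf p \<in> carrier A" if "p \<in> carrier M \<times> carrier M" for p
      using PiE_mem[OF SP(1) that] PiE_mem[OF SP(2) that] by simp_all
    let ?U = "\<lambda>p\<in>carrier M \<times> carrier M. inv (S p)" and ?Uf = "\<lambda>p\<in>carrier M \<times> carrier M. inv (Sf p)"
    have "inv\<^bsub>cochain_group M A\<^esub> c = (?U, ?Uf)"
      using SP by (simp add: S PG)
    moreover have "normalized_pair M A ?U ?Uf"
      using n val by (auto simp: normalized_pair_def)
    moreover have "mult_lie_algebra (cocycle_algebra M A \<chi> ?U ?Uf)"
      by (rule cocycle_algebra_inv[of S Sf]) (use SP c in \<open>auto simp: S cocycles_iff PiE_iff\<close>)
    ultimately show "inv\<^bsub>cochain_group M A\<^esub> c \<in> cocycles M A \<chi>" by (simp add: cocycles_iff)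
  next
    fix c d assume c: "c \<in> cocycles M A \<chi>" and d: "d \<in> cocycles M A \<chi>"
    obtain S Sf T Tf where S: "c = (S, Sf)" and T: "d = (T, Tf)" by (cases c; cases d)
    note n = norm[OF c[unfolded S], unfolded normalized_pair_def]
    note m = norm[OF d[unfolded T], unfolded normalized_pair_def]
    have SP: "S \<in> carrier M \<times> carrier M \<rightarrow>\<^sub>E carrier A" "Sf \<in> carrier M \<times> carrier M \<rightarrow>\<^sub>E carrier A"
      using n by simp_all
    have TP: "T \<in> carrier M \<times> carrier M \<rightarrow>\<^sub>E carrier A" "Tf \<in> carrier M \<times> carrier M \<rightarrow>\<^sub>E carrier A"
      using m by simp_all
    have val: "S p \<in> carrier A" "Sf p \<in> carrier A" "T p \<in> carrier A" "Tf p \<in> carrier A"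
      if "p \<in> carrier M \<times> carrier M" for p
      using PiE_mem[OF SP(1) that] PiE_mem[OF SP(2) that] PiE_mem[OF TP(1) that] PiE_mem[OF TP(2) that]
      by simp_all
    let ?U = "\<lambda>p\<in>carrier M \<times> carrier M. S p \<otimes> T p" and ?Uf = "\<lambda>p\<in>carrier M \<times> carrier M. Sf p \<otimes> Tf p"
    have "c \<otimes>\<^bsub>cochain_group M A\<^esub> d = (?U, ?Uf)" by (simp add: S T)
    moreover have "normalized_pair M A ?U ?Uf"
      using n m val by (auto simp: normalized_pair_def)
    moreover have "mult_lie_algebra (cocycle_algebra M A \<chi> ?U ?Uf)"
      by (rule cocycle_algebra_mult[of "carrier A" S Sf T Tf])
         (use SP TP c d A.subgroup_self in \<open>auto simp: S T cocycles_iff PiE_iff\<close>)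
    ultimately show "c \<otimes>\<^bsub>cochain_group M A\<^esub> d \<in> cocycles M A \<chi>" by (simp add: cocycles_iff)
  qed
qed

lemma comm_group_cocycle_group: "comm_group (cocycle_group M A \<chi>)"
  unfolding cocycle_group_def
  by (intro comm_group_subgroup cocycles_subgroup comm_group_DirProd comm_group_product_group
      A.comm_group_axioms)

lemma coboundary_mult:
  assumes "h \<in> carrier M \<rightarrow> carrier A" "k \<in> carrier M \<rightarrow> carrier A"
  shows "coboundary M A \<chi> (\<lambda>x. h x \<otimes> k x) = coboundary M A \<chi> h \<otimes>\<^bsub>cocycle_group M A \<chi>\<^esub> coboundary M A \<chi> k"
proof -
  have [simp]: "h x \<in> carrier A" "k x \<in> carrier A" if "x \<in> carrier M" for x using assms that by auto
  show ?thesis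
    by (auto simp: coboundary_def sigma_mult bp_mult A.inv_mult A.m_ac intro!: restrict_ext)
qed

lemma coboundaries_subgroup: "subgroup (coboundaries M A \<chi>) (cocycle_group M A \<chi>)"
proof -
  interpret G: comm_group "cocycle_group M A \<chi>" by (rule comm_group_cocycle_group)
  let ?C = "{h \<in> carrier M \<rightarrow> carrier A. h \<one>\<^bsub>M\<^esub> = \<one>}"
  show ?thesis
    unfolding coboundaries_eq
  proof (rule G.subgroupI)
    show "coboundary M A \<chi> ` ?C \<subseteq> carrier (cocycle_group M A \<chi>)"
      using coboundary_in_cocycles by auto
    show "coboundary M A \<chi> ` ?C \<noteq> {}" by auto
  next
    fix c assume "c \<in> coboundary M A \<chi> ` ?C"
    then obtain h where h: "h \<in> ?C" "c = coboundary M A \<chi> h" by blast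
    then have [simp]: "h x \<in> carrier A" if "x \<in> carrier M" for x using that by auto
    have k: "(\<lambda>x. inv (h x)) \<in> ?C" using h by auto
    have "coboundary M A \<chi> (\<lambda>x. inv (h x)) \<otimes>\<^bsub>cocycle_group M A \<chi>\<^esub> coboundary M A \<chi> h
        = coboundary M A \<chi> (\<lambda>x. inv (h x) \<otimes> h x)"
      using h k by (intro coboundary_mult[symmetric]) auto
    also have "\<dots> = \<one>\<^bsub>cocycle_group M A \<chi>\<^esub>"
      by (auto simp: coboundary_def intro!: restrict_ext)
    finally have "inv\<^bsub>cocycle_group M A \<chi>\<^esub> c = coboundary M A \<chi> (\<lambda>x. inv (h x))"
      using h k coboundary_in_cocycles by (intro G.inv_equality) auto
    then show "inv\<^bsub>cocycle_group M A \<chi>\<^esub> c \<in> coboundary M A \<chi> ` ?C" using k by auto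
  next
    fix c d assume "c \<in> coboundary M A \<chi> ` ?C" "d \<in> coboundary M A \<chi> ` ?C"
    then obtain h k where h: "h \<in> ?C" "c = coboundary M A \<chi> h" and k: "k \<in> ?C" "d = coboundary M A \<chi> k"
      by blast
    then have "c \<otimes>\<^bsub>cocycle_group M A \<chi>\<^esub> d = coboundary M A \<chi> (\<lambda>x. h x \<otimes> k x)"
      by (simp add: coboundary_mult)
    moreover have "(\<lambda>x. h x \<otimes> k x) \<in> ?C" using h k by auto
    ultimately show "c \<otimes>\<^bsub>cocycle_group M A \<chi>\<^esub> d \<in> coboundary M A \<chi> ` ?C" by blast
  qed
qed

lemma group_H1: "group (H1 M A \<chi>)"
  unfolding H1_def
  by (intro comm_group.axioms(2) comm_group.abelian_FactGroup comm_group_derivation_group principal_subgroup)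

lemma group_H2: "group (H2 M A \<chi>)"
  unfolding H2_def
  by (intro comm_group.axioms(2) comm_group.abelian_FactGroup comm_group_cocycle_group coboundaries_subgroup)

lemma H1_class_hom: "H1_class M A \<chi> \<in> hom (derivation_group M A \<chi>) (H1 M A \<chi>)"
  unfolding H1_def H1_class_def by (intro r_coset_hom comm_group_derivation_group principal_subgroup)

lemma H2_class_hom: "H2_class M A \<chi> \<in> hom (cocycle_group M A \<chi>) (H2 M A \<chi>)"
  unfolding H2_def H2_class_def by (intro r_coset_hom comm_group_cocycle_group coboundaries_subgroup)

lemma H1_class_eq_one_iff:
  assumes "d \<in> derivations M A \<chi>"
  shows "H1_class M A \<chi> d = \<one>\<^bsub>H1 M A \<chi>\<^esub> \<longleftrightarrow> d \<in> principal_derivations M A \<chi>"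
  unfolding H1_def H1_class_def one_FactGroup
  by (rule r_coset_eq_subgroup_iff[OF comm_group_derivation_group principal_subgroup]) (use assms in simp)

lemma H2_class_eq_one_iff:
  assumes "c \<in> cocycles M A \<chi>"
  shows "H2_class M A \<chi> c = \<one>\<^bsub>H2 M A \<chi>\<^esub> \<longleftrightarrow> c \<in> coboundaries M A \<chi>"
  unfolding H2_def H2_class_def one_FactGroup
  by (rule r_coset_eq_subgroup_iff[OF comm_group_cocycle_group coboundaries_subgroup]) (use assms in simp)

end


section \<open>Realized action terms split\<close>

text \<open>If \<open>E\<close> realizes the action terms, the fibre square \<open>E \<times>\<^sub>M E\<close> has the diagonal as a splitting
  over its second projection, and dividing the base \<open>E\<close> down to \<open>M\<close> turns it into the split
  extension; in coordinates, \<open>(a e, e) \<mapsto> (a, p e)\<close>.\<close>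

lemma realized_imp_split:
  fixes M :: "'m mlie" and A :: "'a mlie" and E :: "'e mlie"
  assumes A: "abelian_mult_lie_algebra A" and act: "action_terms M A \<chi>"
    and realized: "realized_by M A \<chi> E i p"
  shows "mult_lie_algebra (semidirect M A \<chi>)"
proof -
  from realized obtain l where
    ex: "mlie_short_exact A E M i p" and l: "normalized_section E M p l" and
    val: "\<And>m a. \<lbrakk>m \<in> carrier M; a \<in> carrier A\<rbrakk> \<Longrightarrow>
           i (sigma \<chi> m a) = l m \<otimes>\<^bsub>E\<^esub> i a \<otimes>\<^bsub>E\<^esub> inv\<^bsub>E\<^esub> (l m) \<and>
           i (tau \<chi> m a) = \<lbrace>l m, i a\<rbrace>\<^bsub>E\<^esub> \<and> i (nu \<chi> a m) = \<lbrace>i a, l m\<rbrace>\<^bsub>E\<^esub>"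
    unfolding realized_by_def by blast
  interpret A: abelian_mult_lie_algebra A by (rule A)
  interpret E: mult_lie_algebra E using ex by (simp add: mlie_short_exact_def)
  interpret M: mult_lie_algebra M using ex by (simp add: mlie_short_exact_def)
  have i: "i \<in> mlie_hom A E" and p: "p \<in> mlie_hom E M"
    using ex by (simp_all add: mlie_short_exact_def)
  interpret i: group_hom A E i using i by unfold_locales (simp add: mlie_hom_def)
  interpret p: group_hom E M p using p by unfold_locales (simp add: mlie_hom_def)
  note [simp] = E.bracket_closed M.bracket_closed
  have inj: "inj_on i (carrier A)" and im: "i ` carrier A = kernel E M p" and sur: "p ` carrier E = carrier M"
    using ex by (simp_all add: mlie_short_exact_def)
  have pi [simp]: "p (i a) = \<one>\<^bsub>M\<^esub>" if "a \<in> carrier A" for a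
    using im that by (auto simp: kernel_def)
  have lE [simp]: "l m \<in> carrier E" "p (l m) = m" if "m \<in> carrier M" for m
    using l that by (auto simp: normalized_section_def)
  have fibre: "\<exists>a\<in>carrier A. e = i a \<otimes>\<^bsub>E\<^esub> e'"
    if "e \<in> carrier E" "e' \<in> carrier E" "p e = p e'" for e e'
  proof -
    have "e \<otimes>\<^bsub>E\<^esub> inv\<^bsub>E\<^esub> e' \<in> i ` carrier A" using that by (simp add: im kernel_def)
    then obtain a where "a \<in> carrier A" "e \<otimes>\<^bsub>E\<^esub> inv\<^bsub>E\<^esub> e' = i a" by auto
    then show ?thesis using that by (intro bexI[of _ a]) (simp_all flip: \<open>_ = i a\<close> add: E.m_assoc)
  qed
  have ibr [simp]: "\<lbrace>i a, i b\<rbrace>\<^bsub>E\<^esub> = \<one>\<^bsub>E\<^esub>" if "a \<in> carrier A" "b \<in> carrier A" for a b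
    using mlie_homD(3)[OF i that] A.bracket_trivial[OF that] by simp
  have icomm: "i a \<otimes>\<^bsub>E\<^esub> i b = i b \<otimes>\<^bsub>E\<^esub> i a" if "a \<in> carrier A" "b \<in> carrier A" for a b
    using that A.m_comm by (simp flip: i.hom_mult)
  have iconj: "conj_by E (i a) (i b) = i a" if "a \<in> carrier A" "b \<in> carrier A" for a b
    using that icomm[of b a] by (simp add: conj_by_def E.m_assoc)
  have cl [simp]: "sigma \<chi> m u \<in> carrier A" "tau \<chi> m u \<in> carrier A" "nu \<chi> u m \<in> carrier A"
    if "m \<in> carrier M" "u \<in> carrier A" for m u
    using act that by (auto simp: action_terms_def mlie_hom_def hom_def)
  \<comment> \<open>since \<open>A\<close> is abelian, every lift of \<open>m\<close> to \<open>E\<close> acts on \<open>A\<close> as \<open>l m\<close> does\<close>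
  have lift: "e \<otimes>\<^bsub>E\<^esub> i u = i (sigma \<chi> (p e) u) \<otimes>\<^bsub>E\<^esub> e"
      "\<lbrace>e, i u\<rbrace>\<^bsub>E\<^esub> = i (tau \<chi> (p e) u)" "\<lbrace>i u, e\<rbrace>\<^bsub>E\<^esub> = i (nu \<chi> u (p e))"
    if e: "e \<in> carrier E" and u: "u \<in> carrier A" for e u
  proof -
    obtain c where c: "c \<in> carrier A" "e = i c \<otimes>\<^bsub>E\<^esub> l (p e)"
      using fibre[of e "l (p e)"] e by auto
    let ?l = "l (p e)"
    have lu: "?l \<otimes>\<^bsub>E\<^esub> i u = i (sigma \<chi> (p e) u) \<otimes>\<^bsub>E\<^esub> ?l"
      using val[of "p e" u] e u by (simp add: E.m_assoc)
    have "e \<otimes>\<^bsub>E\<^esub> i u = i c \<otimes>\<^bsub>E\<^esub> (?l \<otimes>\<^bsub>E\<^esub> i u)"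
      using c e u by (metis E.m_assoc lE(1) i.hom_closed p.hom_closed)
    also have "\<dots> = i (sigma \<chi> (p e) u) \<otimes>\<^bsub>E\<^esub> (i c \<otimes>\<^bsub>E\<^esub> ?l)"
      using c(1) e u icomm[of c "sigma \<chi> (p e) u"] by (simp add: lu flip: E.m_assoc)
    finally have 1: "e \<otimes>\<^bsub>E\<^esub> i u = i (sigma \<chi> (p e) u) \<otimes>\<^bsub>E\<^esub> e" using c(2) by simp
    have "\<lbrace>i c \<otimes>\<^bsub>E\<^esub> ?l, i u\<rbrace>\<^bsub>E\<^esub> = i (tau \<chi> (p e) u)"
      using val[of "p e" u] c(1) e u iconj[of "tau \<chi> (p e) u" c] by (simp add: E.bracket_mult_left flip: val)
    moreover have "\<lbrace>i u, i c \<otimes>\<^bsub>E\<^esub> ?l\<rbrace>\<^bsub>E\<^esub> = i (nu \<chi> u (p e))"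
      using val[of "p e" u] c(1) e u iconj[of "nu \<chi> u (p e)" c] by (simp add: E.bracket_mult_right flip: val)
    ultimately show "e \<otimes>\<^bsub>E\<^esub> i u = i (sigma \<chi> (p e) u) \<otimes>\<^bsub>E\<^esub> e"
      "\<lbrace>e, i u\<rbrace>\<^bsub>E\<^esub> = i (tau \<chi> (p e) u)" "\<lbrace>i u, e\<rbrace>\<^bsub>E\<^esub> = i (nu \<chi> u (p e))"
      using 1 c(2) by simp_all
  qed
  let ?F = "fibre_product E E p p"
  let ?f = "\<lambda>(e, e'). (inv_into (carrier A) i (e \<otimes>\<^bsub>E\<^esub> inv\<^bsub>E\<^esub> e'), p e')"
  have f: "?f (i a \<otimes>\<^bsub>E\<^esub> e, e) = (a, p e)" if "a \<in> carrier A" "e \<in> carrier E" for a e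
    using that by (simp add: E.m_assoc inv_into_f_f[OF inj])
  have F: "(i a \<otimes>\<^bsub>E\<^esub> e, e) \<in> carrier ?F" if "a \<in> carrier A" "e \<in> carrier E" for a e
    using that by (simp add: fibre_product_def)
  have Fcases: "\<exists>a e. x = (i a \<otimes>\<^bsub>E\<^esub> e, e) \<and> a \<in> carrier A \<and> e \<in> carrier E" if xF: "x \<in> carrier ?F" for x
  proof -
    obtain e e' where x: "x = (e, e')" "e \<in> carrier E" "e' \<in> carrier E" "p e = p e'"
      using xF by (auto simp: fibre_product_def)
    then show ?thesis using fibre[of e e'] by blast
  qed
  show ?thesis
  proof (rule mult_lie_algebra_surj_image[of ?F ?f])
    show "mult_lie_algebra ?F"
      by (intro mult_lie_algebra_fibre_product[OF E.mult_lie_algebra_axioms E.mult_lie_algebra_axioms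
            M.mult_lie_algebra_axioms] p)
    have "(a, m) \<in> ?f ` carrier ?F" if "a \<in> carrier A" "m \<in> carrier M" for a m
      using that f[of a "l m"] F[of a "l m"] by (intro rev_image_eqI[of "(i a \<otimes>\<^bsub>E\<^esub> l m, l m)"]) auto
    moreover have "?f x \<in> carrier A \<times> carrier M" if "x \<in> carrier ?F" for x
      using Fcases[OF that] f by auto
    ultimately show "?f ` carrier ?F = carrier (semidirect M A \<chi>)" by auto
    show "?f \<one>\<^bsub>?F\<^esub> = \<one>\<^bsub>semidirect M A \<chi>\<^esub>"
      using f[of "\<one>\<^bsub>A\<^esub>" "\<one>\<^bsub>E\<^esub>"] by (simp add: fibre_product_def)
    fix x y assume "x \<in> carrier ?F" "y \<in> carrier ?F"
    then obtain a e b e' where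
      xy: "x = (i a \<otimes>\<^bsub>E\<^esub> e, e)" "y = (i b \<otimes>\<^bsub>E\<^esub> e', e')" and
      [simp]: "a \<in> carrier A" "e \<in> carrier E" "b \<in> carrier A" "e' \<in> carrier E"
      using Fcases by metis
    have "i a \<otimes>\<^bsub>E\<^esub> e \<otimes>\<^bsub>E\<^esub> (i b \<otimes>\<^bsub>E\<^esub> e') = i a \<otimes>\<^bsub>E\<^esub> (e \<otimes>\<^bsub>E\<^esub> i b) \<otimes>\<^bsub>E\<^esub> e'"
      by (simp add: E.m_assoc)
    also have "\<dots> = i (a \<otimes>\<^bsub>A\<^esub> sigma \<chi> (p e) b) \<otimes>\<^bsub>E\<^esub> (e \<otimes>\<^bsub>E\<^esub> e')"
      by (subst lift(1)) (simp_all add: E.m_assoc)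
    finally show "?f (x \<otimes>\<^bsub>?F\<^esub> y) = ?f x \<otimes>\<^bsub>semidirect M A \<chi>\<^esub> ?f y"
      using f[of "a \<otimes>\<^bsub>A\<^esub> sigma \<chi> (p e) b" "e \<otimes>\<^bsub>E\<^esub> e'"] f[of a e] f[of b e']
      by (simp add: xy fibre_product_def)
    let ?X = "\<lbrace>e, e'\<rbrace>\<^bsub>E\<^esub>" and ?\<tau> = "tau \<chi> (p e) b" and ?\<nu> = "nu \<chi> a (p e')"
    have pX: "p ?X = \<lbrace>p e, p e'\<rbrace>\<^bsub>M\<^esub>" by (simp add: mlie_homD(3)[OF p])
    let ?u = "?\<nu> \<otimes>\<^bsub>A\<^esub> inv\<^bsub>A\<^esub> a \<otimes>\<^bsub>A\<^esub> inv\<^bsub>A\<^esub> b"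
    have "\<lbrace>i a \<otimes>\<^bsub>E\<^esub> e, i b \<otimes>\<^bsub>E\<^esub> e'\<rbrace>\<^bsub>E\<^esub>
        = i a \<otimes>\<^bsub>E\<^esub> (i ?\<tau> \<otimes>\<^bsub>E\<^esub> (i b \<otimes>\<^bsub>E\<^esub> ?X \<otimes>\<^bsub>E\<^esub> inv\<^bsub>E\<^esub> i b)) \<otimes>\<^bsub>E\<^esub> inv\<^bsub>E\<^esub> i a \<otimes>\<^bsub>E\<^esub> i ?\<nu>"
    proof -
      have "\<lbrace>e, i b \<otimes>\<^bsub>E\<^esub> e'\<rbrace>\<^bsub>E\<^esub> = i ?\<tau> \<otimes>\<^bsub>E\<^esub> conj_by E ?X (i b)"
        by (simp add: E.bracket_mult_right lift(2)[of e b])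
      moreover have "\<lbrace>i a, i b \<otimes>\<^bsub>E\<^esub> e'\<rbrace>\<^bsub>E\<^esub> = i ?\<nu>"
        by (simp add: E.bracket_mult_right lift(3)[of e' a] iconj)
      ultimately show ?thesis
        by (subst E.bracket_mult_left) (simp_all add: conj_by_def)
    qed
    also have "\<dots> = i (a \<otimes>\<^bsub>A\<^esub> ?\<tau> \<otimes>\<^bsub>A\<^esub> b) \<otimes>\<^bsub>E\<^esub> (?X \<otimes>\<^bsub>E\<^esub> i (inv\<^bsub>A\<^esub> b \<otimes>\<^bsub>A\<^esub> inv\<^bsub>A\<^esub> a \<otimes>\<^bsub>A\<^esub> ?\<nu>))"
      by (simp add: E.m_assoc)
    also have "inv\<^bsub>A\<^esub> b \<otimes>\<^bsub>A\<^esub> inv\<^bsub>A\<^esub> a \<otimes>\<^bsub>A\<^esub> ?\<nu> = ?u" by (simp add: A.m_ac)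
    also have "i (a \<otimes>\<^bsub>A\<^esub> ?\<tau> \<otimes>\<^bsub>A\<^esub> b) \<otimes>\<^bsub>E\<^esub> (?X \<otimes>\<^bsub>E\<^esub> i ?u)
        = i (a \<otimes>\<^bsub>A\<^esub> ?\<tau> \<otimes>\<^bsub>A\<^esub> b) \<otimes>\<^bsub>E\<^esub> (i (sigma \<chi> (p ?X) ?u) \<otimes>\<^bsub>E\<^esub> ?X)"
      by (subst lift(1)[of ?X ?u]) simp_all
    also have "\<dots> = i (a \<otimes>\<^bsub>A\<^esub> ?\<tau> \<otimes>\<^bsub>A\<^esub> b \<otimes>\<^bsub>A\<^esub> sigma \<chi> (p ?X) ?u) \<otimes>\<^bsub>E\<^esub> ?X"
      by (simp add: E.m_assoc)
    also have "a \<otimes>\<^bsub>A\<^esub> ?\<tau> \<otimes>\<^bsub>A\<^esub> b \<otimes>\<^bsub>A\<^esub> sigma \<chi> (p ?X) ?u = bracket_part M A \<chi> (p e) (p e') a b"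
      unfolding pX bracket_part_def by (simp add: A.m_ac)
    finally show "?f \<lbrace>x, y\<rbrace>\<^bsub>?F\<^esub> = \<lbrace>?f x, ?f y\<rbrace>\<^bsub>semidirect M A \<chi>\<^esub>"
      using f[of "bracket_part M A \<chi> (p e) (p e') a b" ?X] f[of a e] f[of b e']
      by (simp add: xy fibre_product_def pX bracket_part_def)
  qed
qed


section \<open>Coefficients over the quotient\<close>

lemma cocycle_algebra_restrict_base:
  "cocycle_algebra (M\<lparr>carrier := I\<rparr>) A \<chi> S Sf = (cocycle_algebra M A \<chi> S Sf)\<lparr>carrier := carrier A \<times> I\<rparr>"
  by (simp add: cocycle_algebra_def bracket_part_def)

lemma bracket_part_restrict_base [simp]:
  "bracket_part (M\<lparr>carrier := I\<rparr>) A \<chi> = bracket_part M A \<chi>"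
  by (simp add: bracket_part_def fun_eq_iff)

locale inflation_restriction = action_module M A \<chi>
  for M :: "'m mlie" and A :: "'a mlie" (structure) and \<chi> :: "('m, 'a) action" +
  fixes I :: "'m set" and Q :: "'q mlie" and \<pi> :: "'m \<Rightarrow> 'q" and l :: "'q \<Rightarrow> 'm"
  assumes exact: "mlie_short_exact (M\<lparr>carrier := I\<rparr>) M Q (\<lambda>n. n) \<pi>"
    and H0_trivial: "H0 M A \<chi> = {\<one>}"
    and sect: "normalized_section M Q \<pi> l"
begin

abbreviation AI where "AI \<equiv> A\<lparr>carrier := invariants I A \<chi>\<rparr>"
abbreviation \<chi>' where "\<chi>' \<equiv> induced_action M \<pi> \<chi>"
abbreviation MI where "MI \<equiv> M\<lparr>carrier := I\<rparr>"
abbreviation M_mult (infixl \<open>\<cdot>\<close> 70) where "x \<cdot> y \<equiv> x \<otimes>\<^bsub>M\<^esub> y"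

sublocale Q: mult_lie_algebra Q using exact by (simp add: mlie_short_exact_def)

declare Q.bracket_closed [simp]

lemma pi_hom: "\<pi> \<in> mlie_hom M Q" using exact by (simp add: mlie_short_exact_def)

sublocale pi: group_hom M Q \<pi> using pi_hom by unfold_locales (simp add: mlie_hom_def)

lemma pi_bracket [simp]: "\<lbrakk>x \<in> carrier M; y \<in> carrier M\<rbrakk> \<Longrightarrow> \<pi> \<lbrace>x, y\<rbrace>\<^bsub>M\<^esub> = \<lbrace>\<pi> x, \<pi> y\<rbrace>\<^bsub>Q\<^esub>"
  by (rule mlie_homD[OF pi_hom])

lemma pi_surj: "\<pi> ` carrier M = carrier Q" using exact by (simp add: mlie_short_exact_def)

lemma I_iff: "n \<in> I \<longleftrightarrow> n \<in> carrier M \<and> \<pi> n = \<one>\<^bsub>Q\<^esub>"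
  using exact by (auto simp: mlie_short_exact_def kernel_def)

lemma section_closed [simp]: "x \<in> carrier Q \<Longrightarrow> l x \<in> carrier M"
  and pi_section [simp]: "x \<in> carrier Q \<Longrightarrow> \<pi> (l x) = x"
  and section_one [simp]: "l \<one>\<^bsub>Q\<^esub> = \<one>\<^bsub>M\<^esub>"
  using sect by (auto simp: normalized_section_def)

lemma I_bracket [simp]:
  "\<lbrakk>m \<in> carrier M; n \<in> I\<rbrakk> \<Longrightarrow> \<lbrace>m, n\<rbrace>\<^bsub>M\<^esub> \<in> I"
  "\<lbrakk>m \<in> carrier M; n \<in> I\<rbrakk> \<Longrightarrow> \<lbrace>n, m\<rbrace>\<^bsub>M\<^esub> \<in> I"
  by (simp_all add: I_iff)

lemma I_conj [simp]: "\<lbrakk>m \<in> carrier M; n \<in> I\<rbrakk> \<Longrightarrow> m \<cdot> n \<cdot> inv\<^bsub>M\<^esub> m \<in> I"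
  "\<lbrakk>m \<in> carrier M; n \<in> I\<rbrakk> \<Longrightarrow> inv\<^bsub>M\<^esub> m \<cdot> n \<cdot> m \<in> I"
  by (simp_all add: I_iff)

lemma I_mult [simp]: "\<lbrakk>m \<in> I; n \<in> I\<rbrakk> \<Longrightarrow> m \<cdot> n \<in> I"
  and I_inv [simp]: "n \<in> I \<Longrightarrow> inv\<^bsub>M\<^esub> n \<in> I"
  and I_one [simp]: "\<one>\<^bsub>M\<^esub> \<in> I"
  by (simp_all add: I_iff)

lemma I_carrier [simp]: "n \<in> I \<Longrightarrow> n \<in> carrier M" by (simp add: I_iff)

lemma same_fibre:
  assumes "m \<in> carrier M" "m' \<in> carrier M" "\<pi> m = \<pi> m'"
  shows "\<exists>n\<in>I. m = n \<cdot> m'"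
proof
  show "m \<cdot> inv\<^bsub>M\<^esub> m' \<in> I" "m = m \<cdot> inv\<^bsub>M\<^esub> m' \<cdot> m'"
    using assms by (simp_all add: I_iff M.m_assoc del: I_carrier)
qed

sublocale I: action_module MI A \<chi>
proof (rule action_module.intro)
  show mI: "mult_lie_algebra MI" using exact unfolding mlie_short_exact_def by blast
  show "abelian_mult_lie_algebra A" by (rule coeff)
  show "action_terms MI A \<chi>" using act by (auto simp: action_terms_def)
  have "subgroup (carrier A \<times> I) (semidirect M A \<chi>)"
    using I_one by (intro E.subgroupI) (auto simp: semidirect_inv simp del: I_one)
  then show "mult_lie_algebra (semidirect MI A \<chi>)"
    unfolding cocycle_algebra_restrict_base
    by (intro mult_lie_algebra_subalgebra split) auto
qed

text \<open>If \<open>n\<close> fixes \<open>a\<close>, then \<open>[{n,a},m] = {[n,a],m} = {1,m} = 1\<close> for every \<open>m\<close>, so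
  \<open>{n,a}\<close> is an \<open>M\<close>-invariant of \<open>A\<close>.\<close>

lemma tau_eq_one:
  assumes a: "a \<in> carrier A" and n: "n \<in> carrier M" and fix_a: "\<sigma> n a = a"
  shows "\<tau> n a = \<one>"
proof -
  have "\<sigma> m (\<tau> n a) = \<tau> n a" if m: "m \<in> carrier M" for m
  proof -
    have "\<one> = \<tau> n a \<otimes> inv (\<sigma> m (\<tau> n a))"
      using tau_commutator[OF n m a] a n m by (simp add: fix_a)
    then show ?thesis using a n m by (metis A.inv_solve_right A.l_one A.one_closed sigma_closed tau_closed)
  qed
  then have "\<tau> n a \<in> H0 M A \<chi>" using a n by (simp add: H0_def)
  then show ?thesis by (simp add: H0_trivial)
qed

lemma invariants_iff: "a \<in> invariants I A \<chi> \<longleftrightarrow> a \<in> carrier A \<and> (\<forall>n\<in>I. \<sigma> n a = a)"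
  by (auto simp: invariants_def tau_eq_one nu_eq_inv_tau)

lemma subgroup_invariants: "subgroup (invariants I A \<chi>) A"
proof (rule A.subgroupI)
  have "\<one> \<in> invariants I A \<chi>" by (simp add: invariants_iff)
  then show "invariants I A \<chi> \<noteq> {}" by blast
qed (simp_all add: invariants_iff sigma_mult sigma_inv subset_iff)

lemma invariants_carrier [simp]: "a \<in> invariants I A \<chi> \<Longrightarrow> a \<in> carrier A"
  by (simp add: invariants_iff)

lemma invariants_closed [simp]:
  "\<lbrakk>a \<in> invariants I A \<chi>; b \<in> invariants I A \<chi>\<rbrakk> \<Longrightarrow> a \<otimes> b \<in> invariants I A \<chi>"
  "a \<in> invariants I A \<chi> \<Longrightarrow> inv a \<in> invariants I A \<chi>"
  "\<one> \<in> invariants I A \<chi>"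
  using subgroup_invariants by (auto intro: subgroup.m_closed subgroup.m_inv_closed subgroup.one_closed)

lemma inv_AI [simp]: "a \<in> invariants I A \<chi> \<Longrightarrow> inv\<^bsub>AI\<^esub> a = inv a"
  by (rule A.m_inv_consistent[OF subgroup_invariants])

lemma bp_AI [simp]:
  "\<lbrakk>a \<in> invariants I A \<chi>; b \<in> invariants I A \<chi>\<rbrakk> \<Longrightarrow> bracket_part M AI \<chi> x y a b = bp x y a b"
  by (rule bracket_part_subcarrier[OF A.group_axioms subgroup_invariants])

lemma sigma_invariants [simp]:
  assumes a: "a \<in> invariants I A \<chi>" and m: "m \<in> carrier M"
  shows "\<sigma> m a \<in> invariants I A \<chi>"
proof -
  have a_fix: "\<sigma> k a = a" if "k \<in> I" for k using a that unfolding invariants_iff by blast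
  have "\<sigma> n (\<sigma> m a) = \<sigma> m a" if n: "n \<in> I" for n
  proof -
    have "\<sigma> n (\<sigma> m a) = \<sigma> (m \<cdot> (inv\<^bsub>M\<^esub> m \<cdot> n \<cdot> m)) a"
      using a m n by (simp add: M.m_assoc flip: sigma_comp)
    also have "\<dots> = \<sigma> m a"
      using a m n a_fix[OF I_conj(2)[OF m n]] by (subst sigma_comp) simp_all
    finally show ?thesis .
  qed
  then show ?thesis using a m by (intro invariants_iff[THEN iffD2]) simp
qed

lemma invariants_act [simp]:
  assumes "a \<in> invariants I A \<chi>" "n \<in> I"
  shows "\<sigma> n a = a" "\<tau> n a = \<one>" "\<nu> a n = \<one>"
  using assms unfolding invariants_def by blast+

text \<open>Since \<open>[m,a]\<close> is again invariant, \<open>[{m,a},n] = {[m,a],n} = 1\<close> for \<open>n \<in> I\<close>.\<close>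

lemma tau_invariants [simp]:
  assumes a: "a \<in> invariants I A \<chi>" and m: "m \<in> carrier M"
  shows "\<tau> m a \<in> invariants I A \<chi>"
proof -
  have "\<sigma> n (\<tau> m a) = \<tau> m a" if n: "n \<in> I" for n
  proof -
    have "\<one> = \<tau> m a \<otimes> inv (\<sigma> n (\<tau> m a))"
      using tau_commutator[of m n a] a m n by simp
    then show ?thesis using a n m
      by (metis A.inv_solve_right A.l_one A.one_closed I_carrier invariants_carrier sigma_closed tau_closed)
  qed
  then show ?thesis using a m by (intro invariants_iff[THEN iffD2]) simp
qed

lemma nu_invariants [simp]:
  "\<lbrakk>a \<in> invariants I A \<chi>; m \<in> carrier M\<rbrakk> \<Longrightarrow> \<nu> a m \<in> invariants I A \<chi>"
  by (subst nu_eq_inv_tau) (auto intro: invariants_closed(2) tau_invariants)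

lemma induced_action_eq [simp]:
  assumes a: "a \<in> invariants I A \<chi>" and m: "m \<in> carrier M"
  shows "sigma \<chi>' (\<pi> m) a = \<sigma> m a" "tau \<chi>' (\<pi> m) a = \<tau> m a" "nu \<chi>' a (\<pi> m) = \<nu> a m"
proof -
  have "\<sigma> k a = \<sigma> m a \<and> \<tau> k a = \<tau> m a \<and> \<nu> a k = \<nu> a m" if k: "k \<in> carrier M \<and> \<pi> k = \<pi> m" for k
  proof -
    have "\<exists>n\<in>I. k = n \<cdot> m" using same_fibre[of k m] k m by blast
    then obtain n where "n \<in> I" "k = n \<cdot> m" by blast
    have "\<sigma> (n \<cdot> m) a = \<sigma> m a" using a m \<open>n \<in> I\<close> by (simp add: sigma_comp)
    moreover have "\<tau> (n \<cdot> m) a = \<tau> m a" using a m \<open>n \<in> I\<close> by (simp add: tau_comp)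
    ultimately show ?thesis using a m k \<open>k = _\<close> by (metis invariants_carrier nu_eq_inv_tau)
  qed
  then have same: "\<sigma> k a = \<sigma> m a" "\<tau> k a = \<tau> m a" "\<nu> a k = \<nu> a m"
    if "k \<in> carrier M \<and> \<pi> k = \<pi> m" for k
    using that by blast+
  show "sigma \<chi>' (\<pi> m) a = \<sigma> m a"
    unfolding induced_action_def action.simps by (rule the_elem_unique_value[OF _ same(1)]) (use m in auto)
  show "tau \<chi>' (\<pi> m) a = \<tau> m a"
    unfolding induced_action_def action.simps by (rule the_elem_unique_value[OF _ same(2)]) (use m in auto)
  show "nu \<chi>' a (\<pi> m) = \<nu> a m"
    unfolding induced_action_def action.simps by (rule the_elem_unique_value[OF _ same(3)]) (use m in auto)
qed

lemma bp_induced [simp]: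
  "\<lbrakk>a \<in> invariants I A \<chi>; b \<in> invariants I A \<chi>; x \<in> carrier M; y \<in> carrier M\<rbrakk>
    \<Longrightarrow> bracket_part Q AI \<chi>' (\<pi> x) (\<pi> y) a b = bp x y a b"
  by (simp add: bracket_part_def flip: pi_bracket)

lemma bp_invariants [simp]:
  "\<lbrakk>a \<in> invariants I A \<chi>; b \<in> invariants I A \<chi>; x \<in> carrier M; y \<in> carrier M\<rbrakk>
    \<Longrightarrow> bp x y a b \<in> invariants I A \<chi>"
  by (simp add: bracket_part_def)

lemma ball_Q: "(\<forall>x\<in>carrier Q. R x) \<longleftrightarrow> (\<forall>m\<in>carrier M. R (\<pi> m))"
  by (auto simp flip: pi_surj)

lemma abelian_AI: "abelian_mult_lie_algebra AI"
proof -
  have "mult_lie_algebra AI"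
    by (intro mult_lie_algebra_subalgebra A.mult_lie_algebra_axioms subgroup_invariants)
       (simp add: A.bracket_trivial)
  then show ?thesis
    by (intro abelian_mult_lie_algebra.intro abelian_mult_lie_algebra_axioms.intro comm_group_subgroup
        A.comm_group_axioms subgroup_invariants) (simp_all add: A.bracket_trivial)
qed

lemma action_terms_induced: "action_terms Q AI \<chi>'"
  unfolding action_terms_def ball_Q
proof (intro conjI ballI)
  fix m assume m: "m \<in> carrier M"
  have "inj_on (sigma \<chi>' (\<pi> m)) (invariants I A \<chi>)"
    using m by (intro inj_on_inverseI[where g = "\<sigma> (inv\<^bsub>M\<^esub> m)"]) simp
  moreover have "a \<in> sigma \<chi>' (\<pi> m) ` invariants I A \<chi>" if "a \<in> invariants I A \<chi>" for a
    using m that by (intro image_eqI[of _ _ "\<sigma> (inv\<^bsub>M\<^esub> m) a"]) simp_all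
  ultimately show "bij_betw (sigma \<chi>' (\<pi> m)) (carrier AI) (carrier AI)"
    using m by (auto simp: bij_betw_def)
  show "sigma \<chi>' (\<pi> m) \<in> mlie_hom AI AI"
    using m by (auto simp: mlie_hom_def hom_def sigma_mult A.bracket_trivial)
qed simp_all


section \<open>Inflation of cocycles\<close>

text \<open>Pairs with invariant coefficients form a subalgebra of the inflated extension, and \<open>\<pi>\<close> maps it
  onto the extension of \<open>Q\<close>.\<close>

lemma cocycle_algebra_descend:
  assumes S: "S \<in> carrier Q \<times> carrier Q \<rightarrow> invariants I A \<chi>" "Sf \<in> carrier Q \<times> carrier Q \<rightarrow> invariants I A \<chi>"
    and eq: "\<And>x y. \<lbrakk>x \<in> carrier M; y \<in> carrier M\<rbrakk> \<Longrightarrow> T (x, y) = S (\<pi> x, \<pi> y)"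
      "\<And>x y. \<lbrakk>x \<in> carrier M; y \<in> carrier M\<rbrakk> \<Longrightarrow> Tf (x, y) = Sf (\<pi> x, \<pi> y)"
    and alg: "mult_lie_algebra (cocycle_algebra M A \<chi> T Tf)"
  shows "mult_lie_algebra (cocycle_algebra Q AI \<chi>' S Sf)"
proof -
  interpret T: mult_lie_algebra "cocycle_algebra M A \<chi> T Tf" by (rule alg)
  let ?H = "invariants I A \<chi> \<times> carrier M"
  have Sv [simp]: "S (x, y) \<in> invariants I A \<chi>" "Sf (x, y) \<in> invariants I A \<chi>"
    if "x \<in> carrier Q" "y \<in> carrier Q" for x y
    using S that by (auto simp: Pi_iff)
  have H: "subgroup ?H (cocycle_algebra M A \<chi> T Tf)"
  proof (rule T.subgroupI)
    fix p assume "p \<in> ?H"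
    then obtain a x where p: "p = (a, x)" "a \<in> invariants I A \<chi>" "x \<in> carrier M" by auto
    have "inv\<^bsub>cocycle_algebra M A \<chi> T Tf\<^esub> p
        = (inv (\<sigma> (inv\<^bsub>M\<^esub> x) a \<otimes> T (inv\<^bsub>M\<^esub> x, x)), inv\<^bsub>M\<^esub> x)"
      using p by (intro T.inv_equality) (simp_all add: eq A.m_assoc)
    then show "inv\<^bsub>cocycle_algebra M A \<chi> T Tf\<^esub> p \<in> ?H"
      using p by (simp add: eq)
  next
    show "?H \<noteq> {}" using invariants_closed(3) by blast
  qed (auto simp: eq)
  let ?E = "(cocycle_algebra M A \<chi> T Tf)\<lparr>carrier := ?H\<rparr>"
  show ?thesis
  proof (rule mult_lie_algebra_surj_image[of ?E "\<lambda>(a, x). (a, \<pi> x)"])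
    show "mult_lie_algebra ?E"
      by (intro mult_lie_algebra_subalgebra alg H) (auto simp: eq)
    have "(a, q) \<in> (\<lambda>(a, x). (a, \<pi> x)) ` ?H" if "a \<in> invariants I A \<chi>" "q \<in> carrier Q" for a q
      using that by (intro rev_image_eqI[of "(a, l q)"]) simp_all
    then show "(\<lambda>(a, x). (a, \<pi> x)) ` carrier ?E = carrier (cocycle_algebra Q AI \<chi>' S Sf)"
      by auto
  qed (auto simp: eq)
qed

sublocale Q: action_module Q AI \<chi>'
proof (rule action_module.intro)
  show "mult_lie_algebra (semidirect Q AI \<chi>')"
    using split by (intro cocycle_algebra_descend[where T = "\<lambda>_. \<one>" and Tf = "\<lambda>_. \<one>"]) simp_all
qed (rule Q.mult_lie_algebra_axioms abelian_AI action_terms_induced)+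


lemma inflate_cocycle_closed:
  assumes c: "c \<in> cocycles Q AI \<chi>'"
  shows "inflate_cocycle M \<pi> c \<in> cocycles M A \<chi>"
proof -
  obtain S Sf where S: "c = (S, Sf)" by (cases c)
  have n: "normalized_pair Q AI S Sf" and alg: "mult_lie_algebra (cocycle_algebra Q AI \<chi>' S Sf)"
    using c by (simp_all add: S cocycles_iff)
  have Sv [simp]: "S (x, y) \<in> invariants I A \<chi>" "Sf (x, y) \<in> invariants I A \<chi>"
    if "x \<in> carrier Q" "y \<in> carrier Q" for x y
    using n that by (auto simp: normalized_pair_def PiE_iff)
  let ?T = "\<lambda>(x, y)\<in>carrier M \<times> carrier M. S (\<pi> x, \<pi> y)"
    and ?Tf = "\<lambda>(x, y)\<in>carrier M \<times> carrier M. Sf (\<pi> x, \<pi> y)"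
  let ?F = "fibre_product (cocycle_algebra Q AI \<chi>' S Sf) M snd \<pi>"
  let ?f = "\<lambda>((a, q), m). (a, m)"
  \<comment> \<open>pull the extension back along \<open>\<pi>\<close>, then enlarge the coefficients to \<open>A\<close>\<close>
  have pullback: "mult_lie_algebra (cocycle_algebra M AI \<chi> ?T ?Tf)"
  proof (rule mult_lie_algebra_surj_image[of ?F ?f])
    show "mult_lie_algebra ?F"
      by (intro mult_lie_algebra_fibre_product[OF alg M.mult_lie_algebra_axioms Q.mult_lie_algebra_axioms]
          snd_mlie_hom_cocycle_algebra pi_hom)
    have "(a, m) \<in> ?f ` carrier ?F" if "a \<in> invariants I A \<chi>" "m \<in> carrier M" for a m
      using that by (intro rev_image_eqI[of "((a, \<pi> m), m)"]) (simp_all add: fibre_product_def)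
    then show "?f ` carrier ?F = carrier (cocycle_algebra M AI \<chi> ?T ?Tf)"
      by (auto simp: fibre_product_def)
  qed (auto simp: fibre_product_def)
  have "mult_lie_algebra (cocycle_algebra M A \<chi> ?T ?Tf)"
    by (rule cocycle_algebra_mult[OF subgroup_invariants _ _ _ _ pullback split]) auto
  moreover have "normalized_pair M A ?T ?Tf"
    using n by (auto simp: normalized_pair_def)
  ultimately show ?thesis by (simp add: S inflate_cocycle_def cocycles_iff)
qed

lemma descend_cocycle:
  assumes S: "S \<in> carrier Q \<times> carrier Q \<rightarrow>\<^sub>E invariants I A \<chi>" "Sf \<in> carrier Q \<times> carrier Q \<rightarrow>\<^sub>E invariants I A \<chi>"
    and c: "inflate_cocycle M \<pi> (S, Sf) \<in> cocycles M A \<chi>"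
  shows "(S, Sf) \<in> cocycles Q AI \<chi>'"
proof -
  let ?T = "\<lambda>(x, y)\<in>carrier M \<times> carrier M. S (\<pi> x, \<pi> y)"
    and ?Tf = "\<lambda>(x, y)\<in>carrier M \<times> carrier M. Sf (\<pi> x, \<pi> y)"
  have n: "normalized_pair M A ?T ?Tf" and alg: "mult_lie_algebra (cocycle_algebra M A \<chi> ?T ?Tf)"
    using c by (simp_all add: inflate_cocycle_def cocycles_iff)
  have "S (\<pi> x, \<one>\<^bsub>Q\<^esub>) = \<one> \<and> S (\<one>\<^bsub>Q\<^esub>, \<pi> x) = \<one> \<and> Sf (\<pi> x, \<pi> x) = \<one> \<and> Sf (\<pi> x, \<one>\<^bsub>Q\<^esub>) = \<one> \<and> Sf (\<one>\<^bsub>Q\<^esub>, \<pi> x) = \<one>"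
    if "x \<in> carrier M" for x
    using that bspec[OF conjunct2[OF conjunct2[OF n[unfolded normalized_pair_def]]] that] by simp
  then have "normalized_pair Q AI S Sf"
    using S by (simp add: normalized_pair_def ball_Q)
  moreover have "mult_lie_algebra (cocycle_algebra Q AI \<chi>' S Sf)"
    by (rule cocycle_algebra_descend[OF _ _ _ _ alg]) (use S in \<open>auto simp: PiE_iff\<close>)
  ultimately show ?thesis by (simp add: cocycles_iff)
qed

lemma inflate_coboundary:
  assumes g: "g \<in> carrier Q \<rightarrow> invariants I A \<chi>"
  shows "inflate_cocycle M \<pi> (coboundary Q AI \<chi>' g) = coboundary M A \<chi> (\<lambda>m. g (\<pi> m))"
proof -
  have [simp]: "g q \<in> invariants I A \<chi>" if "q \<in> carrier Q" for q using g that by blast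
  show ?thesis
    by (auto simp: inflate_cocycle_def coboundary_def intro!: restrict_ext simp flip: pi.hom_mult pi_bracket)
qed

lemma inflate_cocycle_hom:
  "inflate_cocycle M \<pi> \<in> hom (cocycle_group Q AI \<chi>') (cocycle_group M A \<chi>)"
proof (rule homI)
  fix c assume "c \<in> carrier (cocycle_group Q AI \<chi>')"
  then show "inflate_cocycle M \<pi> c \<in> carrier (cocycle_group M A \<chi>)" by (simp add: inflate_cocycle_closed)
next
  fix c d
  show "inflate_cocycle M \<pi> (c \<otimes>\<^bsub>cocycle_group Q AI \<chi>'\<^esub> d)
      = inflate_cocycle M \<pi> c \<otimes>\<^bsub>cocycle_group M A \<chi>\<^esub> inflate_cocycle M \<pi> d"
    by (cases c; cases d) (auto simp: inflate_cocycle_def intro!: restrict_ext)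
qed

lemma inflate_cocycle_inj:
  assumes c: "c \<in> cocycles Q AI \<chi>'" and d: "d \<in> cocycles Q AI \<chi>'"
    and eq: "inflate_cocycle M \<pi> c = inflate_cocycle M \<pi> d"
  shows "c = d"
proof -
  obtain S Sf T Tf where S: "c = (S, Sf)" "d = (T, Tf)" by (cases c; cases d)
  have ext: "S \<in> extensional (carrier Q \<times> carrier Q)" "Sf \<in> extensional (carrier Q \<times> carrier Q)"
      "T \<in> extensional (carrier Q \<times> carrier Q)" "Tf \<in> extensional (carrier Q \<times> carrier Q)"
    using c d by (simp_all add: S cocycles_iff normalized_pair_def PiE_def)
  have "S (\<pi> x, \<pi> y) = T (\<pi> x, \<pi> y) \<and> Sf (\<pi> x, \<pi> y) = Tf (\<pi> x, \<pi> y)"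
    if "x \<in> carrier M" "y \<in> carrier M" for x y
    using eq that by (auto simp: S inflate_cocycle_def dest: fun_cong[of _ _ "(x, y)"])
  then have "\<forall>x\<in>carrier Q. \<forall>y\<in>carrier Q. S (x, y) = T (x, y) \<and> Sf (x, y) = Tf (x, y)"
    unfolding ball_Q by blast
  then show ?thesis
    using extensionalityI[OF ext(1,3)] extensionalityI[OF ext(2,4)] by (auto simp: S)
qed


section \<open>Inflation and restriction of derivations\<close>

lemma inflate_derivation_closed:
  assumes d: "d \<in> derivations Q AI \<chi>'"
  shows "inflate_derivation M \<pi> d \<in> derivations M A \<chi>"
proof -
  have [simp]: "d q \<in> invariants I A \<chi>" if "q \<in> carrier Q" for q
    using Q.derivationD(1)[OF d that] by simp
  show ?thesis
    by (simp add: derivations_def inflate_derivation_def Q.derivationD(2,3)[OF d])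
qed

lemma inflate_derivation_hom:
  "inflate_derivation M \<pi> \<in> hom (derivation_group Q AI \<chi>') (derivation_group M A \<chi>)"
  by (rule homI) (auto simp: inflate_derivation_closed, auto simp: inflate_derivation_def)

lemma inflate_principal:
  assumes "d \<in> principal_derivations Q AI \<chi>'"
  shows "inflate_derivation M \<pi> d \<in> principal_derivations M A \<chi>"
proof -
  obtain a where a: "a \<in> invariants I A \<chi>" "d = (\<lambda>x\<in>carrier Q. a \<otimes> inv\<^bsub>AI\<^esub> (sigma \<chi>' x a))"
    using assms by (auto simp: principal_derivations_def)
  then have "inflate_derivation M \<pi> d = (\<lambda>x\<in>carrier M. a \<otimes> inv (\<sigma> x a))"
    by (auto simp: inflate_derivation_def intro!: restrict_ext)
  then show ?thesis using a(1) invariants_carrier by (auto simp: principal_derivations_def)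
qed

text \<open>A cochain that is equivariant under left and constant under right translation by \<open>I\<close> has
  values fixed by \<open>I\<close>, because \<open>n m = m (m\<inverse> n m)\<close>; so it is constant on the fibres of \<open>\<pi>\<close>.\<close>

lemma cochain_descends:
  assumes closed: "\<And>m. m \<in> carrier M \<Longrightarrow> k m \<in> carrier A"
    and left: "\<And>n m. \<lbrakk>n \<in> I; m \<in> carrier M\<rbrakk> \<Longrightarrow> k (n \<cdot> m) = \<sigma> n (k m)"
    and right: "\<And>n m. \<lbrakk>n \<in> I; m \<in> carrier M\<rbrakk> \<Longrightarrow> k (m \<cdot> n) = k m"
    and m: "m \<in> carrier M"
  shows "k m \<in> invariants I A \<chi>" "k (l (\<pi> m)) = k m"
proof -
  have inv_val: "k x \<in> invariants I A \<chi>" if x: "x \<in> carrier M" for x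
  proof -
    have "\<sigma> n (k x) = k x" if n: "n \<in> I" for n
    proof -
      have "\<sigma> n (k x) = k (x \<cdot> (inv\<^bsub>M\<^esub> x \<cdot> n \<cdot> x))"
        using x n by (simp add: left[symmetric] M.m_assoc)
      also have "\<dots> = k x" by (rule right[OF I_conj(2)[OF x n] x])
      finally show ?thesis .
    qed
    then show ?thesis using closed[OF x] by (intro invariants_iff[THEN iffD2]) simp
  qed
  show "k m \<in> invariants I A \<chi>" by (rule inv_val[OF m])
  obtain n where n: "n \<in> I" "m = n \<cdot> l (\<pi> m)"
    using same_fibre[of m "l (\<pi> m)"] m by auto
  then have "k m = \<sigma> n (k (l (\<pi> m)))" using left[OF n(1), of "l (\<pi> m)"] m by simp
  also have "\<dots> = k (l (\<pi> m))" using n(1) m inv_val by simp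
  finally show "k (l (\<pi> m)) = k m" by simp
qed

lemma derivation_descends:
  assumes d: "d \<in> derivations M A \<chi>" and dI: "\<And>n. n \<in> I \<Longrightarrow> d n = \<one>"
  shows "\<exists>e\<in>derivations Q AI \<chi>'. d = inflate_derivation M \<pi> e"
proof
  note dv [simp] = derivationD(1)[OF d]
  let ?e = "\<lambda>q\<in>carrier Q. d (l q)"
  have left: "d (n \<cdot> m) = \<sigma> n (d m)" and right: "d (m \<cdot> n) = d m"
    if "n \<in> I" "m \<in> carrier M" for n m
    using that by (simp_all add: derivationD(2)[OF d] dI)
  note inv_val = cochain_descends(1)[of d, OF dv left right]
    and fibre = cochain_descends(2)[of d, OF dv left right]
  show "d = inflate_derivation M \<pi> ?e"
    using derivationD(4)[OF d]
    by (intro extensionalityI[of d "carrier M"]) (auto simp: inflate_derivation_def fibre)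
  have e: "?e (\<pi> m) = d m" if "m \<in> carrier M" for m using that by (simp add: fibre)
  have eD: "?e (\<pi> x \<otimes>\<^bsub>Q\<^esub> \<pi> y) = ?e (\<pi> x) \<otimes> sigma \<chi>' (\<pi> x) (?e (\<pi> y)) \<and>
      ?e \<lbrace>\<pi> x, \<pi> y\<rbrace>\<^bsub>Q\<^esub> = bracket_part Q AI \<chi>' (\<pi> x) (\<pi> y) (?e (\<pi> x)) (?e (\<pi> y))"
    if x: "x \<in> carrier M" and y: "y \<in> carrier M" for x y
  proof -
    have "?e (\<pi> x \<otimes>\<^bsub>Q\<^esub> \<pi> y) = d (x \<cdot> y)" "?e \<lbrace>\<pi> x, \<pi> y\<rbrace>\<^bsub>Q\<^esub> = d \<lbrace>x, y\<rbrace>\<^bsub>M\<^esub>"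
      using e[of "x \<cdot> y"] e[of "\<lbrace>x, y\<rbrace>\<^bsub>M\<^esub>"] x y by simp_all
    then show ?thesis
      using x y inv_val by (simp only: e) (simp add: derivationD(2,3)[OF d])
  qed
  have "?e \<in> carrier Q \<rightarrow>\<^sub>E invariants I A \<chi>" using inv_val by auto
  then show "?e \<in> derivations Q AI \<chi>'"
    unfolding derivations_def ball_Q using eD by simp
qed

lemma restrict_derivation_closed: "d \<in> derivations M A \<chi> \<Longrightarrow> restrict d I \<in> derivations MI A \<chi>"
  by (simp add: derivations_def PiE_iff)

lemma restrict_derivation_hom:
  "(\<lambda>d. restrict d I) \<in> hom (derivation_group M A \<chi>) (derivation_group MI A \<chi>)"
  by (rule homI) (auto simp: restrict_derivation_closed intro!: restrict_ext)

lemma restrict_principal: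
  "(\<lambda>d. restrict d I) ` principal_derivations M A \<chi> = principal_derivations MI A \<chi>"
proof -
  have eq: "restrict (\<lambda>x\<in>carrier M. a \<otimes> inv (\<sigma> x a)) I = (\<lambda>x\<in>I. a \<otimes> inv (\<sigma> x a))" for a
    by (auto intro!: restrict_ext)
  have "principal_derivations N A \<chi> = (\<lambda>a. \<lambda>x\<in>carrier N. a \<otimes> inv (\<sigma> x a)) ` carrier A" for N
    unfolding principal_derivations_def by blast
  then show ?thesis using eq by (simp add: image_image del: restrict_restrict)
qed


section \<open>Relative cochains\<close>

text \<open>The coboundary of \<open>h\<close> vanishes as soon as one argument lies in \<open>I\<close>. The condition for \<open>{n,m}\<close> is
  left out because it follows by antisymmetry of the bracket.\<close>

definition relative_cochain :: "('m \<Rightarrow> 'a) \<Rightarrow> bool" where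
  "relative_cochain h \<longleftrightarrow> h \<in> carrier M \<rightarrow> carrier A \<and>
     (\<forall>m\<in>carrier M. \<forall>n\<in>I. h (n \<cdot> m) = h n \<otimes> \<sigma> n (h m) \<and> h (m \<cdot> n) = h m \<otimes> \<sigma> m (h n) \<and>
        h \<lbrace>m, n\<rbrace>\<^bsub>M\<^esub> = bp m n (h m) (h n))"

lemma relative_cochainD:
  assumes "relative_cochain h"
  shows "m \<in> carrier M \<Longrightarrow> h m \<in> carrier A"
    and "\<lbrakk>m \<in> carrier M; n \<in> I\<rbrakk> \<Longrightarrow> h (n \<cdot> m) = h n \<otimes> \<sigma> n (h m)"
    and "\<lbrakk>m \<in> carrier M; n \<in> I\<rbrakk> \<Longrightarrow> h (m \<cdot> n) = h m \<otimes> \<sigma> m (h n)"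
    and "\<lbrakk>m \<in> carrier M; n \<in> I\<rbrakk> \<Longrightarrow> h \<lbrace>m, n\<rbrace>\<^bsub>M\<^esub> = bp m n (h m) (h n)"
  using assms by (auto simp: relative_cochain_def)

lemma relative_cochain_one:
  assumes h: "relative_cochain h"
  shows "h \<one>\<^bsub>M\<^esub> = \<one>"
  using relative_cochainD(2)[OF h, of "\<one>\<^bsub>M\<^esub>" "\<one>\<^bsub>M\<^esub>"] relative_cochainD(1)[OF h, of "\<one>\<^bsub>M\<^esub>"] by simp

lemma derivation_relative: "d \<in> derivations M A \<chi> \<Longrightarrow> relative_cochain d"
  by (simp add: relative_cochain_def derivationD Pi_iff)


text \<open>In this form the square condition says that \<open>(\<eta> m, m)\<close> idealizes the subalgebra
  \<open>{(d n, n) | n \<in> I}\<close> of the split extension.\<close>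

lemma square_witness_iff:
  assumes d: "d \<in> I \<rightarrow> carrier A"
  shows "square_witness M I A \<chi> d \<eta> \<longleftrightarrow> \<eta> \<in> carrier M \<rightarrow> carrier A \<and> \<eta> \<one>\<^bsub>M\<^esub> = \<one> \<and>
     (\<forall>m\<in>carrier M. \<forall>n\<in>I. \<eta> m \<otimes> \<sigma> m (d (inv\<^bsub>M\<^esub> m \<cdot> n \<cdot> m)) = d n \<otimes> \<sigma> n (\<eta> m) \<and>
        d \<lbrace>m, n\<rbrace>\<^bsub>M\<^esub> = bp m n (\<eta> m) (d n))"
proof -
  have dv [simp]: "d n \<in> carrier A" if "n \<in> I" for n using d that by blast
  have *: "\<sigma> m (d (inv\<^bsub>M\<^esub> m \<cdot> n \<cdot> m)) \<otimes> inv (d n) = \<sigma> n (\<eta> m) \<otimes> inv (\<eta> m) \<longleftrightarrow>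
        \<eta> m \<otimes> \<sigma> m (d (inv\<^bsub>M\<^esub> m \<cdot> n \<cdot> m)) = d n \<otimes> \<sigma> n (\<eta> m)"
    "d \<lbrace>m, n\<rbrace>\<^bsub>M\<^esub> \<otimes> inv (\<tau> m (d n)) \<otimes> \<sigma> \<lbrace>m, n\<rbrace>\<^bsub>M\<^esub> (d n) \<otimes> inv (d n)
          = \<eta> m \<otimes> \<sigma> \<lbrace>m, n\<rbrace>\<^bsub>M\<^esub> (\<nu> (\<eta> m) n \<otimes> inv (\<eta> m)) \<longleftrightarrow> d \<lbrace>m, n\<rbrace>\<^bsub>M\<^esub> = bp m n (\<eta> m) (d n)"
    if "\<eta> \<in> carrier M \<rightarrow> carrier A" and m: "m \<in> carrier M" and n: "n \<in> I" for m n
  proof -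
    have [simp]: "\<eta> m \<in> carrier A" using that by blast
    show "\<sigma> m (d (inv\<^bsub>M\<^esub> m \<cdot> n \<cdot> m)) \<otimes> inv (d n) = \<sigma> n (\<eta> m) \<otimes> inv (\<eta> m) \<longleftrightarrow>
        \<eta> m \<otimes> \<sigma> m (d (inv\<^bsub>M\<^esub> m \<cdot> n \<cdot> m)) = d n \<otimes> \<sigma> n (\<eta> m)"
      using m n by (intro A.mult_eq_iff_swap) simp_all
    show "d \<lbrace>m, n\<rbrace>\<^bsub>M\<^esub> \<otimes> inv (\<tau> m (d n)) \<otimes> \<sigma> \<lbrace>m, n\<rbrace>\<^bsub>M\<^esub> (d n) \<otimes> inv (d n)
          = \<eta> m \<otimes> \<sigma> \<lbrace>m, n\<rbrace>\<^bsub>M\<^esub> (\<nu> (\<eta> m) n \<otimes> inv (\<eta> m)) \<longleftrightarrow> d \<lbrace>m, n\<rbrace>\<^bsub>M\<^esub> = bp m n (\<eta> m) (d n)"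
      using m n by (subst A.mult_eq_iff_move) (simp_all add: bracket_part_def sigma_mult sigma_inv)
  qed
  show ?thesis
    unfolding square_witness_def by (intro conj_cong ball_cong refl) (simp_all only: *)
qed

lemma relative_cochain_square:
  assumes h: "relative_cochain h"
  shows "restrict h I \<in> square_derivations M I A \<chi>" "square_witness M I A \<chi> (restrict h I) h"
proof -
  note hD = relative_cochainD[OF h]
  show w: "square_witness M I A \<chi> (restrict h I) h"
  proof (subst square_witness_iff, use hD(1) in simp, intro conjI ballI)
    show "h \<in> carrier M \<rightarrow> carrier A" using hD(1) by blast
    show "h \<one>\<^bsub>M\<^esub> = \<one>" by (rule relative_cochain_one[OF h])
    fix m n assume m: "m \<in> carrier M" and n: "n \<in> I"
    have "h m \<otimes> \<sigma> m (h (inv\<^bsub>M\<^esub> m \<cdot> n \<cdot> m)) = h (m \<cdot> (inv\<^bsub>M\<^esub> m \<cdot> n \<cdot> m))"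
      using m n by (intro hD(3)[symmetric] I_conj)
    also have "m \<cdot> (inv\<^bsub>M\<^esub> m \<cdot> n \<cdot> m) = n \<cdot> m" using m n by (simp add: M.m_assoc)
    finally have "h m \<otimes> \<sigma> m (h (inv\<^bsub>M\<^esub> m \<cdot> n \<cdot> m)) = h (n \<cdot> m)" .
    then show "h m \<otimes> \<sigma> m (restrict h I (inv\<^bsub>M\<^esub> m \<cdot> n \<cdot> m)) = restrict h I n \<otimes> \<sigma> n (h m)"
      using m n by (simp add: hD(2))
    show "restrict h I \<lbrace>m, n\<rbrace>\<^bsub>M\<^esub> = bp m n (h m) (restrict h I n)"
      using m n by (simp add: hD(4))
  qed
  have "restrict h I \<in> derivations MI A \<chi>"
    by (auto simp: derivations_def intro!: hD(1,2,4))
  then show "restrict h I \<in> square_derivations M I A \<chi>"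
    using w by (auto simp: square_derivations_def)
qed


abbreviation cob1 where "cob1 h x y \<equiv> h x \<otimes> \<sigma> x (h y) \<otimes> inv (h (x \<cdot> y))"
abbreviation cob2 where "cob2 h x y \<equiv> bp x y (h x) (h y) \<otimes> inv (h \<lbrace>x, y\<rbrace>\<^bsub>M\<^esub>)"

abbreviation E where "E \<equiv> semidirect M A \<chi>"
abbreviation E_mult (infixl \<open>\<bullet>\<close> 70) where "x \<bullet> y \<equiv> x \<otimes>\<^bsub>E\<^esub> y"

text \<open>For a relative cochain \<open>h\<close>, the section \<open>s m = (h m, m)\<close> is compatible with all operations
  that involve an element of \<open>I\<close>. Hence every \<open>s m\<close> idealizes the subalgebra \<open>s(I)\<close>, and so do the
  defects of \<open>s\<close>, which are the values of the coboundary of \<open>h\<close>; but the elements of \<open>A\<close> idealizing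
  \<open>s(I)\<close> are invariant.\<close>

lemma relative_coboundary_invariant:
  assumes h: "relative_cochain h" and m: "m \<in> carrier M" "m' \<in> carrier M"
  shows "cob1 h m m' \<in> invariants I A \<chi>" "cob2 h m m' \<in> invariants I A \<chi>"
proof -
  note hD = relative_cochainD[OF h]
  note [simp] = hD(1)
  define s where "s m = (h m, m)" for m
  have s_closed [simp]: "s m \<in> carrier E" if "m \<in> carrier M" for m using that by (simp add: s_def)
  note [simp del] = carrier_cocycle_algebra one_cocycle_algebra
  have s_left: "s n \<bullet> s m = s (n \<cdot> m)" and s_right: "s m \<bullet> s n = s (m \<cdot> n)"
    and s_bracket: "\<lbrace>s m, s n\<rbrace>\<^bsub>E\<^esub> = s \<lbrace>m, n\<rbrace>\<^bsub>M\<^esub>"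
    if "m \<in> carrier M" "n \<in> I" for m n
    using that by (simp_all add: s_def hD(2,3,4))
  let ?D = "s ` I"
  have s_one: "s \<one>\<^bsub>M\<^esub> = \<one>\<^bsub>E\<^esub>" by (simp add: s_def relative_cochain_one[OF h] one_cocycle_algebra)
  have D: "subgroup ?D E"
  proof (rule E.subgroupI)
    show "?D \<noteq> {}" using I_one by blast
    fix x assume "x \<in> ?D"
    then obtain n where n: "n \<in> I" "x = s n" by blast
    have "s (inv\<^bsub>M\<^esub> n) \<bullet> s n = \<one>\<^bsub>E\<^esub>"
      using n(1) s_one by (subst s_left) simp_all
    then have "inv\<^bsub>E\<^esub> x = s (inv\<^bsub>M\<^esub> n)"
      unfolding n(2) using n(1) by (intro E.inv_equality s_closed) simp_all
    then show "inv\<^bsub>E\<^esub> x \<in> ?D" using n(1) by simp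
  next
    show "x \<bullet> y \<in> ?D" if "x \<in> ?D" "y \<in> ?D" for x y
      using that s_left I_mult I_carrier by fast
  qed (use s_closed I_carrier in blast)
  have D_bracket: "\<lbrace>x, y\<rbrace>\<^bsub>E\<^esub> \<in> ?D" if "x \<in> ?D" "y \<in> ?D" for x y
    using that s_bracket I_bracket(1) I_carrier by fast
  have sN: "s k \<in> idealizer E ?D" if k: "k \<in> carrier M" for k
    unfolding idealizer_def
  proof (intro CollectI conjI ballI)
    show "s k \<in> carrier E" using k by simp
    fix y assume "y \<in> ?D"
    then obtain n where n: "n \<in> I" "y = s n" by blast
    have "s k \<bullet> s n = s (k \<cdot> n \<cdot> inv\<^bsub>M\<^esub> k \<cdot> k)"
      using k n(1) by (simp add: s_right M.m_assoc)
    also have "\<dots> = s (k \<cdot> n \<cdot> inv\<^bsub>M\<^esub> k) \<bullet> s k"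
      using k n(1) by (intro s_left[symmetric] I_conj)
    finally have "conj_by E y (s k) = s (k \<cdot> n \<cdot> inv\<^bsub>M\<^esub> k)"
      unfolding conj_by_def n(2) using k n(1) by (simp add: E.m_assoc)
    then show "conj_by E y (s k) \<in> ?D" using I_conj(1)[OF k n(1)] by simp
    have "s k \<bullet> s (inv\<^bsub>M\<^esub> k \<cdot> n \<cdot> k) = s (k \<cdot> (inv\<^bsub>M\<^esub> k \<cdot> n \<cdot> k))"
      using k n(1) by (intro s_right I_conj)
    also have "\<dots> = s n \<bullet> s k" using k n(1) by (simp add: s_left M.m_assoc)
    finally have "s n \<bullet> s k = s k \<bullet> s (inv\<^bsub>M\<^esub> k \<cdot> n \<cdot> k)" by simp
    then have "conj_by E y (inv\<^bsub>E\<^esub> (s k)) = s (inv\<^bsub>M\<^esub> k \<cdot> n \<cdot> k)"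
      unfolding conj_by_def n(2) using k n(1)
      by (simp add: E.m_assoc)
    then show "conj_by E y (inv\<^bsub>E\<^esub> (s k)) \<in> ?D" using I_conj(2)[OF k n(1)] by simp
    show "\<lbrace>s k, y\<rbrace>\<^bsub>E\<^esub> \<in> ?D" using s_bracket[OF k n(1)] k n by simp
  qed
  interpret N: subgroup "idealizer E ?D" E by (rule E.idealizer_subgroup[OF D])
  have invariant: "a \<in> invariants I A \<chi>"
    if aN: "(a, \<one>\<^bsub>M\<^esub>) \<in> idealizer E ?D" for a
  proof -
    have a: "a \<in> carrier A" using aN by (simp add: idealizer_def carrier_cocycle_algebra)
    have "\<sigma> n a = a" if n: "n \<in> I" for n
    proof -
      have "conj_by E (s n) (a, \<one>\<^bsub>M\<^esub>) \<in> ?D"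
        using aN n unfolding idealizer_def by blast
      then have "(a \<otimes> h n \<otimes> inv (\<sigma> n a), n) \<in> ?D"
        using a n by (simp add: s_def semidirect_conj)
      then have "a \<otimes> h n \<otimes> inv (\<sigma> n a) = h n" by (auto simp: s_def)
      then have "a \<otimes> h n = h n \<otimes> \<sigma> n a"
        using a n by (intro A.inv_solve_right'[THEN iffD1]) simp_all
      then show ?thesis using a n by (simp add: A.m_comm[of a])
    qed
    then show ?thesis using a by (intro invariants_iff[THEN iffD2]) simp
  qed
  have defect1: "s m \<bullet> s m' \<bullet> inv\<^bsub>E\<^esub> (s (m \<cdot> m')) = (cob1 h m m', \<one>\<^bsub>M\<^esub>)"
    using m by (intro E.inv_solve_right'[THEN iffD2]) (simp_all add: s_def A.m_assoc carrier_cocycle_algebra)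
  have "s m \<bullet> s m' \<bullet> inv\<^bsub>E\<^esub> (s (m \<cdot> m')) \<in> idealizer E ?D"
    using m by (intro N.m_closed N.m_inv_closed sN) simp_all
  then show "cob1 h m m' \<in> invariants I A \<chi>" unfolding defect1 by (rule invariant)
  have defect2: "\<lbrace>s m, s m'\<rbrace>\<^bsub>E\<^esub> \<bullet> inv\<^bsub>E\<^esub> (s \<lbrace>m, m'\<rbrace>\<^bsub>M\<^esub>) = (cob2 h m m', \<one>\<^bsub>M\<^esub>)"
    using m by (intro E.inv_solve_right'[THEN iffD2]) (simp_all add: s_def A.m_assoc carrier_cocycle_algebra)
  have "\<lbrace>s m, s m'\<rbrace>\<^bsub>E\<^esub> \<bullet> inv\<^bsub>E\<^esub> (s \<lbrace>m, m'\<rbrace>\<^bsub>M\<^esub>) \<in> idealizer E ?D"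
    using m by (intro N.m_closed N.m_inv_closed sN E.idealizer_bracket_closed[OF D D_bracket]) simp_all
  then show "cob2 h m m' \<in> invariants I A \<chi>" unfolding defect2 by (rule invariant)
qed

lemma relative_cochain_bracket_left:
  assumes h: "relative_cochain h" and m: "m \<in> carrier M" and n: "n \<in> I"
  shows "h \<lbrace>n, m\<rbrace>\<^bsub>M\<^esub> = bp n m (h n) (h m)"
proof -
  note hD = relative_cochainD[OF h]
  let ?k = "\<lbrace>m, n\<rbrace>\<^bsub>M\<^esub>"
  have k: "?k \<in> I" using m n by simp
  have "h (inv\<^bsub>M\<^esub> ?k) \<otimes> \<sigma> (inv\<^bsub>M\<^esub> ?k) (h ?k) = \<one>"
    using hD(2)[of ?k "inv\<^bsub>M\<^esub> ?k"] k relative_cochain_one[OF h] by (simp flip: hD(2))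
  then have "h (inv\<^bsub>M\<^esub> ?k) = inv (\<sigma> (inv\<^bsub>M\<^esub> ?k) (h ?k))"
    using k by (intro A.inv_equality[symmetric]) (simp_all add: hD(1))
  moreover have "\<lbrace>(h n, n), (h m, m)\<rbrace>\<^bsub>E\<^esub> = inv\<^bsub>E\<^esub> (h ?k, ?k)"
    using E.bracket_swap[of "(h m, m)" "(h n, n)"] m n by (simp add: hD(1,4))
  ultimately show ?thesis
    using m n k M.bracket_swap[of m n] by (simp add: semidirect_inv hD(1))
qed

text \<open>By invariance, the defects of \<open>s\<close> commute with \<open>s(I)\<close>, so that translating an argument by an
  element of \<open>I\<close> changes both sides of \<open>{s m, s m'} = v s{m,m'}\<close> in the same way.\<close>

lemma relative_coboundary_translate:
  assumes h: "relative_cochain h" and m: "m \<in> carrier M" "m' \<in> carrier M" and n: "n \<in> I"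
  shows "cob1 h (n \<cdot> m) m' = cob1 h m m'" "cob1 h m (n \<cdot> m') = cob1 h m m'"
    and "cob2 h (n \<cdot> m) m' = cob2 h m m'" "cob2 h m (n \<cdot> m') = cob2 h m m'"
proof -
  note hD = relative_cochainD[OF h]
  note [simp] = hD(1)
  have left: "cob1 h (k \<cdot> m) m' = cob1 h m m'" if k: "k \<in> I" for k
  proof -
    have "cob1 h (k \<cdot> m) m' = h k \<otimes> \<sigma> k (h m) \<otimes> \<sigma> k (\<sigma> m (h m')) \<otimes> inv (h k \<otimes> \<sigma> k (h (m \<cdot> m')))"
      using k m by (simp add: hD(2) sigma_comp M.m_assoc)
    also have "\<dots> = \<sigma> k (cob1 h m m')"
      using k m A.mult_cancel_inv[of "h k" "\<sigma> k (h m)" "\<sigma> k (\<sigma> m (h m'))" "\<sigma> k (h (m \<cdot> m'))"]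
      by (simp add: sigma_mult sigma_inv)
    also have "\<dots> = cob1 h m m'"
      using relative_coboundary_invariant(1)[OF h m] k by (rule invariants_act)
    finally show ?thesis .
  qed
  show "cob1 h (n \<cdot> m) m' = cob1 h m m'" using n by (rule left)
  have "cob1 h m (n \<cdot> m') = cob1 h (m \<cdot> n) m'"
    using m n by (simp add: hD(2,3) sigma_mult sigma_comp M.m_assoc A.m_assoc)
  also have "m \<cdot> n = m \<cdot> n \<cdot> inv\<^bsub>M\<^esub> m \<cdot> m"
    using m n by (simp add: M.m_assoc)
  also have "cob1 h (m \<cdot> n \<cdot> inv\<^bsub>M\<^esub> m \<cdot> m) m' = cob1 h m m'"
    using I_conj(1)[OF m(1) n] by (rule left)
  finally show "cob1 h m (n \<cdot> m') = cob1 h m m'" .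

  define s where "s m = (h m, m)" for m
  define c where "c = \<lbrace>m, m'\<rbrace>\<^bsub>M\<^esub>"
  define v where "v = cob2 h m m'"
  have c: "c \<in> carrier M" using m by (simp add: c_def)
  have vI: "v \<in> invariants I A \<chi>" unfolding v_def by (rule relative_coboundary_invariant(2)[OF h m])
  have vE: "(v, \<one>\<^bsub>M\<^esub>) \<in> carrier E" using vI by simp
  have s_closed [simp]: "s k \<in> carrier E" if "k \<in> carrier M" for k using that by (simp add: s_def)
  have s_left: "s k \<bullet> s x = s (k \<cdot> x)" and s_right: "s x \<bullet> s k = s (x \<cdot> k)"
    and s_bracket: "\<lbrace>s x, s k\<rbrace>\<^bsub>E\<^esub> = s \<lbrace>x, k\<rbrace>\<^bsub>M\<^esub>" "\<lbrace>s k, s x\<rbrace>\<^bsub>E\<^esub> = s \<lbrace>k, x\<rbrace>\<^bsub>M\<^esub>"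
    and v_comm: "s k \<bullet> (v, \<one>\<^bsub>M\<^esub>) = (v, \<one>\<^bsub>M\<^esub>) \<bullet> s k"
    if "x \<in> carrier M" "k \<in> I" for x k
    using that vI by (simp_all add: s_def hD(2,3,4) relative_cochain_bracket_left[OF h] A.m_comm)
  have bracket: "\<lbrace>s m, s m'\<rbrace>\<^bsub>E\<^esub> = (v, \<one>\<^bsub>M\<^esub>) \<bullet> s c"
    using m by (simp add: s_def c_def v_def A.m_assoc)
  note E_simps = carrier_cocycle_algebra one_cocycle_algebra mult_cocycle_algebra bracket_cocycle_algebra
  have conj_c: "conj_by E (s c) (s n) = s (conj_by M c n)"
  proof -
    have "s n \<bullet> s c = s (conj_by M c n \<cdot> n)"
      using n c by (simp add: s_left conj_by_def M.m_assoc)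
    also have "\<dots> = s (conj_by M c n) \<bullet> s n" using n c by (simp add: s_right)
    finally show ?thesis
      unfolding conj_by_def[of E] using n c by (intro E.inv_solve_right'[THEN iffD2]) (simp_all del: E_simps)
  qed
  have conj_v: "conj_by E (v, \<one>\<^bsub>M\<^esub>) (s n) = (v, \<one>\<^bsub>M\<^esub>)"
    unfolding conj_by_def using n v_comm[of "\<one>\<^bsub>M\<^esub>" n] vE
    by (intro E.inv_solve_right'[THEN iffD2]) (simp_all del: E_simps)
  have conj: "conj_by E \<lbrace>s m, s m'\<rbrace>\<^bsub>E\<^esub> (s n) = (v, \<one>\<^bsub>M\<^esub>) \<bullet> s (conj_by M c n)"
    unfolding bracket using n c vE by (subst E.conj_by_mult) (simp_all add: conj_c conj_v del: E_simps)
  have cob2_eq: "cob2 h x y = v"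
    if "\<lbrace>s x, s y\<rbrace>\<^bsub>E\<^esub> = (v, \<one>\<^bsub>M\<^esub>) \<bullet> s \<lbrace>x, y\<rbrace>\<^bsub>M\<^esub>" "x \<in> carrier M" "y \<in> carrier M" for x y
    using that vI by (intro A.inv_solve_right'[THEN iffD2]) (simp_all add: s_def)

  have "\<lbrace>s (n \<cdot> m), s m'\<rbrace>\<^bsub>E\<^esub> = \<lbrace>s n \<bullet> s m, s m'\<rbrace>\<^bsub>E\<^esub>"
    using m n by (simp add: s_left)
  also have "\<dots> = (v, \<one>\<^bsub>M\<^esub>) \<bullet> s (conj_by M c n) \<bullet> s \<lbrace>n, m'\<rbrace>\<^bsub>M\<^esub>"
    using m n by (subst E.bracket_mult_left) (simp_all add: conj s_bracket del: E_simps)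
  also have "\<dots> = (v, \<one>\<^bsub>M\<^esub>) \<bullet> s (conj_by M c n \<cdot> \<lbrace>n, m'\<rbrace>\<^bsub>M\<^esub>)"
    using m n c vE by (simp add: E.m_assoc s_right del: E_simps)
  also have "conj_by M c n \<cdot> \<lbrace>n, m'\<rbrace>\<^bsub>M\<^esub> = \<lbrace>n \<cdot> m, m'\<rbrace>\<^bsub>M\<^esub>"
    unfolding c_def using m n by (intro M.bracket_mult_left[symmetric]) simp_all
  finally show "cob2 h (n \<cdot> m) m' = cob2 h m m'"
    unfolding v_def[symmetric] using m n by (intro cob2_eq) simp_all

  have "\<lbrace>s m, s (n \<cdot> m')\<rbrace>\<^bsub>E\<^esub> = \<lbrace>s m, s n \<bullet> s m'\<rbrace>\<^bsub>E\<^esub>"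
    using m n by (simp add: s_left)
  also have "\<dots> = s \<lbrace>m, n\<rbrace>\<^bsub>M\<^esub> \<bullet> ((v, \<one>\<^bsub>M\<^esub>) \<bullet> s (conj_by M c n))"
    using m n by (subst E.bracket_mult_right) (simp_all add: conj s_bracket del: E_simps)
  also have "\<dots> = (v, \<one>\<^bsub>M\<^esub>) \<bullet> s (\<lbrace>m, n\<rbrace>\<^bsub>M\<^esub> \<cdot> conj_by M c n)"
    using m n c vE v_comm[of m "\<lbrace>m, n\<rbrace>\<^bsub>M\<^esub>"]
    by (simp add: s_left[symmetric] E.m_assoc[symmetric] del: E_simps)
  also have "\<lbrace>m, n\<rbrace>\<^bsub>M\<^esub> \<cdot> conj_by M c n = \<lbrace>m, n \<cdot> m'\<rbrace>\<^bsub>M\<^esub>"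
    unfolding c_def using m n by (intro M.bracket_mult_right[symmetric]) simp_all
  finally show "cob2 h m (n \<cdot> m') = cob2 h m m'"
    unfolding v_def[symmetric] using m n by (intro cob2_eq) simp_all
qed

lemma relative_coboundary_fibre:
  assumes h: "relative_cochain h" and m: "m \<in> carrier M" "m' \<in> carrier M"
  shows "cob1 h m m' = cob1 h (l (\<pi> m)) (l (\<pi> m'))" "cob2 h m m' = cob2 h (l (\<pi> m)) (l (\<pi> m'))"
proof -
  obtain n n' where n: "n \<in> I" "m = n \<cdot> l (\<pi> m)" and n': "n' \<in> I" "m' = n' \<cdot> l (\<pi> m')"
    using same_fibre[of m "l (\<pi> m)"] same_fibre[of m' "l (\<pi> m')"] m by auto
  have l: "l (\<pi> m) \<in> carrier M" "l (\<pi> m') \<in> carrier M" using m by simp_all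
  show "cob1 h m m' = cob1 h (l (\<pi> m)) (l (\<pi> m'))" "cob2 h m m' = cob2 h (l (\<pi> m)) (l (\<pi> m'))"
    using relative_coboundary_translate[OF h l(1) m(2) n(1), folded n(2)]
      relative_coboundary_translate[OF h l n'(1), folded n'(2)] by metis+
qed

text \<open>The cocycle on \<open>Q\<close> whose inflation is the coboundary of a relative cochain.\<close>

definition relative_cocycle :: "('m \<Rightarrow> 'a) \<Rightarrow> ('q \<times> 'q \<Rightarrow> 'a) \<times> ('q \<times> 'q \<Rightarrow> 'a)" where
  "relative_cocycle h = (\<lambda>(x, y)\<in>carrier Q \<times> carrier Q. cob1 h (l x) (l y),
                         \<lambda>(x, y)\<in>carrier Q \<times> carrier Q. cob2 h (l x) (l y))"

lemma inflate_relative_cocycle: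
  assumes h: "relative_cochain h"
  shows "inflate_cocycle M \<pi> (relative_cocycle h) = coboundary M A \<chi> h"
  by (auto simp: inflate_cocycle_def relative_cocycle_def coboundary_def
      relative_coboundary_fibre[OF h, symmetric] intro!: restrict_ext)

lemma relative_cocycle_closed:
  assumes h: "relative_cochain h"
  shows "relative_cocycle h \<in> cocycles Q AI \<chi>'"
  unfolding relative_cocycle_def
proof (rule descend_cocycle)
  have "h \<in> carrier M \<rightarrow> carrier A" using h by (simp add: relative_cochain_def)
  then show "inflate_cocycle M \<pi> (\<lambda>(x, y)\<in>carrier Q \<times> carrier Q. cob1 h (l x) (l y),
      \<lambda>(x, y)\<in>carrier Q \<times> carrier Q. cob2 h (l x) (l y)) \<in> cocycles M A \<chi>"
    using coboundary_in_cocycles relative_cochain_one[OF h] inflate_relative_cocycle[OF h]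
    by (simp add: relative_cocycle_def)
qed (auto intro: relative_coboundary_invariant[OF h])


lemma relative_cochain_mult:
  assumes h: "relative_cochain h" and k: "relative_cochain k"
  shows "relative_cochain (\<lambda>m. h m \<otimes> k m)"
  using relative_cochainD[OF h] relative_cochainD[OF k]
  by (simp add: relative_cochain_def sigma_mult bp_mult A.m_ac Pi_iff)

lemma relative_cochain_inv:
  assumes h: "relative_cochain h"
  shows "relative_cochain (\<lambda>m. inv (h m))"
  using relative_cochainD[OF h]
  by (simp add: relative_cochain_def sigma_inv bp_inv A.inv_mult Pi_iff)

lemma relative_cocycle_mult:
  assumes h: "relative_cochain h" and k: "relative_cochain k"
  shows "relative_cocycle (\<lambda>m. h m \<otimes> k m)
       = relative_cocycle h \<otimes>\<^bsub>cocycle_group Q AI \<chi>'\<^esub> relative_cocycle k"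
proof -
  note [simp] = relative_cochainD(1)[OF h] relative_cochainD(1)[OF k]
  show ?thesis
    by (auto simp: relative_cocycle_def sigma_mult bp_mult A.inv_mult A.m_ac intro!: restrict_ext)
qed

lemma relative_cocycle_cong:
  assumes "\<And>m. m \<in> carrier M \<Longrightarrow> h m = k m"
  shows "relative_cocycle h = relative_cocycle k"
  by (auto simp: relative_cocycle_def assms intro!: restrict_ext)

lemma relative_cocycle_derivation:
  assumes d: "d \<in> derivations M A \<chi>"
  shows "relative_cocycle d = \<one>\<^bsub>cocycle_group Q AI \<chi>'\<^esub>"
  by (auto simp: relative_cocycle_def derivationD[OF d] intro!: restrict_ext)

text \<open>A relative cochain that vanishes on \<open>I\<close> is inflated from a cochain \<open>g\<close> of \<open>Q\<close> with invariant
  values, so its cocycle is the coboundary of \<open>g\<close>.\<close>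

lemma relative_cocycle_coboundary:
  assumes k: "relative_cochain k" and kI: "\<And>n. n \<in> I \<Longrightarrow> k n = \<one>"
  shows "relative_cocycle k \<in> coboundaries Q AI \<chi>'"
proof -
  note kD = relative_cochainD[OF k]
  have left: "k (n \<cdot> m) = \<sigma> n (k m)" and right: "k (m \<cdot> n) = k m"
    if "n \<in> I" "m \<in> carrier M" for n m
    using that kD(1)[of m] by (simp_all add: kD(2,3) kI)
  note inv_val = cochain_descends(1)[of k, OF kD(1) left right]
    and fibre = cochain_descends(2)[of k, OF kD(1) left right]
  let ?g = "\<lambda>q. k (l q)"
  have g: "?g \<in> carrier Q \<rightarrow> invariants I A \<chi>" using inv_val by simp
  have g1: "?g \<one>\<^bsub>Q\<^esub> = \<one>" by (simp add: kI)
  have "coboundary M A \<chi> (\<lambda>m. ?g (\<pi> m)) = coboundary M A \<chi> k"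
    by (auto simp: coboundary_def fibre simp del: pi.hom_mult pi_bracket intro!: restrict_ext)
  then have "inflate_cocycle M \<pi> (relative_cocycle k) = inflate_cocycle M \<pi> (coboundary Q AI \<chi>' ?g)"
    using inflate_coboundary[OF g] inflate_relative_cocycle[OF k] by simp
  then have "relative_cocycle k = coboundary Q AI \<chi>' ?g"
    using g g1 by (intro inflate_cocycle_inj relative_cocycle_closed[OF k] Q.coboundary_in_cocycles) simp_all
  then show ?thesis using g g1 by (auto simp: coboundaries_eq)
qed

text \<open>The class of the cocycle therefore depends only on the class of the restriction to \<open>I\<close>.\<close>

lemma relative_cocycle_class:
  assumes h: "relative_cochain h" and k: "relative_cochain k"
    and p: "p \<in> principal_derivations MI A \<chi>"
    and eq: "\<And>n. n \<in> I \<Longrightarrow> k n = p n \<otimes> h n"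
  shows "H2_class Q AI \<chi>' (relative_cocycle k) = H2_class Q AI \<chi>' (relative_cocycle h)"
proof -
  obtain e where e: "e \<in> principal_derivations M A \<chi>" "p = restrict e I"
    using p unfolding restrict_principal[symmetric] by blast
  have eM: "e \<in> derivations M A \<chi>"
    using e(1) principal_derivation_closed by (auto simp: principal_derivations_def)
  have er: "relative_cochain e" by (rule derivation_relative[OF eM])
  note hv [simp] = relative_cochainD(1)[OF h] and kv [simp] = relative_cochainD(1)[OF k]
    and ev [simp] = derivationD(1)[OF eM]
  let ?f = "\<lambda>m. k m \<otimes> inv (e m \<otimes> h m)"
  have eh: "relative_cochain (\<lambda>m. e m \<otimes> h m)" by (rule relative_cochain_mult[OF er h])
  have f: "relative_cochain ?f"
    by (rule relative_cochain_mult[OF k relative_cochain_inv[OF eh]])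
  have fI: "?f n = \<one>" if "n \<in> I" for n
    using that by (simp add: eq e(2))
  have C: "comm_group (cocycle_group Q AI \<chi>')" by (rule Q.comm_group_cocycle_group)
  interpret C: comm_group "cocycle_group Q AI \<chi>'" by (rule C)
  have cl: "relative_cocycle h \<in> cocycles Q AI \<chi>'" "relative_cocycle k \<in> cocycles Q AI \<chi>'"
    using relative_cocycle_closed h k by blast+
  have "relative_cocycle k = relative_cocycle (\<lambda>m. ?f m \<otimes> (e m \<otimes> h m))"
    by (rule relative_cocycle_cong) (simp add: A.m_assoc)
  also have "\<dots> = relative_cocycle ?f \<otimes>\<^bsub>cocycle_group Q AI \<chi>'\<^esub> relative_cocycle h"
    using cl C.l_one
    by (simp add: relative_cocycle_mult[OF f eh] relative_cocycle_mult[OF er h]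
        relative_cocycle_derivation[OF eM] del: one_cocycle_group)
  finally have k_eq: "relative_cocycle k = \<dots>" .
  have "H2_class Q AI \<chi>' (relative_cocycle h) = H2_class Q AI \<chi>' (relative_cocycle k)"
    unfolding H2_class_def
    using relative_cocycle_coboundary[OF f fI] k_eq cl
    by (subst r_coset_eq_iff[OF C Q.coboundaries_subgroup]) auto
  then show ?thesis by simp
qed


section \<open>The transgression as a connecting map\<close>

text \<open>The \<open>A\<close>-component of \<open>(d n, n) (\<eta> x, x)\<close> in the split extension, where \<open>m = n x\<close> with \<open>n \<in> I\<close> and
  \<open>x\<close> in the image of the section \<open>l\<close>.\<close>

definition transgression_lift :: "('m \<Rightarrow> 'a) \<Rightarrow> ('m \<Rightarrow> 'a) \<Rightarrow> 'm \<Rightarrow> 'a" where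
  "transgression_lift d \<eta> m =
     (let n = m \<cdot> inv\<^bsub>M\<^esub> l (\<pi> m) in d n \<otimes> \<sigma> n (\<eta> (l (\<pi> m))))"

lemma transgression_lift_eq:
  assumes "n \<in> I" "q \<in> carrier Q"
  shows "transgression_lift d \<eta> (n \<cdot> l q) = d n \<otimes> \<sigma> n (\<eta> (l q))"
proof -
  have "\<pi> (n \<cdot> l q) = q" using assms I_iff by simp
  moreover have "n \<cdot> l q \<cdot> inv\<^bsub>M\<^esub> l q = n" using assms by (simp add: M.m_assoc)
  ultimately show ?thesis by (simp add: transgression_lift_def)
qed

lemma fibre_cases:
  assumes "m \<in> carrier M"
  obtains n q where "n \<in> I" "q \<in> carrier Q" "m = n \<cdot> l q"
proof -
  have "\<exists>n\<in>I. m = n \<cdot> l (\<pi> m)" using assms by (intro same_fibre) simp_all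
  then show thesis using that[of _ "\<pi> m"] assms by auto
qed

lemma square_witnessD:
  assumes d: "d \<in> derivations MI A \<chi>" and w: "square_witness M I A \<chi> d \<eta>"
  shows "m \<in> carrier M \<Longrightarrow> \<eta> m \<in> carrier A" and "\<eta> \<one>\<^bsub>M\<^esub> = \<one>"
    and "\<lbrakk>m \<in> carrier M; n \<in> I\<rbrakk> \<Longrightarrow> \<eta> m \<otimes> \<sigma> m (d n) = d (m \<cdot> n \<cdot> inv\<^bsub>M\<^esub> m) \<otimes> \<sigma> (m \<cdot> n \<cdot> inv\<^bsub>M\<^esub> m) (\<eta> m)"
    and "\<lbrakk>m \<in> carrier M; n \<in> I\<rbrakk> \<Longrightarrow> d \<lbrace>m, n\<rbrace>\<^bsub>M\<^esub> = bp m n (\<eta> m) (d n)"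
proof -
  have dv: "d \<in> I \<rightarrow> carrier A" using I.derivationD(1)[OF d] by simp
  note w' = w[unfolded square_witness_iff[OF dv]]
  show "m \<in> carrier M \<Longrightarrow> \<eta> m \<in> carrier A" "\<eta> \<one>\<^bsub>M\<^esub> = \<one>"
    "\<lbrakk>m \<in> carrier M; n \<in> I\<rbrakk> \<Longrightarrow> d \<lbrace>m, n\<rbrace>\<^bsub>M\<^esub> = bp m n (\<eta> m) (d n)"
    using w' by blast+
  assume m: "m \<in> carrier M" and n: "n \<in> I"
  let ?n = "m \<cdot> n \<cdot> inv\<^bsub>M\<^esub> m"
  have "inv\<^bsub>M\<^esub> m \<cdot> ?n \<cdot> m = n" using m n by (simp add: M.m_assoc)
  moreover have "\<eta> m \<otimes> \<sigma> m (d (inv\<^bsub>M\<^esub> m \<cdot> ?n \<cdot> m)) = d ?n \<otimes> \<sigma> ?n (\<eta> m)"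
    using w' m I_conj(1)[OF m n] by blast
  ultimately show "\<eta> m \<otimes> \<sigma> m (d n) = d ?n \<otimes> \<sigma> ?n (\<eta> m)" by simp
qed

text \<open>The square condition at \<open>x\<close> moves elements of \<open>I\<close> past \<open>(\<eta> x, x)\<close>, so the compatibility of \<open>d\<close> with
  products and brackets in \<open>I\<close> extends to products and brackets of \<open>I\<close> with \<open>M\<close>.\<close>

lemma transgression_lift_relative:
  assumes d: "d \<in> derivations MI A \<chi>" and w: "square_witness M I A \<chi> d \<eta>"
  shows "relative_cochain (transgression_lift d \<eta>)"
    and "n \<in> I \<Longrightarrow> transgression_lift d \<eta> n = d n"
    and "q \<in> carrier Q \<Longrightarrow> transgression_lift d \<eta> (l q) = \<eta> (l q)"
proof -
  let ?h = "transgression_lift d \<eta>"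
  have dv [simp]: "d n \<in> carrier A" if "n \<in> I" for n using I.derivationD(1)[OF d] that by simp
  have dmult: "d (n \<cdot> k) = d n \<otimes> \<sigma> n (d k)" and dbr: "d \<lbrace>n, k\<rbrace>\<^bsub>M\<^esub> = bp n k (d n) (d k)"
    if "n \<in> I" "k \<in> I" for n k
    using I.derivationD(2,3)[OF d, of n k] that by simp_all
  note wD = square_witnessD[OF d w]
  note [simp] = wD(1)
  have d1: "d \<one>\<^bsub>M\<^esub> = \<one>" using I.derivation_one[OF d] by simp
  show hI: "?h n = d n" if "n \<in> I" for n
    using transgression_lift_eq[of n "\<one>\<^bsub>Q\<^esub>" d \<eta>] that by (simp add: wD(2))
  show "?h (l q) = \<eta> (l q)" if "q \<in> carrier Q" for q
    using transgression_lift_eq[of "\<one>\<^bsub>M\<^esub>" q d \<eta>] that by (simp add: d1)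
  have h_closed: "?h m \<in> carrier A" if "m \<in> carrier M" for m
    using fibre_cases[OF that] by (metis A.m_closed I_carrier dv section_closed sigma_closed transgression_lift_eq wD(1))
  have "?h (n \<cdot> m) = ?h n \<otimes> \<sigma> n (?h m) \<and> ?h (m \<cdot> n) = ?h m \<otimes> \<sigma> m (?h n)
      \<and> ?h \<lbrace>m, n\<rbrace>\<^bsub>M\<^esub> = bp m n (?h m) (?h n)"
    if m: "m \<in> carrier M" and n: "n \<in> I" for m n
  proof (intro conjI)
    obtain k q where k: "k \<in> I" "q \<in> carrier Q" "m = k \<cdot> l q" using fibre_cases[OF m] .
    have "?h (n \<cdot> m) = ?h (n \<cdot> k \<cdot> l q)" using k n by (simp add: M.m_assoc)
    also have "\<dots> = ?h n \<otimes> \<sigma> n (?h m)"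
      using k n by (subst transgression_lift_eq) (simp_all add: transgression_lift_eq hI dmult sigma_mult sigma_comp A.m_assoc)
    finally show "?h (n \<cdot> m) = ?h n \<otimes> \<sigma> n (?h m)" .
    let ?n = "l q \<cdot> n \<cdot> inv\<^bsub>M\<^esub> l q"
    have nI: "?n \<in> I" using k n by simp
    have "?h (m \<cdot> n) = ?h (k \<cdot> ?n \<cdot> l q)" using k n by (simp add: M.m_assoc)
    also have "\<dots> = d (k \<cdot> ?n) \<otimes> \<sigma> (k \<cdot> ?n) (\<eta> (l q))"
      using k(1,2) nI by (intro transgression_lift_eq) simp_all
    also have "\<dots> = d k \<otimes> \<sigma> k (d ?n \<otimes> \<sigma> ?n (\<eta> (l q)))"
      using k(1,2) nI by (simp only: dmult) (simp add: sigma_comp sigma_mult A.m_assoc)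
    also have "d ?n \<otimes> \<sigma> ?n (\<eta> (l q)) = \<eta> (l q) \<otimes> \<sigma> (l q) (d n)"
      using wD(3)[of "l q" n] k(2) n by simp
    also have "d k \<otimes> \<sigma> k (\<eta> (l q) \<otimes> \<sigma> (l q) (d n)) = ?h m \<otimes> \<sigma> m (?h n)"
      using k n by (simp add: transgression_lift_eq hI sigma_mult sigma_comp A.m_assoc)
    finally show "?h (m \<cdot> n) = ?h m \<otimes> \<sigma> m (?h n)" .
    \<comment> \<open>in the split extension, \<open>s m = t k \<otimes> (\<eta> x, x)\<close> with \<open>t k = (d k, k)\<close> and \<open>x = l q\<close>\<close>
    define t where "t n = (d n, n)" for n
    have t_closed [simp]: "t n \<in> carrier E" if "n \<in> I" for n using that by (simp add: t_def)
    have t_mult: "t n \<bullet> t j = t (n \<cdot> j)" and t_br: "\<lbrace>t n, t j\<rbrace>\<^bsub>E\<^esub> = t \<lbrace>n, j\<rbrace>\<^bsub>M\<^esub>"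
      if "n \<in> I" "j \<in> I" for n j
      using that by (simp_all add: t_def dmult dbr)
    note E_simps = carrier_cocycle_algebra one_cocycle_algebra mult_cocycle_algebra bracket_cocycle_algebra
    have t_conj: "conj_by E (t n) (t j) = t (conj_by M n j)" if n: "n \<in> I" and j: "j \<in> I" for n j
    proof -
      have I: "conj_by M n j \<in> I" using n j by (simp add: conj_by_def)
      have "t j \<bullet> t n = t (conj_by M n j \<cdot> j)"
        using n j by (simp add: t_mult conj_by_def M.m_assoc del: E_simps)
      also have "\<dots> = t (conj_by M n j) \<bullet> t j" using I j by (simp add: t_mult del: E_simps)
      finally show ?thesis
        unfolding conj_by_def[of E] using n j I by (intro E.inv_solve_right'[THEN iffD2]) (simp_all del: E_simps)
    qed
    let ?x = "(\<eta> (l q), l q)"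
    have x: "?x \<in> carrier E" using k(2) by simp
    have xn: "\<lbrace>?x, t n\<rbrace>\<^bsub>E\<^esub> = t \<lbrace>l q, n\<rbrace>\<^bsub>M\<^esub>"
      using k(2) n by (simp add: t_def wD(4))
    have sm: "t k \<bullet> ?x = (?h m, m)"
      using k by (simp add: t_def transgression_lift_eq)
    have "\<lbrace>(?h m, m), t n\<rbrace>\<^bsub>E\<^esub> = t (conj_by M \<lbrace>l q, n\<rbrace>\<^bsub>M\<^esub> k) \<bullet> t \<lbrace>k, n\<rbrace>\<^bsub>M\<^esub>"
      unfolding sm[symmetric] using k(1,2) n x
      by (subst E.bracket_mult_left) (simp_all add: xn t_conj t_br del: E_simps)
    also have "\<dots> = t (conj_by M \<lbrace>l q, n\<rbrace>\<^bsub>M\<^esub> k \<cdot> \<lbrace>k, n\<rbrace>\<^bsub>M\<^esub>)"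
      using k n by (intro t_mult) (simp_all add: conj_by_def)
    also have "conj_by M \<lbrace>l q, n\<rbrace>\<^bsub>M\<^esub> k \<cdot> \<lbrace>k, n\<rbrace>\<^bsub>M\<^esub> = \<lbrace>m, n\<rbrace>\<^bsub>M\<^esub>"
      unfolding k(3) using k(1,2) n by (intro M.bracket_mult_left[symmetric]) simp_all
    finally show "?h \<lbrace>m, n\<rbrace>\<^bsub>M\<^esub> = bp m n (?h m) (?h n)"
      using m n h_closed by (simp add: t_def hI)
  qed
  then show "relative_cochain ?h" using h_closed by (simp add: relative_cochain_def)
qed

text \<open>The transgression formula is the coboundary of the lift at the points of the section, because
  \<open>l x l y = T l(xy)\<close> and \<open>{l x, l y} = T\<^sub>f l{x,y}\<close> with \<open>T\<close> and \<open>T\<^sub>f\<close> in \<open>I\<close>.\<close>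

lemma transgression_cocycle_eq:
  assumes d: "d \<in> derivations MI A \<chi>" and w: "square_witness M I A \<chi> d \<eta>"
  shows "transgression_cocycle M Q A \<chi> l d \<eta> = relative_cocycle (transgression_lift d \<eta>)"
proof -
  let ?h = "transgression_lift d \<eta>"
  have lift: "?h u = d (u \<cdot> inv\<^bsub>M\<^esub> l q) \<otimes> \<sigma> (u \<cdot> inv\<^bsub>M\<^esub> l q) (\<eta> (l q))"
    if "u \<in> carrier M" "\<pi> u = q" for u q
    using that by (simp add: transgression_lift_def Let_def)
  have [simp]: "d n \<in> carrier A" if "n \<in> I" for n using I.derivationD(1)[OF d] that by simp
  note [simp] = square_witnessD(1)[OF d w] transgression_lift_relative(3)[OF d w]
  have I: "u \<cdot> inv\<^bsub>M\<^esub> l q \<in> I" if "u \<in> carrier M" "\<pi> u = q" for u q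
    using that by (intro I_iff[THEN iffD2]) auto
  have inv_lift: "a \<otimes> inv (?h u) = a \<otimes> inv (\<sigma> (u \<cdot> inv\<^bsub>M\<^esub> l q) (\<eta> (l q))) \<otimes> inv (d (u \<cdot> inv\<^bsub>M\<^esub> l q))"
    if "u \<in> carrier M" "\<pi> u = q" "a \<in> carrier A" for u q a
  proof -
    have "q \<in> carrier Q" using that by auto
    then show ?thesis using that I[OF that(1,2)] lift[OF that(1,2)] by (simp add: A.inv_mult A.m_ac)
  qed
  show ?thesis
    unfolding transgression_cocycle_def relative_cocycle_def Let_def
    by (auto simp: inv_lift intro!: restrict_ext)
qed

lemma square_derivation_lift:
  assumes "d \<in> square_derivations M I A \<chi>"
  obtains h where "relative_cochain h" "d = restrict h I"
proof -
  obtain \<eta> where d: "d \<in> derivations MI A \<chi>" and w: "square_witness M I A \<chi> d \<eta>"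
    using assms by (auto simp: square_derivations_def)
  have "d = restrict (transgression_lift d \<eta>) I"
    using I.derivationD(4)[OF d] transgression_lift_relative(2)[OF d w]
    by (intro extensionalityI[of d I]) simp_all
  then show thesis using that transgression_lift_relative(1)[OF d w] by blast
qed

lemma square_derivations_eq:
  "square_derivations M I A \<chi> = (\<lambda>h. restrict h I) ` {h. relative_cochain h}"
  using relative_cochain_square(1) square_derivation_lift by blast


abbreviation inf1 where "inf1 \<equiv> inflation1 M \<pi> A \<chi>"
abbreviation res where "res \<equiv> restriction1 M I A \<chi>"
abbreviation tra where "tra \<equiv> transgression M I Q \<pi> A \<chi> l"
abbreviation inf2 where "inf2 \<equiv> inflation2 M \<pi> A \<chi>"

lemma inf1_class:
  assumes "d \<in> derivations Q AI \<chi>'"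
  shows "inf1 (H1_class Q AI \<chi>' d) = H1_class M A \<chi> (inflate_derivation M \<pi> d)"
  unfolding inflation1_def H1_class_def
  by (rule the_elem_hom_r_coset[OF Q.comm_group_derivation_group Q.principal_subgroup
        comm_group_derivation_group principal_subgroup inflate_derivation_hom inflate_principal])
     (use assms in simp_all)

lemma res_class:
  assumes "d \<in> derivations M A \<chi>"
  shows "res (H1_class M A \<chi> d) = H1_class MI A \<chi> (restrict d I)"
  unfolding restriction1_def H1_class_def
  by (rule the_elem_hom_r_coset[OF comm_group_derivation_group principal_subgroup
        I.comm_group_derivation_group I.principal_subgroup restrict_derivation_hom])
     (use assms restrict_principal in auto)

lemma inf2_class:
  assumes "c \<in> cocycles Q AI \<chi>'"
  shows "inf2 (H2_class Q AI \<chi>' c) = H2_class M A \<chi> (inflate_cocycle M \<pi> c)"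
  unfolding inflation2_def H2_class_def
proof (rule the_elem_hom_r_coset[OF Q.comm_group_cocycle_group Q.coboundaries_subgroup
        comm_group_cocycle_group coboundaries_subgroup inflate_cocycle_hom])
  fix c assume "c \<in> coboundaries Q AI \<chi>'"
  then obtain g where g: "g \<in> carrier Q \<rightarrow> invariants I A \<chi>" "g \<one>\<^bsub>Q\<^esub> = \<one>" "c = coboundary Q AI \<chi>' g"
    by (auto simp: coboundaries_eq)
  then have "inflate_cocycle M \<pi> c = coboundary M A \<chi> (\<lambda>m. g (\<pi> m))"
    using inflate_coboundary by simp
  moreover have "(\<lambda>m. g (\<pi> m)) \<in> carrier M \<rightarrow> carrier A" "g (\<pi> \<one>\<^bsub>M\<^esub>) = \<one>"
    using g by (auto simp: Pi_iff)
  ultimately show "inflate_cocycle M \<pi> c \<in> coboundaries M A \<chi>" by (auto simp: coboundaries_eq)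
qed (use assms in simp)

text \<open>All choices in the definition of the transgression lead to relative cochains whose restrictions
  to \<open>I\<close> differ by principal derivations.\<close>

lemma tra_class:
  assumes h: "relative_cochain h"
  shows "tra (H1_class MI A \<chi> (restrict h I)) = H2_class Q AI \<chi>' (relative_cocycle h)"
  unfolding transgression_def
proof -
  let ?d = "restrict h I"
  let ?P = "\<lambda>d \<eta>. d \<in> H1_class MI A \<chi> ?d \<and> d \<in> square_derivations M I A \<chi> \<and>
                       square_witness M I A \<chi> d \<eta> \<and> (\<forall>n\<in>I. \<eta> n = d n)"
  let ?F = "\<lambda>d \<eta>. H2_class Q AI \<chi>' (transgression_cocycle M Q A \<chi> l d \<eta>)"
  have val: "?F d \<eta> = H2_class Q AI \<chi>' (relative_cocycle h)" if P: "?P d \<eta>" for d \<eta>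
  proof -
    have d: "d \<in> derivations MI A \<chi>" and w: "square_witness M I A \<chi> d \<eta>"
      using P by (auto simp: square_derivations_def)
    obtain p where p: "p \<in> principal_derivations MI A \<chi>" "d = p \<otimes>\<^bsub>derivation_group MI A \<chi>\<^esub> ?d"
      using P by (auto simp: H1_class_def r_coset_def)
    have "H2_class Q AI \<chi>' (relative_cocycle (transgression_lift d \<eta>)) = H2_class Q AI \<chi>' (relative_cocycle h)"
      by (rule relative_cocycle_class[OF h transgression_lift_relative(1)[OF d w] p(1)])
         (simp add: transgression_lift_relative(2)[OF d w], simp add: p(2))
    then show ?thesis by (simp add: transgression_cocycle_eq[OF d w])
  qed
  have "?d \<in> H1_class MI A \<chi> ?d"
    unfolding H1_class_def
    using relative_cochain_square(1)[OF h] I.principal_subgroup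
    by (intro group.rcos_self comm_group.axioms(2)[OF I.comm_group_derivation_group])
       (auto simp: square_derivations_def)
  then have "?P ?d h" using relative_cochain_square[OF h] by simp
  then have "{?F d \<eta> | d \<eta>. ?P d \<eta>} = {H2_class Q AI \<chi>' (relative_cocycle h)}"
    using val by (auto intro!: exI)
  then show "the_elem {?F d \<eta> | d \<eta>. ?P d \<eta>} = H2_class Q AI \<chi>' (relative_cocycle h)" by simp
qed

lemma square_witness_extends:
  assumes d: "d \<in> square_derivations M I A \<chi>"
  shows "\<exists>\<eta>. square_witness M I A \<chi> d \<eta> \<and> (\<forall>n\<in>I. \<eta> n = d n)"
proof -
  obtain h where "relative_cochain h" "d = restrict h I" using square_derivation_lift[OF d] .
  then show ?thesis using relative_cochain_square(2)[of h] by auto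
qed

lemma tra_class_witness:
  assumes d: "d \<in> square_derivations M I A \<chi>" and w: "square_witness M I A \<chi> d \<eta>"
  shows "tra (H1_class MI A \<chi> d) = H2_class Q AI \<chi>' (transgression_cocycle M Q A \<chi> l d \<eta>)"
proof -
  have dI: "d \<in> derivations MI A \<chi>" using d by (simp add: square_derivations_def)
  have "d = restrict (transgression_lift d \<eta>) I"
    using I.derivationD(4)[OF dI] transgression_lift_relative(2)[OF dI w]
    by (intro extensionalityI[of d I]) simp_all
  then show ?thesis
    using tra_class[OF transgression_lift_relative(1)[OF dI w]] by (simp add: transgression_cocycle_eq[OF dI w])
qed


section \<open>The group of square classes\<close>

abbreviation square_group where
  "square_group \<equiv> (derivation_group MI A \<chi>)\<lparr>carrier := square_derivations M I A \<chi>\<rparr>"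

lemma square_derivations_subgroup: "subgroup (square_derivations M I A \<chi>) (derivation_group MI A \<chi>)"
proof -
  interpret D: comm_group "derivation_group MI A \<chi>" by (rule I.comm_group_derivation_group)
  show ?thesis
  proof (rule D.subgroupI)
    show "square_derivations M I A \<chi> \<subseteq> carrier (derivation_group MI A \<chi>)"
      by (auto simp: square_derivations_def)
    have "relative_cochain (\<lambda>x\<in>carrier M. \<one> \<otimes> inv (\<sigma> x \<one>))"
      by (intro derivation_relative principal_derivation_closed A.one_closed)
    then show "square_derivations M I A \<chi> \<noteq> {}" unfolding square_derivations_eq by blast
  next
    fix d assume "d \<in> square_derivations M I A \<chi>"
    then obtain h where h: "relative_cochain h" "d = restrict h I" by (rule square_derivation_lift)
    have dI: "d \<in> derivations MI A \<chi>"
      using relative_cochain_square(1)[OF h(1)] by (simp add: square_derivations_def h(2))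
    have "inv\<^bsub>derivation_group MI A \<chi>\<^esub> d = restrict (\<lambda>m. inv (h m)) I"
      unfolding I.derivation_group_inv[OF dI] by (auto simp: h(2) intro!: restrict_ext)
    then show "inv\<^bsub>derivation_group MI A \<chi>\<^esub> d \<in> square_derivations M I A \<chi>"
      using relative_cochain_inv[OF h(1)] unfolding square_derivations_eq by blast
  next
    fix d e assume "d \<in> square_derivations M I A \<chi>" "e \<in> square_derivations M I A \<chi>"
    then obtain h k where h: "relative_cochain h" "d = restrict h I" and k: "relative_cochain k" "e = restrict k I"
      using square_derivation_lift by metis
    have "d \<otimes>\<^bsub>derivation_group MI A \<chi>\<^esub> e = restrict (\<lambda>m. h m \<otimes> k m) I"
      by (auto simp: h(2) k(2) intro!: restrict_ext)
    then show "d \<otimes>\<^bsub>derivation_group MI A \<chi>\<^esub> e \<in> square_derivations M I A \<chi>"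
      using relative_cochain_mult[OF h(1) k(1)] unfolding square_derivations_eq by blast
  qed
qed

lemma comm_group_square_group: "comm_group square_group"
  by (intro comm_group_subgroup I.comm_group_derivation_group square_derivations_subgroup)

lemma restrict_derivation_square:
  "d \<in> derivations M A \<chi> \<Longrightarrow> restrict d I \<in> square_derivations M I A \<chi>"
  using derivation_relative relative_cochain_square(1) by blast

lemma principal_subset_square: "principal_derivations MI A \<chi> \<subseteq> square_derivations M I A \<chi>"
proof
  fix p assume "p \<in> principal_derivations MI A \<chi>"
  then obtain e where "e \<in> principal_derivations M A \<chi>" "p = restrict e I"
    unfolding restrict_principal[symmetric] by blast
  then show "p \<in> square_derivations M I A \<chi>"
    using restrict_derivation_square subgroup.subset[OF principal_subgroup] by auto
qed

lemma principal_subgroup_square: "subgroup (principal_derivations MI A \<chi>) square_group"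
  by (rule group.subgroup_incl[OF comm_group.axioms(2)[OF I.comm_group_derivation_group]
        I.principal_subgroup square_derivations_subgroup principal_subset_square])

text \<open>Seen as a quotient of the group of square derivations, this group falls under
  \<open>hom_from_quotient\<close>.\<close>

lemma H1_square_eq: "H1_square M I A \<chi> = square_group Mod principal_derivations MI A \<chi>"
  by (auto simp: H1_square_def H1_def FactGroup_def RCOSETS_def H1_class_def r_coset_def set_mult_def fun_eq_iff)

lemma H1_class_square: "H1_class MI A \<chi> d = principal_derivations MI A \<chi> #>\<^bsub>square_group\<^esub> d"
  by (simp add: H1_class_def r_coset_def)

lemma group_H1_square: "group (H1_square M I A \<chi>)"
  unfolding H1_square_eq
  by (intro comm_group.axioms(2) comm_group.abelian_FactGroup comm_group_square_group principal_subgroup_square)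

lemma one_H1_square [simp]: "\<one>\<^bsub>H1_square M I A \<chi>\<^esub> = \<one>\<^bsub>H1 MI A \<chi>\<^esub>"
  by (simp add: H1_square_def)

lemma H1_class_square_hom: "H1_class MI A \<chi> \<in> hom square_group (H1_square M I A \<chi>)"
  unfolding H1_square_eq H1_class_square
  by (rule r_coset_hom[OF comm_group_square_group principal_subgroup_square])


section \<open>Exactness\<close>

lemma restrict_square_hom: "(\<lambda>d. restrict d I) \<in> hom (derivation_group M A \<chi>) square_group"
  by (rule homI) (auto simp: restrict_derivation_square intro!: restrict_ext)

lemma hom_inf1:
  shows "inf1 \<in> hom (H1 Q AI \<chi>') (H1 M A \<chi>)"
    and "inf1 ` carrier (H1 Q AI \<chi>') = H1_class M A \<chi> ` inflate_derivation M \<pi> ` derivations Q AI \<chi>'"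
    and "kernel (H1 Q AI \<chi>') (H1 M A \<chi>) inf1 = H1_class Q AI \<chi>' ` {d \<in> derivations Q AI \<chi>'.
           inflate_derivation M \<pi> d \<in> principal_derivations M A \<chi>}"
proof -
  have hom: "(\<lambda>d. H1_class M A \<chi> (inflate_derivation M \<pi> d)) \<in> hom (derivation_group Q AI \<chi>') (H1 M A \<chi>)"
    using hom_compose[OF inflate_derivation_hom H1_class_hom] by (simp add: comp_def)
  have F: "\<forall>d\<in>carrier (derivation_group Q AI \<chi>').
      inf1 (principal_derivations Q AI \<chi>' #>\<^bsub>derivation_group Q AI \<chi>'\<^esub> d) = H1_class M A \<chi> (inflate_derivation M \<pi> d)"
    using inf1_class by (simp add: H1_class_def)
  note q = hom_from_quotient[OF Q.comm_group_derivation_group Q.principal_subgroup hom F,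
      folded H1_def H1_class_def]
  show "inf1 \<in> hom (H1 Q AI \<chi>') (H1 M A \<chi>)" by (rule q(1))
  show "inf1 ` carrier (H1 Q AI \<chi>') = H1_class M A \<chi> ` inflate_derivation M \<pi> ` derivations Q AI \<chi>'"
    using q(2) by (simp add: image_image)
  show "kernel (H1 Q AI \<chi>') (H1 M A \<chi>) inf1 = H1_class Q AI \<chi>' ` {d \<in> derivations Q AI \<chi>'.
           inflate_derivation M \<pi> d \<in> principal_derivations M A \<chi>}"
    by (rule trans[OF q(3)], rule image_cong[OF _ refl])
       (simp add: kernel_def H1_class_eq_one_iff inflate_derivation_closed cong: conj_cong)
qed

lemma hom_res:
  shows "res \<in> hom (H1 M A \<chi>) (H1_square M I A \<chi>)"
    and "res ` carrier (H1 M A \<chi>) = H1_class MI A \<chi> ` (\<lambda>d. restrict d I) ` derivations M A \<chi>"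
    and "kernel (H1 M A \<chi>) (H1_square M I A \<chi>) res = H1_class M A \<chi> ` {d \<in> derivations M A \<chi>.
           restrict d I \<in> principal_derivations MI A \<chi>}"
proof -
  have hom: "(\<lambda>d. H1_class MI A \<chi> (restrict d I)) \<in> hom (derivation_group M A \<chi>) (H1_square M I A \<chi>)"
    using hom_compose[OF restrict_square_hom H1_class_square_hom] by (simp add: comp_def)
  have F: "\<forall>d\<in>carrier (derivation_group M A \<chi>).
      res (principal_derivations M A \<chi> #>\<^bsub>derivation_group M A \<chi>\<^esub> d) = H1_class MI A \<chi> (restrict d I)"
    using res_class by (simp add: H1_class_def)
  note q = hom_from_quotient[OF comm_group_derivation_group principal_subgroup hom F,
      folded H1_def H1_class_def]
  show "res \<in> hom (H1 M A \<chi>) (H1_square M I A \<chi>)" by (rule q(1))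
  show "res ` carrier (H1 M A \<chi>) = H1_class MI A \<chi> ` (\<lambda>d. restrict d I) ` derivations M A \<chi>"
    using q(2) by (simp add: image_image)
  show "kernel (H1 M A \<chi>) (H1_square M I A \<chi>) res = H1_class M A \<chi> ` {d \<in> derivations M A \<chi>.
           restrict d I \<in> principal_derivations MI A \<chi>}"
    by (rule trans[OF q(3)], rule image_cong[OF _ refl])
       (simp add: kernel_def I.H1_class_eq_one_iff restrict_derivation_closed cong: conj_cong)
qed

lemma hom_inf2:
  shows "inf2 \<in> hom (H2 Q AI \<chi>') (H2 M A \<chi>)"
    and "kernel (H2 Q AI \<chi>') (H2 M A \<chi>) inf2 = H2_class Q AI \<chi>' ` {c \<in> cocycles Q AI \<chi>'.
           inflate_cocycle M \<pi> c \<in> coboundaries M A \<chi>}"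
proof -
  have hom: "(\<lambda>c. H2_class M A \<chi> (inflate_cocycle M \<pi> c)) \<in> hom (cocycle_group Q AI \<chi>') (H2 M A \<chi>)"
    using hom_compose[OF inflate_cocycle_hom H2_class_hom] by (simp add: comp_def)
  have F: "\<forall>c\<in>carrier (cocycle_group Q AI \<chi>').
      inf2 (coboundaries Q AI \<chi>' #>\<^bsub>cocycle_group Q AI \<chi>'\<^esub> c) = H2_class M A \<chi> (inflate_cocycle M \<pi> c)"
    using inf2_class unfolding H2_class_def by simp
  note q = hom_from_quotient[OF Q.comm_group_cocycle_group Q.coboundaries_subgroup hom F,
      folded H2_def H2_class_def]
  show "inf2 \<in> hom (H2 Q AI \<chi>') (H2 M A \<chi>)" by (rule q(1))
  show "kernel (H2 Q AI \<chi>') (H2 M A \<chi>) inf2 = H2_class Q AI \<chi>' ` {c \<in> cocycles Q AI \<chi>'.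
           inflate_cocycle M \<pi> c \<in> coboundaries M A \<chi>}"
    by (rule trans[OF q(3)], rule image_cong[OF _ refl])
       (simp add: kernel_def H2_class_eq_one_iff inflate_cocycle_closed cong: conj_cong)
qed

lemma hom_tra:
  shows "tra \<in> hom (H1_square M I A \<chi>) (H2 Q AI \<chi>')"
    and "tra ` carrier (H1_square M I A \<chi>) = H2_class Q AI \<chi>' ` relative_cocycle ` {h. relative_cochain h}"
    and "kernel (H1_square M I A \<chi>) (H2 Q AI \<chi>') tra = H1_class MI A \<chi> ` (\<lambda>h. restrict h I) `
           {h. relative_cochain h \<and> relative_cocycle h \<in> coboundaries Q AI \<chi>'}"
proof -
  let ?\<phi> = "\<lambda>d. tra (H1_class MI A \<chi> d)"
  have hom: "?\<phi> \<in> hom square_group (H2 Q AI \<chi>')"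
  proof (rule homI)
    fix d assume "d \<in> carrier square_group"
    then obtain h where h: "relative_cochain h" "d = restrict h I" using square_derivation_lift by auto
    then show "?\<phi> d \<in> carrier (H2 Q AI \<chi>')"
      using tra_class relative_cocycle_closed Q.H2_class_hom by (auto simp: hom_def Pi_iff)
  next
    fix d e assume "d \<in> carrier square_group" "e \<in> carrier square_group"
    then obtain h k where h: "relative_cochain h" "d = restrict h I" and k: "relative_cochain k" "e = restrict k I"
      using square_derivation_lift by (metis partial_object.select_convs(1) partial_object.surjective partial_object.update_convs(1))
    have de: "d \<otimes>\<^bsub>square_group\<^esub> e = restrict (\<lambda>m. h m \<otimes> k m) I"
      by (auto simp: h(2) k(2) intro!: restrict_ext)
    have "?\<phi> (d \<otimes>\<^bsub>square_group\<^esub> e) = H2_class Q AI \<chi>' (relative_cocycle h \<otimes>\<^bsub>cocycle_group Q AI \<chi>'\<^esub> relative_cocycle k)"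
      unfolding de tra_class[OF relative_cochain_mult[OF h(1) k(1)]] relative_cocycle_mult[OF h(1) k(1)] ..
    also have "\<dots> = H2_class Q AI \<chi>' (relative_cocycle h) \<otimes>\<^bsub>H2 Q AI \<chi>'\<^esub> H2_class Q AI \<chi>' (relative_cocycle k)"
      by (rule hom_mult[OF Q.H2_class_hom]) (simp_all add: relative_cocycle_closed h k)
    also have "\<dots> = ?\<phi> d \<otimes>\<^bsub>H2 Q AI \<chi>'\<^esub> ?\<phi> e"
      unfolding h(2) k(2) tra_class[OF h(1)] tra_class[OF k(1)] ..
    finally show "?\<phi> (d \<otimes>\<^bsub>square_group\<^esub> e) = ?\<phi> d \<otimes>\<^bsub>H2 Q AI \<chi>'\<^esub> ?\<phi> e" .
  qed
  note q = hom_from_quotient[OF comm_group_square_group principal_subgroup_square hom, of tra,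
      folded H1_square_eq H1_class_square, OF ballI[OF refl]]
  show "tra \<in> hom (H1_square M I A \<chi>) (H2 Q AI \<chi>')" by (rule q(1))
  show "tra ` carrier (H1_square M I A \<chi>) = H2_class Q AI \<chi>' ` relative_cocycle ` {h. relative_cochain h}"
    using q(2) by (simp add: square_derivations_eq image_image tra_class cong: image_cong_simp)
  have "kernel square_group (H2 Q AI \<chi>') ?\<phi>
      = (\<lambda>h. restrict h I) ` {h. relative_cochain h \<and> relative_cocycle h \<in> coboundaries Q AI \<chi>'}"
  proof -
    have "tra (H1_class MI A \<chi> (restrict h I)) = \<one>\<^bsub>H2 Q AI \<chi>'\<^esub> \<longleftrightarrow> relative_cocycle h \<in> coboundaries Q AI \<chi>'"
      if "relative_cochain h" for h
      using that by (simp add: tra_class Q.H2_class_eq_one_iff relative_cocycle_closed)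
    then show ?thesis unfolding kernel_def square_derivations_eq partial_object.select_convs
      by (simp add: square_derivations_eq) blast
  qed
  then show "kernel (H1_square M I A \<chi>) (H2 Q AI \<chi>') tra = H1_class MI A \<chi> ` (\<lambda>h. restrict h I) `
           {h. relative_cochain h \<and> relative_cocycle h \<in> coboundaries Q AI \<chi>'}"
    by (intro trans[OF q(3)] arg_cong[where f = "image _"])
qed

text \<open>If \<open>d \<circ> \<pi>\<close> is the principal derivation of \<open>a\<close>, then \<open>a\<close> is fixed by \<open>I\<close>, hence invariant.\<close>

lemma exact_at_H1_Q:
  "exact_at (singleton_group ()) (\<lambda>_. \<one>\<^bsub>H1 Q AI \<chi>'\<^esub>) (H1 Q AI \<chi>') inf1 (H1 M A \<chi>)"
proof -
  interpret H: group "H1 Q AI \<chi>'" by (rule Q.group_H1)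
  have "d \<in> principal_derivations Q AI \<chi>'"
    if d: "d \<in> derivations Q AI \<chi>'" and p: "inflate_derivation M \<pi> d \<in> principal_derivations M A \<chi>" for d
  proof -
    obtain a where a: "a \<in> carrier A" "inflate_derivation M \<pi> d = (\<lambda>x\<in>carrier M. a \<otimes> inv (\<sigma> x a))"
      using p by (auto simp: principal_derivations_def)
    have val: "d (\<pi> m) = a \<otimes> inv (\<sigma> m a)" if "m \<in> carrier M" for m
      using fun_cong[OF a(2), of m] that by (simp add: inflate_derivation_def)
    have "\<sigma> n a = a" if n: "n \<in> I" for n
    proof -
      have "d (\<pi> n) = \<one>" using Q.derivation_one[OF d] I_iff[THEN iffD1, OF n] by simp
      then have "a \<otimes> inv (\<sigma> n a) = \<one>" using val[of n] n by simp
      then show ?thesis by (rule A.eq_of_mult_inv_eq_one) (use a(1) n in simp_all)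
    qed
    then have aI: "a \<in> invariants I A \<chi>" using a(1) by (intro invariants_iff[THEN iffD2]) simp
    have "d q = a \<otimes> inv\<^bsub>AI\<^esub> (sigma \<chi>' q a)" if "q \<in> carrier Q" for q
      using val[of "l q"] induced_action_eq(1)[OF aI, of "l q"] that aI by simp
    then have "d = (\<lambda>q\<in>carrier Q. a \<otimes>\<^bsub>AI\<^esub> inv\<^bsub>AI\<^esub> (sigma \<chi>' q a))"
      using Q.derivationD(4)[OF d] by (intro extensionalityI[of d "carrier Q"]) simp_all
    then show ?thesis using aI by (auto simp: principal_derivations_def)
  qed
  then have "H1_class Q AI \<chi>' d = \<one>\<^bsub>H1 Q AI \<chi>'\<^esub>"
    if "d \<in> derivations Q AI \<chi>'" "inflate_derivation M \<pi> d \<in> principal_derivations M A \<chi>" for d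
    using that Q.H1_class_eq_one_iff by blast
  moreover have "\<one>\<^bsub>H1 Q AI \<chi>'\<^esub> \<in> kernel (H1 Q AI \<chi>') (H1 M A \<chi>) inf1"
    using hom_one[OF hom_inf1(1) Q.group_H1 group_H1] by (simp add: kernel_def)
  ultimately have "kernel (H1 Q AI \<chi>') (H1 M A \<chi>) inf1 = {\<one>\<^bsub>H1 Q AI \<chi>'\<^esub>}"
    unfolding hom_inf1(3) by blast
  then show ?thesis
    using Q.group_H1 group_H1 hom_inf1(1) by (simp add: exact_at_def hom_def)
qed

text \<open>A derivation that is principal on \<open>I\<close> differs by a principal derivation of \<open>M\<close> from one that
  vanishes on \<open>I\<close>.\<close>

lemma exact_at_H1_M: "exact_at (H1 Q AI \<chi>') inf1 (H1 M A \<chi>) res (H1_square M I A \<chi>)"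
proof -
  interpret D: comm_group "derivation_group M A \<chi>" by (rule comm_group_derivation_group)
  have "H1_class M A \<chi> ` inflate_derivation M \<pi> ` derivations Q AI \<chi>'
      = H1_class M A \<chi> ` {d \<in> derivations M A \<chi>. restrict d I \<in> principal_derivations MI A \<chi>}"
  proof (intro equalityI subsetI)
    fix c assume "c \<in> H1_class M A \<chi> ` inflate_derivation M \<pi> ` derivations Q AI \<chi>'"
    then obtain e where e: "e \<in> derivations Q AI \<chi>'" "c = H1_class M A \<chi> (inflate_derivation M \<pi> e)" by blast
    have "inflate_derivation M \<pi> e n = \<one> \<otimes> inv (\<sigma> n \<one>)" if "n \<in> I" for n
      using that Q.derivation_one[OF e(1)] I_iff by (simp add: inflate_derivation_def)
    then have "restrict (inflate_derivation M \<pi> e) I = (\<lambda>x\<in>carrier MI. \<one> \<otimes> inv (\<sigma> x \<one>))"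
      by (auto intro!: restrict_ext)
    then have "restrict (inflate_derivation M \<pi> e) I \<in> principal_derivations MI A \<chi>"
      unfolding principal_derivations_def using A.one_closed by blast
    then show "c \<in> H1_class M A \<chi> ` {d \<in> derivations M A \<chi>. restrict d I \<in> principal_derivations MI A \<chi>}"
      using e inflate_derivation_closed by blast
  next
    fix c assume "c \<in> H1_class M A \<chi> ` {d \<in> derivations M A \<chi>. restrict d I \<in> principal_derivations MI A \<chi>}"
    then obtain d where d: "d \<in> derivations M A \<chi>" "restrict d I \<in> principal_derivations MI A \<chi>"
      "c = H1_class M A \<chi> d" by blast
    then obtain p where p: "p \<in> principal_derivations M A \<chi>" "restrict d I = restrict p I"
      unfolding restrict_principal[symmetric] by blast
    have pM: "p \<in> derivations M A \<chi>" using p(1) subgroup.subset[OF principal_subgroup] by auto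
    let ?e = "inv\<^bsub>derivation_group M A \<chi>\<^esub> p \<otimes>\<^bsub>derivation_group M A \<chi>\<^esub> d"
    have e: "?e \<in> derivations M A \<chi>"
      using D.m_closed[OF D.inv_closed[of p], of d] pM d(1) by (simp del: mult_derivation_group)
    have eI: "?e n = \<one>" if "n \<in> I" for n
      using that fun_cong[OF p(2), of n] derivationD(1)[OF pM, of n]
      by (simp add: derivation_group_inv[OF pM])
    obtain f where f: "f \<in> derivations Q AI \<chi>'" "?e = inflate_derivation M \<pi> f"
      using derivation_descends[OF e eI] by blast
    have "d = p \<otimes>\<^bsub>derivation_group M A \<chi>\<^esub> ?e"
      using D.inv_solve_left[of ?e p d] e pM d(1) by (simp del: mult_derivation_group)
    then have "H1_class M A \<chi> ?e = H1_class M A \<chi> d"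
      unfolding H1_class_def using e d(1) p(1)
      by (intro r_coset_eq_iff[OF comm_group_derivation_group principal_subgroup, THEN iffD2]) auto
    then show "c \<in> H1_class M A \<chi> ` inflate_derivation M \<pi> ` derivations Q AI \<chi>'"
      using f d(3) by (metis image_eqI)
  qed
  then show ?thesis
    using Q.group_H1 group_H1 group_H1_square hom_inf1(1,2) hom_res(1,3) by (simp add: exact_at_def)
qed

text \<open>A relative cochain whose cocycle is the coboundary of \<open>g\<close> becomes a derivation of \<open>M\<close> after
  division by \<open>g \<circ> \<pi>\<close>, which is trivial on \<open>I\<close>.\<close>

lemma exact_at_H1_square: "exact_at (H1 M A \<chi>) res (H1_square M I A \<chi>) tra (H2 Q AI \<chi>')"
proof -
  have "(\<lambda>d. restrict d I) ` derivations M A \<chi>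
      = (\<lambda>h. restrict h I) ` {h. relative_cochain h \<and> relative_cocycle h \<in> coboundaries Q AI \<chi>'}"
  proof (intro equalityI subsetI)
    fix c assume "c \<in> (\<lambda>d. restrict d I) ` derivations M A \<chi>"
    then obtain d where d: "d \<in> derivations M A \<chi>" "c = restrict d I" by blast
    have "relative_cocycle d \<in> coboundaries Q AI \<chi>'"
      unfolding relative_cocycle_derivation[OF d(1)] using subgroup.one_closed[OF Q.coboundaries_subgroup] .
    then show "c \<in> (\<lambda>h. restrict h I) ` {h. relative_cochain h \<and> relative_cocycle h \<in> coboundaries Q AI \<chi>'}"
      using d derivation_relative by blast
  next
    fix c assume "c \<in> (\<lambda>h. restrict h I) ` {h. relative_cochain h \<and> relative_cocycle h \<in> coboundaries Q AI \<chi>'}"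
    then obtain h where h: "relative_cochain h" "relative_cocycle h \<in> coboundaries Q AI \<chi>'" "c = restrict h I"
      by blast
    obtain g where g: "g \<in> carrier Q \<rightarrow> invariants I A \<chi>" "g \<one>\<^bsub>Q\<^esub> = \<one>" "relative_cocycle h = coboundary Q AI \<chi>' g"
      using h(2) by (auto simp: coboundaries_eq)
    have gv [simp]: "g q \<in> invariants I A \<chi>" if "q \<in> carrier Q" for q using g(1) that by blast
    note hv [simp] = relative_cochainD(1)[OF h(1)]
    have cob: "coboundary M A \<chi> h = coboundary M A \<chi> (\<lambda>m. g (\<pi> m))"
      using inflate_relative_cocycle[OF h(1)] inflate_coboundary[OF g(1)] g(3) by simp
    let ?d = "\<lambda>m\<in>carrier M. h m \<otimes> inv (g (\<pi> m))"
    have eq1: "cob1 h x y = cob1 (\<lambda>m. g (\<pi> m)) x y" and eq2: "cob2 h x y = cob2 (\<lambda>m. g (\<pi> m)) x y"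
      if "x \<in> carrier M" "y \<in> carrier M" for x y
      using cob that by (auto simp: coboundary_def dest: fun_cong[of _ _ "(x, y)"])
    have quot: "u \<otimes> inv w = v \<otimes> inv z"
      if "v \<otimes> inv u = z \<otimes> inv w" "u \<in> carrier A" "v \<in> carrier A" "w \<in> carrier A" "z \<in> carrier A" for u v w z
      using that A.mult_eq_iff_swap[of w u z v] A.mult_eq_iff_swap[of z w v u] A.mult_eq_iff_swap
      by (metis A.m_comm)
    have "?d \<in> derivations M A \<chi>"
      unfolding derivations_def
    proof (intro CollectI conjI ballI)
      fix x y assume xy: "x \<in> carrier M" "y \<in> carrier M"
      have "h (x \<cdot> y) \<otimes> inv (g (\<pi> (x \<cdot> y))) = h x \<otimes> \<sigma> x (h y) \<otimes> inv (g (\<pi> x) \<otimes> \<sigma> x (g (\<pi> y)))"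
        by (rule quot[OF eq1[OF xy]]) (use xy in simp_all)
      then show "?d (x \<cdot> y) = ?d x \<otimes> \<sigma> x (?d y)"
        using xy by (simp add: sigma_mult sigma_inv A.inv_mult A.m_ac)
      have "h \<lbrace>x, y\<rbrace>\<^bsub>M\<^esub> \<otimes> inv (g (\<pi> \<lbrace>x, y\<rbrace>\<^bsub>M\<^esub>)) = bp x y (h x) (h y) \<otimes> inv (bp x y (g (\<pi> x)) (g (\<pi> y)))"
        by (rule quot[OF eq2[OF xy]]) (use xy in simp_all)
      then show "?d \<lbrace>x, y\<rbrace>\<^bsub>M\<^esub> = bp x y (?d x) (?d y)"
        using xy by (simp add: bp_mult bp_inv)
    qed simp
    moreover have "c = restrict ?d I"
      using g(2) I_iff[THEN iffD1] by (auto simp: h(3) intro!: restrict_ext)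
    ultimately show "c \<in> (\<lambda>d. restrict d I) ` derivations M A \<chi>" by blast
  qed
  then have "res ` carrier (H1 M A \<chi>) = kernel (H1_square M I A \<chi>) (H2 Q AI \<chi>') tra"
    unfolding hom_res(2) hom_tra(3) by (rule arg_cong)
  then show ?thesis
    using group_H1 group_H1_square Q.group_H2 hom_res(1) hom_tra(1) by (simp add: exact_at_def)
qed

text \<open>If the inflation of a cocycle is the coboundary of \<open>h\<close>, then \<open>h\<close> is a relative cochain, because
  normalized cocycles of \<open>Q\<close> vanish when one argument is trivial.\<close>

lemma relative_cochain_of_inflated:
  assumes c: "c \<in> cocycles Q AI \<chi>'" and h: "h \<in> carrier M \<rightarrow> carrier A"
    and eq: "inflate_cocycle M \<pi> c = coboundary M A \<chi> h"
  shows "relative_cochain h"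
proof -
  obtain S Sf where S: "c = (S, Sf)" by (cases c)
  have n: "S (q, \<one>\<^bsub>Q\<^esub>) = \<one>" "S (\<one>\<^bsub>Q\<^esub>, q) = \<one>" "Sf (q, \<one>\<^bsub>Q\<^esub>) = \<one>" if "q \<in> carrier Q" for q
    using c that by (simp_all add: S cocycles_iff normalized_pair_def)
  have hv [simp]: "h m \<in> carrier A" if "m \<in> carrier M" for m using h that by blast
  have val: "S (\<pi> x, \<pi> y) = cob1 h x y" "Sf (\<pi> x, \<pi> y) = cob2 h x y"
    if "x \<in> carrier M" "y \<in> carrier M" for x y
    using eq that by (auto simp: S inflate_cocycle_def coboundary_def dest: fun_cong[of _ _ "(x, y)"])
  have "h (n \<cdot> m) = h n \<otimes> \<sigma> n (h m) \<and> h (m \<cdot> n) = h m \<otimes> \<sigma> m (h n) \<and>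
        h \<lbrace>m, n\<rbrace>\<^bsub>M\<^esub> = bp m n (h m) (h n)" if m: "m \<in> carrier M" and n: "n \<in> I" for m n
  proof (intro conjI; rule A.eq_of_mult_inv_eq_one)
    have pn: "\<pi> n = \<one>\<^bsub>Q\<^esub>" using n I_iff by simp
    show "cob1 h n m = \<one>" using val(1)[of n m] m n \<open>\<And>q. q \<in> carrier Q \<Longrightarrow> S (\<one>\<^bsub>Q\<^esub>, q) = \<one>\<close> by (simp add: pn)
    show "cob1 h m n = \<one>" using val(1)[of m n] m n \<open>\<And>q. q \<in> carrier Q \<Longrightarrow> S (q, \<one>\<^bsub>Q\<^esub>) = \<one>\<close> by (simp add: pn)
    show "cob2 h m n = \<one>" using val(2)[of m n] m n \<open>\<And>q. q \<in> carrier Q \<Longrightarrow> Sf (q, \<one>\<^bsub>Q\<^esub>) = \<one>\<close> by (simp add: pn)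
  qed (use m n in simp_all)
  then show ?thesis using h by (simp add: relative_cochain_def)
qed

lemma exact_at_H2_Q: "exact_at (H1_square M I A \<chi>) tra (H2 Q AI \<chi>') inf2 (H2 M A \<chi>)"
proof -
  have "relative_cocycle ` {h. relative_cochain h}
      = {c \<in> cocycles Q AI \<chi>'. inflate_cocycle M \<pi> c \<in> coboundaries M A \<chi>}"
  proof (intro equalityI subsetI)
    fix c assume "c \<in> relative_cocycle ` {h. relative_cochain h}"
    then obtain h where h: "relative_cochain h" "c = relative_cocycle h" by blast
    have "h \<in> carrier M \<rightarrow> carrier A" using relative_cochainD(1)[OF h(1)] by blast
    then have "coboundary M A \<chi> h \<in> coboundaries M A \<chi>"
      using relative_cochain_one[OF h(1)] by (auto simp: coboundaries_eq)
    then show "c \<in> {c \<in> cocycles Q AI \<chi>'. inflate_cocycle M \<pi> c \<in> coboundaries M A \<chi>}"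
      using relative_cocycle_closed[OF h(1)] inflate_relative_cocycle[OF h(1)] h(2) by simp
  next
    fix c assume "c \<in> {c \<in> cocycles Q AI \<chi>'. inflate_cocycle M \<pi> c \<in> coboundaries M A \<chi>}"
    then obtain h where c: "c \<in> cocycles Q AI \<chi>'" and h: "h \<in> carrier M \<rightarrow> carrier A"
      and eq: "inflate_cocycle M \<pi> c = coboundary M A \<chi> h"
      by (auto simp: coboundaries_eq)
    have r: "relative_cochain h" by (rule relative_cochain_of_inflated[OF c h eq])
    have "c = relative_cocycle h"
      using c relative_cocycle_closed[OF r] by (rule inflate_cocycle_inj) (simp add: eq inflate_relative_cocycle[OF r])
    then show "c \<in> relative_cocycle ` {h. relative_cochain h}" using r by blast
  qed
  then have "tra ` carrier (H1_square M I A \<chi>) = kernel (H2 Q AI \<chi>') (H2 M A \<chi>) inf2"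
    unfolding hom_tra(2) hom_inf2(2) by (rule arg_cong)
  then show ?thesis
    using group_H1_square Q.group_H2 group_H2 hom_tra(1) hom_inf2(1) by (simp add: exact_at_def)
qed

end

theorem theorem5p1:
  fixes M :: "'m mlie" and Q :: "'q mlie" and A :: "'a mlie" and E :: "'e mlie"
    and I :: "'m set" and \<pi> :: "'m \<Rightarrow> 'q" and l :: "'q \<Rightarrow> 'm"
    and \<chi> :: "('m, 'a) action" and i :: "'a \<Rightarrow> 'e" and p :: "'e \<Rightarrow> 'm"
  assumes exact: "mlie_short_exact (M\<lparr>carrier := I\<rparr>) M Q (\<lambda>n. n) \<pi>"
    and abelian: "abelian_mult_lie_algebra A"
    and terms: "action_terms M A \<chi>"
    and realized: "realized_by M A \<chi> E i p"
    and H0_trivial: "H0 M A \<chi> = {\<one>\<^bsub>A\<^esub>}"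
    and sect: "normalized_section M Q \<pi> l"
  shows "let AI = A\<lparr>carrier := invariants I A \<chi>\<rparr>;
             \<chi>' = induced_action M \<pi> \<chi>;
             inf1 = inflation1 M \<pi> A \<chi>;
             res = restriction1 M I A \<chi>;
             tra = transgression M I Q \<pi> A \<chi> l;
             inf2 = inflation2 M \<pi> A \<chi>
         in \<comment> \<open>the induced action terms and the four maps are well defined\<close>
            action_terms Q AI \<chi>' \<and>
            (\<forall>m\<in>carrier M. \<forall>a\<in>carrier AI.
               sigma \<chi>' (\<pi> m) a = sigma \<chi> m a \<and> tau \<chi>' (\<pi> m) a = tau \<chi> m a \<and>
               nu \<chi>' a (\<pi> m) = nu \<chi> a m) \<and>
            (\<forall>d\<in>derivations Q AI \<chi>'.
               inf1 (H1_class Q AI \<chi>' d) = H1_class M A \<chi> (inflate_derivation M \<pi> d)) \<and>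
            (\<forall>d\<in>derivations M A \<chi>.
               res (H1_class M A \<chi> d) = H1_class (M\<lparr>carrier := I\<rparr>) A \<chi> (restrict d I)) \<and>
            (\<forall>d\<in>square_derivations M I A \<chi>.
               (\<exists>\<eta>. square_witness M I A \<chi> d \<eta> \<and> (\<forall>n\<in>I. \<eta> n = d n)) \<and>
               (\<forall>\<eta>. square_witness M I A \<chi> d \<eta> \<and> (\<forall>n\<in>I. \<eta> n = d n) \<longrightarrow>
                  tra (H1_class (M\<lparr>carrier := I\<rparr>) A \<chi> d)
                    = H2_class Q AI \<chi>' (transgression_cocycle M Q A \<chi> l d \<eta>))) \<and>
            (\<forall>s\<in>cocycles Q AI \<chi>'.
               inf2 (H2_class Q AI \<chi>' s) = H2_class M A \<chi> (inflate_cocycle M \<pi> s)) \<and>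
            \<comment> \<open>exactness\<close>
            exact_at (singleton_group ()) (\<lambda>_. \<one>\<^bsub>H1 Q AI \<chi>'\<^esub>) (H1 Q AI \<chi>') inf1 (H1 M A \<chi>) \<and>
            exact_at (H1 Q AI \<chi>') inf1 (H1 M A \<chi>) res (H1_square M I A \<chi>) \<and>
            exact_at (H1 M A \<chi>) res (H1_square M I A \<chi>) tra (H2 Q AI \<chi>') \<and>
            exact_at (H1_square M I A \<chi>) tra (H2 Q AI \<chi>') inf2 (H2 M A \<chi>)"
proof -
  interpret inflation_restriction M A \<chi> I Q \<pi> l
  proof (intro inflation_restriction.intro action_module.intro inflation_restriction_axioms.intro)
    show "mult_lie_algebra M" using exact by (simp add: mlie_short_exact_def)
    show "mult_lie_algebra (semidirect M A \<chi>)" by (rule realized_imp_split[OF abelian terms realized])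
  qed (fact abelian terms exact H0_trivial sect)+
  show ?thesis
    unfolding Let_def
    by (intro conjI ballI allI impI action_terms_induced inf1_class res_class inf2_class
        square_witness_extends tra_class_witness exact_at_H1_Q exact_at_H1_M exact_at_H1_square
        exact_at_H2_Q) simp_all
qed


end
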